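(* Assume that $(B_t)_{t\in[0,T]}$ is a Brownian motion and take $\mathbb{F}:=\mathbb{F}^B$, the filtration generated by $B$. Let $(W_t)_{t\in[0,T]}$ be another Brownian motion, independent of $(B_t)_{t\in[0,T]}$, and consider the process $$V_t:=B_T+\int_t^T\sigma_s\,\mathrm{d}W_s,\qquad\text{with }\int_t^T\sigma_s^2\,\mathrm{d}s<\infty\text{ for all }0\le t\le T.$$ Then, provided that $$\int_0^t\frac{T}{T+\int_s^T\sigma_u^2\,\mathrm{d}u-s}\,\mathrm{d}s<\infty\qquad\text{for all }0\le t<T,$$ the Doob–Meyer decomposition of $(B_t)_{t\in[0,T]}$ in $\mathbb{F}^{B,V}$ is given by $$B_t=\tilde W_t+\int_0^t\frac{V_s-B_s}{T+\int_s^T\sigma_u^2\,\mathrm{d}u-s}\,\mathrm{d}s,\qquad 0\le t<T,$$ where $(\tilde W_t)_{t\in[0,T]}$ is a Brownian motion, but correlated with $(V_t)_{t\in[0,T]}$.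
   Context: $T>0$ is a fixed time horizon. $\mathbb{F}^{B,V}$ denotes the filtration generated by the pair of processes $(B,V)$, i.e. the progressive enlargement of $\mathbb{F}^B$ by the information carried by $V$ (taken right-continuous).
   Formalization: The correlation of W̃_t with V_t is asserted (as nonzero covariance) only for those t for which σ is not almost everywhere zero on [0,t]; for σ = 0 one has V = B_T and W̃ is independent of V, so the claim fails there. *)

theory Defs
  imports "HOL-Probability.Probability"
begin

text \<open>
  Processes on the horizon \<open>[0,T]\<close> are functions \<open>real \<Rightarrow> 'a \<Rightarrow> 'b\<close> whose values at times
  outside \<open>[0,T]\<close> are irrelevant. Filtrations are indexed by all reals so that the locale
  \<^locale>\<open>filtration\<close> applies; they are constant from \<open>T\<close> on. Null sets are not
  added to any \<open>\<sigma>\<close>-algebra; path properties are required almost surely.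
\<close>

definition natural_filtration ::
    "'a measure \<Rightarrow> real \<Rightarrow> (real \<Rightarrow> 'a \<Rightarrow> 'b::topological_space) \<Rightarrow> real \<Rightarrow> 'a measure" where
  "natural_filtration M T X t =
     sigma (space M) {X s -` A \<inter> space M | s A. s \<in> {0..min t T} \<and> A \<in> sets borel}"

definition right_cont_filtration :: "(real \<Rightarrow> 'a measure) \<Rightarrow> real \<Rightarrow> 'a measure" where
  "right_cont_filtration F t = sigma (space (F t)) (\<Inter>u\<in>{t<..}. sets (F u))"

definition filtration_on :: "'a measure \<Rightarrow> (real \<Rightarrow> 'a measure) \<Rightarrow> bool" where
  "filtration_on M F \<longleftrightarrow> filtration (space M) F \<and> (\<forall>t. subalgebra M (F t))"

definition adapted_on :: "(real \<Rightarrow> 'a measure) \<Rightarrow> real set \<Rightarrow> (real \<Rightarrow> 'a \<Rightarrow> real) \<Rightarrow> bool" where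
  "adapted_on F I X \<longleftrightarrow> (\<forall>t\<in>I. X t \<in> borel_measurable (F t))"

definition martingale_on ::
    "'a measure \<Rightarrow> (real \<Rightarrow> 'a measure) \<Rightarrow> real set \<Rightarrow> (real \<Rightarrow> 'a \<Rightarrow> real) \<Rightarrow> bool" where
  "martingale_on M F I X \<longleftrightarrow>
     filtration_on M F \<and> adapted_on F I X \<and> (\<forall>t\<in>I. integrable M (X t)) \<and>
     (\<forall>s\<in>I. \<forall>t\<in>I. s \<le> t \<longrightarrow> (AE \<omega> in M. real_cond_exp M (F s) (X t) \<omega> = X s \<omega>))"

text \<open>Standard Brownian motion on \<open>[0,T]\<close> relative to the filtration \<open>F\<close>. A Brownian motion
  without reference to a filtration is one relative to its own natural filtration.\<close>

definition brownian_motion ::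
    "'a measure \<Rightarrow> (real \<Rightarrow> 'a measure) \<Rightarrow> real \<Rightarrow> (real \<Rightarrow> 'a \<Rightarrow> real) \<Rightarrow> bool" where
  "brownian_motion M F T X \<longleftrightarrow>
     filtration_on M F \<and> adapted_on F {0..T} X \<and>
     (AE \<omega> in M. X 0 \<omega> = 0) \<and>
     (AE \<omega> in M. continuous_on {0..T} (\<lambda>t. X t \<omega>)) \<and>
     (\<forall>s t. 0 \<le> s \<and> s < t \<and> t \<le> T \<longrightarrow>
        distributed M lborel (\<lambda>\<omega>. X t \<omega> - X s \<omega>) (normal_density 0 (sqrt (t - s))) \<and>
        prob_space.indep_set M (sets (F s))
          {(\<lambda>\<omega>. X t \<omega> - X s \<omega>) -` A \<inter> space M | A. A \<in> sets borel})"

definition partition_of :: "real \<Rightarrow> real \<Rightarrow> nat \<Rightarrow> (nat \<Rightarrow> real) \<Rightarrow> bool" where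
  "partition_of a b n p \<longleftrightarrow> p 0 = a \<and> p n = b \<and> (\<forall>i<n. p i \<le> p (Suc i))"

definition step_fun :: "nat \<Rightarrow> (nat \<Rightarrow> real) \<Rightarrow> (nat \<Rightarrow> real) \<Rightarrow> real \<Rightarrow> real" where
  "step_fun n p c u = (\<Sum>i<n. c i * indicator {p i<..p (Suc i)} u)"

definition step_integral ::
    "(real \<Rightarrow> 'a \<Rightarrow> real) \<Rightarrow> nat \<Rightarrow> (nat \<Rightarrow> real) \<Rightarrow> (nat \<Rightarrow> real) \<Rightarrow> 'a \<Rightarrow> real" where
  "step_integral W n p c \<omega> = (\<Sum>i<n. c i * (W (p (Suc i)) \<omega> - W (p i) \<omega>))"

text \<open>\<open>X\<close> is (a version of) the stochastic integral of the deterministic function \<open>f\<close> against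
  \<open>W\<close> over \<open>[a,b]\<close>: the \<open>L\<^sup>2\<close>-limit of the integrals of step functions that converge to
  \<open>f\<close> in \<open>L\<^sup>2([a,b])\<close>. By the isometry property this determines \<open>X\<close> up to null sets.\<close>

definition has_wiener_integral ::
    "'a measure \<Rightarrow> (real \<Rightarrow> 'a \<Rightarrow> real) \<Rightarrow> real \<Rightarrow> real \<Rightarrow> (real \<Rightarrow> real) \<Rightarrow> ('a \<Rightarrow> real) \<Rightarrow> bool" where
  "has_wiener_integral M W a b f X \<longleftrightarrow>
     X \<in> borel_measurable M \<and>
     (\<exists>n p c. (\<forall>k::nat. partition_of a b (n k) (p k)) \<and>
        (\<lambda>k. \<integral>\<^sup>+u\<in>{a..b}. ennreal ((step_fun (n k) (p k) (c k) u - f u)\<^sup>2) \<partial>lborel) \<longlonglongrightarrow> 0 \<and>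
        (\<lambda>k. \<integral>\<^sup>+\<omega>. ennreal ((step_integral W (n k) (p k) (c k) \<omega> - X \<omega>)\<^sup>2) \<partial>M) \<longlonglongrightarrow> 0)"

definition finite_variation_on :: "real \<Rightarrow> real \<Rightarrow> (real \<Rightarrow> real) \<Rightarrow> bool" where
  "finite_variation_on a b f \<longleftrightarrow>
     (\<exists>C. \<forall>n p. partition_of a b n p \<longrightarrow> (\<Sum>i<n. \<bar>f (p (Suc i)) - f (p i)\<bar>) \<le> C)"

text \<open>The predictable \<open>\<sigma>\<close>-algebra on \<open>[0,T) \<times> \<Omega>\<close>.\<close>

definition predictable_sigma :: "(real \<Rightarrow> 'a measure) \<Rightarrow> real \<Rightarrow> (real \<times> 'a) measure" where
  "predictable_sigma F T = sigma ({0..<T} \<times> space (F 0))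
     ({{0} \<times> A | A. A \<in> sets (F 0)} \<union>
      {{s<..t} \<times> A | s t A. 0 \<le> s \<and> s < t \<and> t < T \<and> A \<in> sets (F s)})"

text \<open>Doob--Meyer decomposition \<open>X = N + A\<close> on \<open>[0,T)\<close> of a process \<open>X\<close> with continuous paths:
  martingale part \<open>N\<close>, predictable finite-variation part \<open>A\<close> null at \<open>0\<close>, both continuous.\<close>

definition doob_meyer_decomposition ::
    "'a measure \<Rightarrow> (real \<Rightarrow> 'a measure) \<Rightarrow> real \<Rightarrow>
      (real \<Rightarrow> 'a \<Rightarrow> real) \<Rightarrow> (real \<Rightarrow> 'a \<Rightarrow> real) \<Rightarrow> (real \<Rightarrow> 'a \<Rightarrow> real) \<Rightarrow> bool" where
  "doob_meyer_decomposition M F T X N A \<longleftrightarrow>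
     martingale_on M F {0..<T} N \<and>
     (AE \<omega> in M. continuous_on {0..<T} (\<lambda>t. N t \<omega>)) \<and>
     (\<lambda>(t, \<omega>). A t \<omega>) \<in> borel_measurable (predictable_sigma F T) \<and>
     (AE \<omega> in M. A 0 \<omega> = 0) \<and>
     (AE \<omega> in M. continuous_on {0..<T} (\<lambda>t. A t \<omega>)) \<and>
     (AE \<omega> in M. \<forall>t\<in>{0..<T}. finite_variation_on 0 t (\<lambda>s. A s \<omega>)) \<and>
     (AE \<omega> in M. \<forall>t\<in>{0..<T}. X t \<omega> = N t \<omega> + A t \<omega>)"

definition covariance :: "'a measure \<Rightarrow> ('a \<Rightarrow> real) \<Rightarrow> ('a \<Rightarrow> real) \<Rightarrow> real" where
  "covariance M X Y =
     (LINT \<omega>|M. (X \<omega> - (LINT \<omega>'|M. X \<omega>')) * (Y \<omega> - (LINT \<omega>'|M. Y \<omega>')))"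

end

theory Submission
  imports Defs
begin

text \<open>
  Write \<open>D s = T + \<integral>\<^sub>s\<^sup>T \<sigma>\<^sup>2 - s\<close>, the variance of \<open>V s - B s\<close>. Every finite linear combination of values of
  \<open>B\<close> and \<open>V\<close> is a Wiener integral against \<open>(B, W)\<close>, hence centred Gaussian with variance the squared
  \<open>L\<^sup>2\<close> norm of its kernel. The Euler step \<open>B (u + d) - B u - d (V u - B u) / D u\<close> is exactly orthogonal to all
  \<open>B r\<close> and \<open>V r\<close> with \<open>r \<le> u\<close> and has variance \<open>d - d\<^sup>2 / D u\<close>. Summing the steps over a uniform grid of
  \<open>[s, t]\<close> and refining the grid, the sums converge almost surely to the increment of
  \<open>B - \<integral> (V - B) / D\<close>, so the joint characteristic function of this increment with any combination of past
  observations factorizes, with the factor of \<open>N(0, t - s)\<close>. Uniqueness of characteristic functions turns this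
  into independence of the past. The integral converges up to time \<open>T\<close> since
  \<open>E \<bar>V s - B s\<bar> / D s \<le> 1 / sqrt (T - s)\<close>. The covariance with \<open>V t\<close> is \<open>\<integral>\<^sub>0\<^sup>t (D s + s - D t - t) / D s ds\<close>.
\<close>

section \<open>Uniqueness of characteristic functions under weights\<close>

text \<open>The coefficient \<open>d / gap_var u\<close> of an Euler step is the regression
  coefficient of \<open>B (u + d) - B u\<close> on \<open>V u - B u\<close>, covariance
  \<open>d\<close> over variance. Each step is thus a projection residual, and orthogonality is
  exact before any limit is taken. Three obstacles shape the rest. Independence is wanted from a
  sigma-algebra generated by uncountably many observations, while the Gaussian calculus yields only
  transforms of finite linear combinations; nonnegative weights carry these over to events. The
  denominator vanishes at T, so Euler sums run over intervals ending before T, and T itself is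
  reached by path continuity, which needs the drift to be integrable up to T. The variables
  \<open>S t\<close> are given separately for each t and no null sets are added to the filtration;
  hence time integrals enter as limits of left-endpoint sums, both in the moment bound and in the
  measurability proofs.\<close>

lemma integral_iexp_weight:
  fixes f S :: "'a \<Rightarrow> real"
  assumes f: "integrable M f" and [measurable]: "S \<in> borel_measurable M"
  shows "integrable M (\<lambda>x. f x * cos (S x))" "integrable M (\<lambda>x. f x * sin (S x))"
    "integrable M (\<lambda>x. of_real (f x) * iexp (S x))"
    "(CLINT x|M. f x * iexp (S x)) = Complex (\<integral>x. f x * cos (S x) \<partial>M) (\<integral>x. f x * sin (S x) \<partial>M)"
proof -
  have [measurable]: "f \<in> borel_measurable M" using f by simp
  show c: "integrable M (\<lambda>x. f x * cos (S x))"
    by (rule Bochner_Integration.integrable_bound[OF f]) (auto simp: abs_mult mult_left_le)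
  show s: "integrable M (\<lambda>x. f x * sin (S x))"
    by (rule Bochner_Integration.integrable_bound[OF f]) (auto simp: abs_mult mult_left_le)
  have eq: "of_real (f x) * iexp (S x) = of_real (f x * cos (S x)) + \<i> * of_real (f x * sin (S x))" for x
    by (simp add: complex_eq_iff Re_exp Im_exp)
  show "integrable M (\<lambda>x. of_real (f x) * iexp (S x))"
    unfolding eq using c s by (intro Bochner_Integration.integrable_add integrable_mult_right integrable_of_real)
  have "(CLINT x|M. f x * iexp (S x)) = (CLINT x|M. of_real (f x * cos (S x)) + \<i> * of_real (f x * sin (S x)))"
    unfolding eq ..
  also have "\<dots> = (CLINT x|M. of_real (f x * cos (S x))) + \<i> * (CLINT x|M. of_real (f x * sin (S x)))"
    using c s by (subst Bochner_Integration.integral_add) (auto simp del: of_real_mult)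
  also have "\<dots> = Complex (\<integral>x. f x * cos (S x) \<partial>M) (\<integral>x. f x * sin (S x) \<partial>M)"
    by (simp add: complex_eq_iff del: of_real_mult)
  finally show "(CLINT x|M. f x * iexp (S x)) = Complex (\<integral>x. f x * cos (S x) \<partial>M) (\<integral>x. f x * sin (S x) \<partial>M)" .
qed

text \<open>The value \<theta> = 0 forces a common mass c. If c > 0, division by c turns both
  weights into probability densities under which Y has the same characteristic function, hence the
  same law; if c = 0, both weights vanish almost everywhere.\<close>

lemma Levy_uniqueness_weighted:
  fixes f g Y :: "'a \<Rightarrow> real"
  assumes f: "integrable M f" "\<And>x. 0 \<le> f x" and g: "integrable M g" "\<And>x. 0 \<le> g x"
    and [measurable]: "Y \<in> borel_measurable M" "C \<in> sets borel"
    and eq: "\<And>\<theta>. (CLINT x|M. f x * iexp (\<theta> * Y x)) = (CLINT x|M. g x * iexp (\<theta> * Y x))"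
  shows "(\<integral>x. f x * indicator C (Y x) \<partial>M) = (\<integral>x. g x * indicator C (Y x) \<partial>M)"
proof -
  have [measurable]: "f \<in> borel_measurable M" "g \<in> borel_measurable M" using f g by auto
  define c where "c = (\<integral>x. f x \<partial>M)"
  have cg: "c = (\<integral>x. g x \<partial>M)" using eq[of 0] by (simp add: c_def)
  have c0: "c \<ge> 0" unfolding c_def using f by (intro integral_nonneg_AE) auto
  have cf: "integrable M (\<lambda>x. h x * indicator C (Y x))" if "integrable M h" for h :: "'a \<Rightarrow> real"
    using that by (rule Bochner_Integration.integrable_bound) (use that in \<open>auto simp: indicator_def\<close>)
  show ?thesis
  proof (cases "c = 0")
    case True
    have "(\<integral>x. h x * indicator C (Y x) \<partial>M) = 0"
      if h: "integrable M h" "\<And>x. 0 \<le> h x" "(\<integral>x. h x \<partial>M) = 0" for h :: "'a \<Rightarrow> real"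
    proof -
      have "AE x in M. h x = 0" using h integral_nonneg_eq_0_iff_AE[OF h(1)] by simp
      then have "AE x in M. h x * indicator C (Y x) = 0" by auto
      then show ?thesis by (rule integral_eq_zero_AE)
    qed
    then show ?thesis using f g True c_def cg by metis
  next
    case False
    with c0 have cp: "c > 0" by simp
    define N where "N h = distr (density M (\<lambda>x. h x / c)) borel Y" for h :: "'a \<Rightarrow> real"
    have N: "real_distribution (N h)" "char (N h) \<theta> = (CLINT x|M. h x * iexp (\<theta> * Y x)) / c"
       "measure (N h) C = (\<integral>x. h x * indicator C (Y x) \<partial>M) / c"
      if h: "integrable M h" "\<And>x. 0 \<le> h x" "(\<integral>x. h x \<partial>M) = c" for h :: "'a \<Rightarrow> real" and \<theta>
    proof -
      have [measurable]: "h \<in> borel_measurable M" using h by simp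
      have "prob_space (density M (\<lambda>x. h x / c))"
      proof
        have "emeasure (density M (\<lambda>x. h x / c)) (space M) = (\<integral>\<^sup>+x. ennreal (h x / c) \<partial>M)"
          by (subst emeasure_density) (auto intro!: nn_integral_cong)
        also have "\<dots> = ennreal (\<integral>x. h x / c \<partial>M)"
          using h cp by (intro nn_integral_eq_integral) auto
        also have "\<dots> = 1" using h cp by simp
        finally show "emeasure (density M (\<lambda>x. h x / c)) (space (density M (\<lambda>x. h x / c))) = 1"
          by simp
      qed
      then interpret D: prob_space "density M (\<lambda>x. h x / c)" .
      show "real_distribution (N h)" unfolding N_def
        by (rule D.real_distribution_distr) simp
      show "char (N h) \<theta> = (CLINT x|M. h x * iexp (\<theta> * Y x)) / c"
        unfolding N_def char_def using cp h
        by (simp add: integral_distr integral_density scaleR_conv_of_real)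
      have "measure (N h) C = (\<integral>x. indicator C x \<partial>N h)"
        by (simp add: N_def)
      also have "\<dots> = (\<integral>x. indicator C (Y x) \<partial>density M (\<lambda>x. h x / c))"
        unfolding N_def by (subst integral_distr) auto
      also have "\<dots> = (\<integral>x. h x / c * indicator C (Y x) \<partial>M)"
        using cp h by (subst integral_density) auto
      finally show "measure (N h) C = (\<integral>x. h x * indicator C (Y x) \<partial>M) / c"
        by simp
    qed
    have "N f = N g"
      using N[OF f] N[OF g] c_def cg eq by (intro Levy_uniqueness) (auto intro!: ext)
    then show ?thesis using N(3)[OF f] N(3)[OF g] cp c_def cg by auto
  qed
qed

text \<open>Induction over the coordinates: the indicator of coordinate q is absorbed into the
  weights. The remaining coordinates must then have equal transforms under the new weights. A
  complex exponential is not a nonnegative weight, so it is reached through the weights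
  \<open>1 + cos (S x + a)\<close>.\<close>

lemma Levy_uniqueness_weighted_finite:
  fixes f g :: "'a \<Rightarrow> real" and Y :: "'j \<Rightarrow> 'a \<Rightarrow> real"
  assumes "finite Q" and f: "integrable M f" "\<And>x. 0 \<le> f x" and g: "integrable M g" "\<And>x. 0 \<le> g x"
    and "\<And>j. j \<in> Q \<Longrightarrow> Y j \<in> borel_measurable M" "\<And>j. j \<in> Q \<Longrightarrow> C j \<in> sets borel"
    and "\<And>l. (CLINT x|M. f x * iexp (\<Sum>j\<in>Q. l j * Y j x)) = (CLINT x|M. g x * iexp (\<Sum>j\<in>Q. l j * Y j x))"
  shows "(\<integral>x. f x * (\<Prod>j\<in>Q. indicator (C j) (Y j x)) \<partial>M) = (\<integral>x. g x * (\<Prod>j\<in>Q. indicator (C j) (Y j x)) \<partial>M)"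
  using assms
proof (induction Q arbitrary: f g rule: finite_induct)
  case empty
  then show ?case by simp
next
  case (insert q Q)
  have [measurable]: "f \<in> borel_measurable M" "g \<in> borel_measurable M" using insert.prems by auto
  have Yq[measurable]: "Y q \<in> borel_measurable M" "C q \<in> sets borel" using insert.prems by auto
  have YQ: "\<And>j. j \<in> Q \<Longrightarrow> Y j \<in> borel_measurable M" "\<And>j. j \<in> Q \<Longrightarrow> C j \<in> sets borel"
    using insert.prems by auto
  note f = insert.prems(1,2) and g = insert.prems(3,4)
  define I where "I x = (indicator (C q) (Y q x) :: real)" for x
  have [measurable]: "I \<in> borel_measurable M" unfolding I_def by simp
  have I01: "0 \<le> I x" "I x \<le> 1" for x by (auto simp: I_def)
  \<comment> \<open>The bound 2 fits both factors that multiply the weights, this indicator and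
    \<open>1 + cos\<close>.\<close>
  have I2: "\<bar>I x\<bar> \<le> 2" for x by (simp add: I_def indicator_def)
  have int: "integrable M (\<lambda>x. h x * k x)" if "integrable M h" "k \<in> borel_measurable M" "\<And>x. \<bar>k x\<bar> \<le> 2"
    for h k :: "'a \<Rightarrow> real"
  proof (rule Bochner_Integration.integrable_bound[OF integrable_mult_right[of 2, OF that(1)]])
    have "\<bar>h x * k x\<bar> \<le> \<bar>2 * h x\<bar>" for x
      using mult_left_mono[OF that(3)[of x], of "\<bar>h x\<bar>"] by (simp add: abs_mult mult.commute)
    then show "AE x in M. norm (h x * k x) \<le> norm (2 * h x)" by simp
  qed (use that in auto)
  have step: "(CLINT x|M. (f x * I x) * iexp (\<Sum>j\<in>Q. l j * Y j x)) = (CLINT x|M. (g x * I x) * iexp (\<Sum>j\<in>Q. l j * Y j x))" for l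
  proof -
    define S where "S x = (\<Sum>j\<in>Q. l j * Y j x)" for x
    have [measurable]: "S \<in> borel_measurable M" unfolding S_def using YQ by measurable
    \<comment> \<open>Scaling the coefficients on Q by a supplies the exponents a = 0, 1, -1 into
      which \<open>1 + cos\<close> times an exponential decomposes.\<close>
    have hyp: "(CLINT x|M. f x * iexp (a * S x + \<theta> * Y q x)) = (CLINT x|M. g x * iexp (a * S x + \<theta> * Y q x))" for a \<theta>
    proof -
      have "(\<Sum>j\<in>insert q Q. ((\<lambda>j. a * l j)(q := \<theta>)) j * Y j x) = a * S x + \<theta> * Y q x" for x
        using insert.hyps by (auto simp: S_def sum_distrib_left mult.assoc intro!: sum.cong)
      then show ?thesis using insert.prems(7)[of "(\<lambda>j. a * l j)(q := \<theta>)"] by simp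
    qed
    have h0: "(\<integral>x. f x * I x \<partial>M) = (\<integral>x. g x * I x \<partial>M)"
      unfolding I_def using hyp[of 0] by (intro Levy_uniqueness_weighted f g) auto
    have exp_eq: "complex_of_real (h x * (1 + cos (S x + a))) * iexp (\<theta> * Y q x) = h x * iexp (0 * S x + \<theta> * Y q x) +
        (iexp a * (h x * iexp (1 * S x + \<theta> * Y q x)) + iexp (- a) * (h x * iexp ((-1) * S x + \<theta> * Y q x))) / 2"
      for h x \<theta> a
      by (simp add: complex_eq_iff Re_exp Im_exp cos_add sin_add cos_diff sin_diff field_simps)
    have inti: "integrable M (\<lambda>x. of_real (h x) * iexp (a * S x + \<theta> * Y q x))" if "integrable M h" for h a \<theta>
      by (rule integral_iexp_weight(3)) (use that in auto)
    have c1: "(CLINT x|M. complex_of_real (h x * (1 + cos (S x + a))) * iexp (\<theta> * Y q x)) =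
        (CLINT x|M. h x * iexp (0 * S x + \<theta> * Y q x)) + (iexp a * (CLINT x|M. h x * iexp (1 * S x + \<theta> * Y q x)) +
        iexp (- a) * (CLINT x|M. h x * iexp ((-1) * S x + \<theta> * Y q x))) / 2"
      if "integrable M h" for h :: "'a \<Rightarrow> real" and \<theta> a
      unfolding exp_eq
      by (simp only: Bochner_Integration.integral_add Bochner_Integration.integrable_add integrable_divide_zero
         integral_divide_zero integral_mult_right_zero integrable_mult_right inti[OF that])
    have ic: "integrable M (\<lambda>x. h x * (1 + cos (S x + a)))" if "integrable M h" for h a
      using that by (auto intro!: int simp: abs_le_iff) (smt (verit) cos_le_one cos_ge_minus_one)+
    have pos: "0 \<le> 1 + cos (S x + a)" for x a
      by (smt (verit) cos_ge_minus_one)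
    have hc: "(\<integral>x. (f x * (1 + cos (S x + a))) * I x \<partial>M) = (\<integral>x. (g x * (1 + cos (S x + a))) * I x \<partial>M)" for a
      unfolding I_def
      by (intro Levy_uniqueness_weighted ic f g mult_nonneg_nonneg pos) (simp_all only: c1[OF f(1)] c1[OF g(1)] hyp Yq)
    have iI: "integrable M (\<lambda>x. h x * I x)" if "integrable M h" for h
      by (intro int that I2) simp
    have "(\<integral>x. (h x * (1 + cos (S x + a))) * I x \<partial>M) = (\<integral>x. h x * I x \<partial>M) + (\<integral>x. h x * I x * cos (S x + a) \<partial>M)"
      if "integrable M h" for h a
      using integral_iexp_weight(1)[OF iI[OF that], of "\<lambda>x. S x + a"] iI[OF that]
      by (simp add: distrib_left distrib_right mult_ac)
    then have "(\<integral>x. f x * I x * cos (S x + a) \<partial>M) = (\<integral>x. g x * I x * cos (S x + a) \<partial>M)" for a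
      using hc[of a] h0 f(1) g(1) by simp
    \<comment> \<open>The phases 0 and -pi/2 give cosine and sine, that is, the real and imaginary
      part of the transform.\<close>
    from this[of 0] this[of "- (pi / 2)"]
    have "(\<integral>x. f x * I x * cos (S x) \<partial>M) = (\<integral>x. g x * I x * cos (S x) \<partial>M)"
      "(\<integral>x. f x * I x * sin (S x) \<partial>M) = (\<integral>x. g x * I x * sin (S x) \<partial>M)"
      by (simp_all add: cos_diff)
    then show ?thesis
      using integral_iexp_weight(4)[OF iI[OF f(1)], of S] integral_iexp_weight(4)[OF iI[OF g(1)], of S]
      by (simp add: S_def)
  qed
  have "(\<integral>x. (f x * I x) * (\<Prod>j\<in>Q. indicator (C j) (Y j x)) \<partial>M) = (\<integral>x. (g x * I x) * (\<Prod>j\<in>Q. indicator (C j) (Y j x)) \<partial>M)"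
    by (intro insert.IH YQ step int I2 mult_nonneg_nonneg f g I01) simp_all
  then show ?case using insert.hyps by (simp add: I_def mult.assoc)
qed

text \<open>Finite intersections of preimages form an intersection-stable generator on which the
  finite case applies; the two finite measures with densities f and g agree there, hence on the
  generated sigma-algebra.\<close>

lemma Levy_uniqueness_weighted_sigma:
  fixes f g :: "'a \<Rightarrow> real" and Y :: "'j \<Rightarrow> 'a \<Rightarrow> real"
  assumes f: "integrable M f" "\<And>x. 0 \<le> f x" and g: "integrable M g" "\<And>x. 0 \<le> g x"
    and Y: "\<And>j. j \<in> J \<Longrightarrow> Y j \<in> borel_measurable M"
    and eq: "\<And>Q l. finite Q \<Longrightarrow> Q \<subseteq> J \<Longrightarrow>
      (CLINT x|M. f x * iexp (\<Sum>j\<in>Q. l j * Y j x)) = (CLINT x|M. g x * iexp (\<Sum>j\<in>Q. l j * Y j x))"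
    and A: "A \<in> sigma_sets (space M) {Y j -` C \<inter> space M | j C. j \<in> J \<and> C \<in> sets borel}"
  shows "(\<integral>x. f x * indicator A x \<partial>M) = (\<integral>x. g x * indicator A x \<partial>M)"
proof -
  have [measurable]: "f \<in> borel_measurable M" "g \<in> borel_measurable M" using f g by auto
  define E where "E = {(\<Inter>j\<in>Q. Y j -` C j) \<inter> space M | Q C. finite Q \<and> Q \<subseteq> J \<and> (\<forall>j\<in>J. C j \<in> sets borel)}"
  have EM: "X \<in> sets M" if X: "X \<in> E" for X
  proof -
    obtain Q C where X: "X = (\<Inter>j\<in>Q. Y j -` C j) \<inter> space M" "finite Q" "Q \<subseteq> J" "\<forall>j\<in>J. C j \<in> sets borel"
      using X unfolding E_def by auto
    have "X = {x \<in> space M. \<forall>j\<in>Q. Y j x \<in> C j}" using X by auto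
    also have "\<dots> \<in> sets M"
      by (intro sets.sets_Collect_finite_All' sets.sets_Collect_finite_All X(2))
         (use X(3,4) Y in \<open>auto intro!: measurable_sets_Collect[of _ _ borel] simp: subset_iff\<close>)
    finally show ?thesis .
  qed
  have Q1: "(\<integral>x. f x * indicator X x \<partial>M) = (\<integral>x. g x * indicator X x \<partial>M)" if XE: "X \<in> E" for X
  proof -
    obtain Q C where X: "X = (\<Inter>j\<in>Q. Y j -` C j) \<inter> space M" "finite Q" "Q \<subseteq> J" "\<forall>j\<in>J. C j \<in> sets borel"
      using XE unfolding E_def by auto
    have ind: "(indicator X x :: real) = (\<Prod>j\<in>Q. indicator (C j) (Y j x))" if "x \<in> space M" for x
      using X(2) that unfolding X(1) by (induction Q rule: finite_induct) (auto simp: indicator_def)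
    have "(\<integral>x. h x * indicator X x \<partial>M) = (\<integral>x. h x * (\<Prod>j\<in>Q. indicator (C j) (Y j x)) \<partial>M)" for h :: "'a \<Rightarrow> real"
      by (intro Bochner_Integration.integral_cong) (auto simp: ind)
    moreover have "(\<integral>x. f x * (\<Prod>j\<in>Q. indicator (C j) (Y j x)) \<partial>M) = (\<integral>x. g x * (\<Prod>j\<in>Q. indicator (C j) (Y j x)) \<partial>M)"
      using X(3,4) Y by (intro Levy_uniqueness_weighted_finite X(2) f g eq) auto
    ultimately show ?thesis by simp
  qed
  have E_space: "space M \<in> E" unfolding E_def by (auto intro!: exI[of _ "{}"])
  have Int: "Int_stable E"
  proof (rule Int_stableI)
    fix X X' assume "X \<in> E" "X' \<in> E"
    then obtain Q C Q' C' where X: "X = (\<Inter>j\<in>Q. Y j -` C j) \<inter> space M" "finite Q" "Q \<subseteq> J" "\<forall>j\<in>J. C j \<in> sets borel"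
        "X' = (\<Inter>j\<in>Q'. Y j -` C' j) \<inter> space M" "finite Q'" "Q' \<subseteq> J" "\<forall>j\<in>J. C' j \<in> sets borel"
      unfolding E_def by auto
    \<comment> \<open>A coordinate constrained by only one of the two sets gets the whole line from
      the other.\<close>
    define D where "D j = (if j \<in> Q then C j else UNIV) \<inter> (if j \<in> Q' then C' j else UNIV)" for j
    have "X \<inter> X' = (\<Inter>j\<in>Q \<union> Q'. Y j -` D j) \<inter> space M"
      unfolding X D_def by (auto split: if_splits)
    moreover have "finite (Q \<union> Q')" "Q \<union> Q' \<subseteq> J" "\<forall>j\<in>J. D j \<in> sets borel"
      using X by (auto simp: D_def)
    ultimately show "X \<inter> X' \<in> E"
      unfolding E_def by blast
  qed
  have fin: "finite_measure (density M h)" if "integrable M h" "\<And>x. 0 \<le> h x" for h :: "'a \<Rightarrow> real"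
  proof (rule finite_measureI)
    have "emeasure (density M h) (space M) = (\<integral>\<^sup>+x. ennreal (h x) \<partial>M)"
      using that by (subst emeasure_density) (auto intro!: nn_integral_cong)
    also have "\<dots> = ennreal (\<integral>x. h x \<partial>M)" using that by (intro nn_integral_eq_integral) auto
    finally show "emeasure (density M h) (space (density M h)) \<noteq> \<infinity>" by simp
  qed
  have meas: "measure (density M h) X = (\<integral>x. h x * indicator X x \<partial>M)"
    if h: "integrable M h" "\<And>x. 0 \<le> h x" and [measurable]: "X \<in> sets M" for h :: "'a \<Rightarrow> real" and X
  proof -
    have [measurable]: "h \<in> borel_measurable M" using h by simp
    have "measure (density M h) X = (\<integral>x. indicator X x \<partial>density M h)"
      by (subst Bochner_Integration.integral_indicator) (simp add: Int_absorb2 sets.sets_into_space)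
    also have "\<dots> = (\<integral>x. h x * indicator X x \<partial>M)" using h by (subst integral_density) auto
    finally show ?thesis .
  qed
  interpret Mf: finite_measure "density M f" by (rule fin[OF f])
  interpret Mg: finite_measure "density M g" by (rule fin[OF g])
  have sub: "sigma_sets (space M) E \<subseteq> sets M" using EM by (intro sets.sigma_sets_subset) auto
  have AE: "A \<in> sigma_sets (space M) E"
  proof (rule subsetD[OF sigma_sets_mono A])
    show "{Y j -` C \<inter> space M | j C. j \<in> J \<and> C \<in> sets borel} \<subseteq> sigma_sets (space M) E"
    proof
      fix X assume "X \<in> {Y j -` C \<inter> space M | j C. j \<in> J \<and> C \<in> sets borel}"
      then obtain j C where "j \<in> J" "C \<in> sets borel" "X = Y j -` C \<inter> space M" by auto
      then have "X \<in> E" unfolding E_def by (auto intro!: exI[of _ "{j}"] exI[of _ "\<lambda>_. C"])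
      then show "X \<in> sigma_sets (space M) E" ..
    qed
  qed
  have EP: "E \<subseteq> Pow (space M)" unfolding E_def by auto
  have "measure (density M f) A = measure (density M g) A"
  using Int EP AE
  proof (induction rule: sigma_sets_induct_disjoint)
    case (basic X)
    then show ?case using Q1 EM by (simp add: meas f g)
  next
    case empty
    then show ?case by simp
  next
    case (compl X)
    then have [measurable]: "X \<in> sets M" using sub by auto
    have "measure (density M f) (space M) = measure (density M g) (space M)"
      using Q1[OF E_space] by (simp add: meas f g)
    then show ?case
      using compl Mf.finite_measure_compl[of X] Mg.finite_measure_compl[of X] by simp
  next
    case (union X)
    then have X: "range X \<subseteq> sets M" using sub by auto
    have "(\<lambda>i. measure (density M f) (X i)) sums measure (density M f) (\<Union>i. X i)"
      using X union by (intro Mf.finite_measure_UNION) auto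
    moreover have "(\<lambda>i. measure (density M g) (X i)) sums measure (density M g) (\<Union>i. X i)"
      using X union by (intro Mg.finite_measure_UNION) auto
    ultimately show ?case using union by (simp add: sums_iff)
  qed
  moreover have "A \<in> sets M" using AE sub by auto
  ultimately show ?thesis by (simp add: meas f g)
qed

section \<open>Factorization over events, and centred normal laws\<close>

text \<open>With e the normal characteristic function at \<theta>, the weights
  \<open>1 + cos (\<theta> * Z x + a)\<close> and \<open>1 + e * cos a\<close> have equal transforms
  against the \<open>Y j\<close>, by the hypothesis at \<theta> and at -\<theta>. So they have equal
  integrals over A, and varying a isolates cosine and sine. The bound e \<le> 1 keeps the second
  weight nonnegative.\<close>

lemma (in prob_space) iexp_indicator_factor:
  fixes Z :: "'a \<Rightarrow> real" and Y :: "'j \<Rightarrow> 'a \<Rightarrow> real"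
  assumes [measurable]: "Z \<in> borel_measurable M"
    and Y: "\<And>j. j \<in> J \<Longrightarrow> Y j \<in> borel_measurable M" and v: "0 \<le> v"
    and hyp: "\<And>\<theta> Q l. finite Q \<Longrightarrow> Q \<subseteq> J \<Longrightarrow>
      (CLINT x|M. iexp (\<theta> * Z x + (\<Sum>j\<in>Q. l j * Y j x))) =
       complex_of_real (exp (- \<theta>\<^sup>2 * v / 2)) * (CLINT x|M. iexp (\<Sum>j\<in>Q. l j * Y j x))"
    and A: "A \<in> sigma_sets (space M) {Y j -` C \<inter> space M | j C. j \<in> J \<and> C \<in> sets borel}"
  shows "(CLINT x|M. indicator A x * iexp (\<theta> * Z x)) = complex_of_real (exp (- \<theta>\<^sup>2 * v / 2) * prob A)"
proof -
  define e where "e = exp (- \<theta>\<^sup>2 * v / 2)"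
  have e: "0 \<le> e" "e \<le> 1" using v by (simp_all add: e_def)
  have "sigma_sets (space M) {Y j -` C \<inter> space M | j C. j \<in> J \<and> C \<in> sets borel} \<subseteq> sets M"
    using Y by (intro sets.sigma_sets_subset) (auto intro: measurable_sets)
  then have [measurable]: "A \<in> sets M" using A by auto
  have ii: "integrable M (\<lambda>x. iexp (U x))" if "U \<in> borel_measurable M" for U
    using that by (intro integrable_iexp) auto
  have "(\<integral>x. (1 + cos (\<theta> * Z x + a)) * indicator A x \<partial>M) = (\<integral>x. (1 + e * cos a) * indicator A x \<partial>M)" for a
  proof (rule Levy_uniqueness_weighted_sigma[OF _ _ _ _ Y _ A])
    show "integrable M (\<lambda>x. 1 + cos (\<theta> * Z x + a))"
      by (intro Bochner_Integration.integrable_add integrable_const integrable_const_bound[of _ 1]) auto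
    show "0 \<le> 1 + cos (\<theta> * Z x + a)" for x by (smt (verit) cos_ge_minus_one)
    show "0 \<le> 1 + e * cos a"
      using mult_left_mono[OF cos_ge_minus_one e(1), of a] e(2) by simp
    fix Q :: "'j set" and l assume Q: "finite Q" "Q \<subseteq> J"
    define S where "S x = (\<Sum>j\<in>Q. l j * Y j x)" for x
    have [measurable]: "S \<in> borel_measurable M" unfolding S_def using Y Q(2) by (intro borel_measurable_sum borel_measurable_times) auto
    have i3: "integrable M (\<lambda>x. iexp (S x))" "integrable M (\<lambda>x. iexp (\<theta> * Z x + S x))"
       "integrable M (\<lambda>x. iexp ((-\<theta>) * Z x + S x))"
      by (intro ii; measurable)+
    have hS: "(CLINT x|M. iexp (\<theta> * Z x + S x)) = complex_of_real e * (CLINT x|M. iexp (S x))"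
      "(CLINT x|M. iexp ((-\<theta>) * Z x + S x)) = complex_of_real e * (CLINT x|M. iexp (S x))"
      using hyp[OF Q, of \<theta> l] hyp[OF Q, of "-\<theta>" l] by (simp_all only: S_def e_def power2_minus)
    have "complex_of_real (1 + cos (\<theta> * Z x + a)) * iexp (S x) =
       iexp (S x) + (iexp a * iexp (\<theta> * Z x + S x) + iexp (- a) * iexp ((-\<theta>) * Z x + S x)) / 2" for x
      by (simp add: complex_eq_iff Re_exp Im_exp cos_add sin_add cos_diff sin_diff field_simps)
    then have "(CLINT x|M. complex_of_real (1 + cos (\<theta> * Z x + a)) * iexp (S x)) = (CLINT x|M. iexp (S x)) +
       (iexp a * (CLINT x|M. iexp (\<theta> * Z x + S x)) + iexp (- a) * (CLINT x|M. iexp ((-\<theta>) * Z x + S x))) / 2"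
      by (simp only: Bochner_Integration.integral_add Bochner_Integration.integrable_add integrable_divide_zero
         integral_divide_zero integral_mult_right_zero integrable_mult_right i3)
    also have "\<dots> = (CLINT x|M. iexp (S x)) + complex_of_real e * ((iexp a + iexp (- a)) / 2) * (CLINT x|M. iexp (S x))"
      unfolding hS by (simp add: algebra_simps add_divide_distrib)
    also have "(iexp a + iexp (- a)) / 2 = complex_of_real (cos a)"
      by (simp add: complex_eq_iff Re_exp Im_exp)
    also have "(CLINT x|M. iexp (S x)) + complex_of_real e * complex_of_real (cos a) * (CLINT x|M. iexp (S x)) =
       (CLINT x|M. complex_of_real (1 + e * cos a) * iexp (S x))"
      unfolding integral_mult_right_zero by (simp add: distrib_right)
    finally show "(CLINT x|M. complex_of_real (1 + cos (\<theta> * Z x + a)) * iexp (\<Sum>j\<in>Q. l j * Y j x)) =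
       (CLINT x|M. complex_of_real (1 + e * cos a) * iexp (\<Sum>j\<in>Q. l j * Y j x))" by (simp add: S_def)
  qed simp
  moreover
  have iA: "integrable M (indicator A :: _ \<Rightarrow> real)" by (simp add: emeasure_eq_measure)
  have "(\<integral>x. (1 + cos (\<theta> * Z x + a)) * indicator A x \<partial>M) = prob A + (\<integral>x. indicator A x * cos (\<theta> * Z x + a) \<partial>M)" for a
    using Bochner_Integration.integral_add[OF iA integral_iexp_weight(1)[OF iA, of "\<lambda>x. \<theta> * Z x + a"]]
    by (simp add: distrib_left mult.commute)
  moreover have "(\<integral>x. (1 + e * cos a) * indicator A x \<partial>M) = prob A + e * cos a * prob A" for a
    by (subst integral_mult_right_zero, simp add: algebra_simps)
  ultimately have *: "(\<integral>x. indicator A x * cos (\<theta> * Z x + a) \<partial>M) = e * cos a * prob A" for a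
    by (metis add_left_cancel)
  have "(\<integral>x. indicator A x * cos (\<theta> * Z x) \<partial>M) = e * prob A" "(\<integral>x. indicator A x * sin (\<theta> * Z x) \<partial>M) = 0"
    using *[of 0] *[of "- (pi / 2)"] by (simp_all add: cos_diff)
  moreover have "(CLINT x|M. indicator A x * iexp (\<theta> * Z x)) = (CLINT x|M. complex_of_real (indicator A x) * iexp (\<theta> * Z x))"
    by (intro Bochner_Integration.integral_cong) (auto simp: indicator_def)
  ultimately show ?thesis using integral_iexp_weight(4)[OF iA, of "\<lambda>x. \<theta> * Z x"] by (simp add: e_def complex_eq_iff)
qed

lemma (in prob_space) iexp_tendsto:
  assumes [measurable]: "\<And>n. U n \<in> borel_measurable M" "U' \<in> borel_measurable M"
    and lim: "AE x in M. (\<lambda>n. U n x) \<longlonglongrightarrow> U' x"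
  shows "A \<in> sets M \<Longrightarrow> (\<lambda>n. CLINT x|M. indicator A x * iexp (U n x)) \<longlonglongrightarrow> (CLINT x|M. indicator A x * iexp (U' x))"
    and "(\<lambda>n. CLINT x|M. iexp (U n x)) \<longlonglongrightarrow> (CLINT x|M. iexp (U' x))"
proof -
  show A: "(\<lambda>n. CLINT x|M. indicator A x * iexp (U n x)) \<longlonglongrightarrow> (CLINT x|M. indicator A x * iexp (U' x))"
    if [measurable]: "A \<in> sets M" for A
  proof (rule integral_dominated_convergence[where w = "\<lambda>_. 1"])
    show "AE x in M. (\<lambda>n. indicator A x * iexp (U n x)) \<longlonglongrightarrow> indicator A x * iexp (U' x)"
      using lim by eventually_elim (intro tendsto_intros)
  qed (auto simp: norm_mult indicator_def)
  have "(CLINT x|M. indicator (space M) x * iexp (V x)) = (CLINT x|M. iexp (V x))" for V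
    by (intro Bochner_Integration.integral_cong) auto
  then show "(\<lambda>n. CLINT x|M. iexp (U n x)) \<longlonglongrightarrow> (CLINT x|M. iexp (U' x))"
    using A[OF sets.top] by simp
qed

lemma (in prob_space) normal_distributed_iexp:
  assumes v: "0 < v" and X: "distributed M lborel X (normal_density 0 (sqrt v))"
  shows "(CLINT x|M. iexp (\<theta> * X x)) = complex_of_real (exp (- \<theta>\<^sup>2 * v / 2))"
proof -
  have [measurable]: "X \<in> borel_measurable M" using distributed_measurable[OF X] by simp
  have d: "distributed M lborel (\<lambda>x. (X x - 0) / sqrt v) std_normal_density"
    using X v by (subst normal_standard_normal_convert[symmetric]) auto
  have "(CLINT x|M. iexp (\<theta> * X x)) = (CLINT x|M. iexp ((\<theta> * sqrt v) * ((X x - 0) / sqrt v)))"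
    using v by (intro Bochner_Integration.integral_cong) auto
  also have "\<dots> = (CLINT y|distr M lborel (\<lambda>x. (X x - 0) / sqrt v). iexp ((\<theta> * sqrt v) * y))"
    by (subst integral_distr) auto
  also have "\<dots> = char std_normal_distribution (\<theta> * sqrt v)"
    unfolding distributed_distr_eq_density[OF d] char_def ..
  also have "\<dots> = complex_of_real (exp (- \<theta>\<^sup>2 * v / 2))"
    using v by (simp add: char_std_normal_distribution power_mult_distrib)
  finally show ?thesis .
qed

lemma (in prob_space) distributed_normal_of_iexp:
  assumes v: "0 < v" and [measurable]: "X \<in> borel_measurable M"
    and cf: "\<And>\<theta>. (CLINT x|M. iexp (\<theta> * X x)) = complex_of_real (exp (- \<theta>\<^sup>2 * v / 2))"
  shows "distributed M lborel X (normal_density 0 (sqrt v))"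
proof -
  have "char (distr M borel (\<lambda>x. X x / sqrt v)) = char std_normal_distribution"
  proof
    fix \<theta>
    have "char (distr M borel (\<lambda>x. X x / sqrt v)) \<theta> = (CLINT x|M. iexp ((\<theta> / sqrt v) * X x))"
      unfolding char_def by (subst integral_distr) auto
    also have "\<dots> = char std_normal_distribution \<theta>"
      unfolding cf char_std_normal_distribution using v by (simp add: power_divide)
    finally show "char (distr M borel (\<lambda>x. X x / sqrt v)) \<theta> = char std_normal_distribution \<theta>" .
  qed
  then have "distr M borel (\<lambda>x. X x / sqrt v) = std_normal_distribution"
    by (intro Levy_uniqueness real_distribution_distr real_dist_normal_dist) auto
  then have "distributed M lborel (\<lambda>x. (X x - 0) / sqrt v) std_normal_density"
    unfolding distributed_def by (auto cong: distr_cong)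
  then show ?thesis using v by (subst normal_standard_normal_convert) auto
qed

lemma (in prob_space) centred_normal_moments:
  assumes v: "0 < v" and X: "distributed M lborel X (normal_density 0 (sqrt v))"
  shows "integrable M X" "(\<integral>x. X x \<partial>M) = 0" "integrable M (\<lambda>x. (X x)\<^sup>2)" "(\<integral>x. (X x)\<^sup>2 \<partial>M) = v"
    "(\<integral>x. \<bar>X x\<bar> \<partial>M) \<le> sqrt v"
proof -
  show i: "integrable M X"
    using distributed_integrable_var[OF X] integrable_normal_moment_nz_1[of "sqrt v" 0] v by auto
  show e: "(\<integral>x. X x \<partial>M) = 0"
    using normal_distributed_expectation[OF _ X] v by simp
  show i2: "integrable M (\<lambda>x. (X x)\<^sup>2)"
    using distributed_integrable[OF X, of "\<lambda>x. x\<^sup>2"] integrable_normal_moment[of "sqrt v" 0 2] v by auto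
  show e2: "(\<integral>x. (X x)\<^sup>2 \<partial>M) = v"
    using normal_distributed_variance[OF _ X] v e by simp
  \<comment> \<open>Completing the square at the scale \<open>sqrt v\<close> trades the first
    absolute moment for the second moment; each of the two terms contributes
    \<open>sqrt v / 2\<close>.\<close>
  have pw: "\<bar>x\<bar> \<le> sqrt v / 2 + x\<^sup>2 / (2 * sqrt v)" for x :: real
  proof -
    have "0 \<le> (\<bar>x\<bar> - sqrt v)\<^sup>2" by simp
    then have "2 * \<bar>x\<bar> * sqrt v \<le> sqrt v * sqrt v + x\<^sup>2" by (simp add: power2_eq_square algebra_simps)
    then show ?thesis using v by (simp add: field_simps power2_eq_square)
  qed
  have "(\<integral>x. \<bar>X x\<bar> \<partial>M) \<le> (\<integral>x. sqrt v / 2 + (X x)\<^sup>2 / (2 * sqrt v) \<partial>M)"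
    using i i2 pw by (intro integral_mono) auto
  also have "\<dots> = sqrt v / 2 + v / (2 * sqrt v)"
    using i2 e2 by (simp add: prob_space)
  also have "\<dots> = sqrt v" using v by (simp add: real_div_sqrt field_simps)
  finally show "(\<integral>x. \<bar>X x\<bar> \<partial>M) \<le> sqrt v" .
qed

section \<open>Wiener integrals against two independent Brownian motions\<close>

text \<open>Independence of random variables speaks of generated sigma-algebras. The families of
  preimages are intersection-stable, so independence of the families themselves already extends to
  what they generate.\<close>

lemma (in prob_space) indep_var_of_indep_set:
  fixes U Z :: "'a \<Rightarrow> real"
  assumes ind: "indep_set \<A> \<B>" and [measurable]: "U \<in> borel_measurable M" "Z \<in> borel_measurable M"
    and U: "\<And>C. C \<in> sets borel \<Longrightarrow> U -` C \<inter> space M \<in> \<A>"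
    and Z: "\<And>C. C \<in> sets borel \<Longrightarrow> Z -` C \<inter> space M \<in> \<B>"
  shows "indep_var borel U borel Z"
proof -
  have st: "Int_stable {f -` A \<inter> space M | A. A \<in> sets borel}" for f :: "'a \<Rightarrow> real"
  proof (rule Int_stableI, clarify)
    fix A B :: "real set" assume "A \<in> sets borel" "B \<in> sets borel"
    then show "\<exists>C. f -` A \<inter> space M \<inter> (f -` B \<inter> space M) = f -` C \<inter> space M \<and> C \<in> sets borel"
      by (intro exI[of _ "A \<inter> B"]) auto
  qed
  have "indep_set {U -` A \<inter> space M | A. A \<in> sets borel} {Z -` A \<inter> space M | A. A \<in> sets borel}"
    using ind U Z unfolding indep_sets2_eq by blast
  then have "indep_set (sigma_sets (space M) {U -` A \<inter> space M | A. A \<in> sets borel})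
     (sigma_sets (space M) {Z -` A \<inter> space M | A. A \<in> sets borel})"
    by (rule indep_set_sigma_sets[OF _ st st])
  then show ?thesis
    unfolding indep_var_eq by simp
qed

lemma (in prob_space) iexp_add_indep:
  assumes "indep_set \<A> \<B>" and [measurable]: "U \<in> borel_measurable M" "Z \<in> borel_measurable M"
    and "\<And>C. C \<in> sets borel \<Longrightarrow> U -` C \<inter> space M \<in> \<A>"
    and "\<And>C. C \<in> sets borel \<Longrightarrow> Z -` C \<inter> space M \<in> \<B>"
  shows "(CLINT x|M. iexp (U x + Z x)) = (CLINT x|M. iexp (U x)) * (CLINT x|M. iexp (Z x))"
proof -
  have "indep_var borel U borel Z"
    by (rule indep_var_of_indep_set[OF assms(1)]) (fact assms)+
  from char_distr_add[OF this, of 1] show ?thesis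
    by (simp add: char_def integral_distr)
qed

lemma natural_filtration_props:
  assumes "\<And>t. t \<in> {0..T} \<Longrightarrow> X t \<in> borel_measurable M"
  shows "space (natural_filtration M T X t) = space M"
    "sets (natural_filtration M T X t) =
       sigma_sets (space M) {X s -` A \<inter> space M | s A. s \<in> {0..min t T} \<and> A \<in> sets borel}"
    "filtration_on M (natural_filtration M T X)"
    "s \<in> {0..min t T} \<Longrightarrow> X s \<in> borel_measurable (natural_filtration M T X t)"
proof -
  have sub: "{X s -` A \<inter> space M | s A. s \<in> {0..min t T} \<and> A \<in> sets borel} \<subseteq> Pow (space M)" for t
    by auto
  show sp: "space (natural_filtration M T X t) = space M" for t
    unfolding natural_filtration_def by (rule space_measure_of[OF sub])
  show se: "sets (natural_filtration M T X t) =
       sigma_sets (space M) {X s -` A \<inter> space M | s A. s \<in> {0..min t T} \<and> A \<in> sets borel}" for t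
    unfolding natural_filtration_def by (rule sets_measure_of[OF sub])
  have M: "sets (natural_filtration M T X t) \<subseteq> sets M" for t
    unfolding se using assms by (intro sets.sigma_sets_subset) (auto intro: measurable_sets)
  have mono: "sets (natural_filtration M T X s) \<subseteq> sets (natural_filtration M T X t)" if "s \<le> t" for s t
    unfolding se
  proof (rule sigma_sets_mono')
    show "{X r -` A \<inter> space M |r A. r \<in> {0..min s T} \<and> A \<in> sets borel}
        \<subseteq> {X s -` A \<inter> space M |s A. s \<in> {0..min t T} \<and> A \<in> sets borel}"
    proof clarify
      fix r and A :: "'b set" assume "r \<in> {0..min s T}" "A \<in> sets borel"
      then show "\<exists>s' A'. X r -` A \<inter> space M = X s' -` A' \<inter> space M \<and> s' \<in> {0..min t T} \<and> A' \<in> sets borel"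
        using that by (intro exI[of _ r] exI[of _ A]) auto
    qed
  qed
  show "filtration_on M (natural_filtration M T X)"
    unfolding filtration_on_def subalgebra_def filtration_def using sp M mono by auto
  show "X s \<in> borel_measurable (natural_filtration M T X t)" if "s \<in> {0..min t T}"
  proof (rule measurableI)
    fix A :: "'b set" assume "A \<in> sets borel"
    then show "X s -` A \<inter> space (natural_filtration M T X t) \<in> sets (natural_filtration M T X t)"
      unfolding sp se using that by (intro sigma_sets.Basic) auto
  qed simp
qed

lemma brownian_motion_measurable:
  assumes "brownian_motion M G T X" "t \<in> {0..T}"
  shows "X t \<in> borel_measurable M"
proof -
  have "subalgebra M (G t)" "X t \<in> borel_measurable (G t)"
    using assms unfolding brownian_motion_def filtration_on_def adapted_on_def by auto
  then show ?thesis by (rule measurable_from_subalg)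
qed

section \<open>Joint characteristic function of the values of a Brownian motion\<close>

lemma integrable_step_power2:
  fixes c :: "real \<Rightarrow> real"
  shows "integrable lborel (\<lambda>u. (\<Sum>q\<in>Q. c q * indicator {0<..q} u)\<^sup>2)"
proof -
  have "integrable lborel (\<lambda>u. c q * indicator {0<..q} u * (c r * indicator {0<..r} u))" for q r
  proof (rule Bochner_Integration.integrable_bound)
    have "integrable lborel (indicator {0<..q} :: real \<Rightarrow> real)"
    proof (cases "0 \<le> q")
      case True
      then show ?thesis by (intro integrable_real_indicator) auto
    qed simp
    then show "integrable lborel (\<lambda>u. \<bar>c q * c r\<bar> * indicator {0<..q} u)" by simp
  qed (auto simp: indicator_def abs_mult)
  then show ?thesis unfolding power2_eq_square sum_product by (intro Bochner_Integration.integrable_sum)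
qed

text \<open>Let m be the largest time and m' its predecessor. Moving the coefficient of m to m'
  leaves \<open>a m\<close> times the increment over (m', m], which is independent of
  \<open>G m'\<close>. The remaining kernel vanishes beyond m', so the squared norms add just as the
  exponents do.\<close>

lemma (in prob_space) brownian_motion_iexp_sum:
  assumes bm: "brownian_motion M G T X" and "finite Q" "Q \<subseteq> {0..T}"
  shows "(CLINT x|M. iexp (\<Sum>q\<in>Q. a q * X q x)) =
    complex_of_real (exp (- (LINT u|lborel. (\<Sum>q\<in>Q. a q * indicator {0<..q} u)\<^sup>2) / 2))"
  using assms(2,3)
proof (induction Q arbitrary: a rule: finite_linorder_max_induct)
  case empty
  then show ?case by (simp add: prob_space)
next
  case (insert m Q)
  have Xm[measurable]: "X q \<in> borel_measurable M" if "q \<in> {0..T}" for q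
    using that by (rule brownian_motion_measurable[OF bm])
  have sub: "subalgebra M (G t)" and X0: "AE x in M. X 0 x = 0" for t
    using bm by (auto simp: brownian_motion_def filtration_on_def)
  have incr: "(CLINT x|M. iexp (c * (X t x - X s x))) = complex_of_real (exp (- c\<^sup>2 * (t - s) / 2))"
    if "0 \<le> s" "s < t" "t \<le> T" for s t c
    using that bm by (intro normal_distributed_iexp) (auto simp: brownian_motion_def)
  have notin: "m \<notin> Q" using insert.hyps(2) by auto
  have m: "0 \<le> m" "m \<le> T" using insert.prems by auto
  show ?case
  proof (cases "Q = {}")
    \<comment> \<open>A single time has no predecessor in Q. Time 0 takes this role, where X
      vanishes only almost surely.\<close>
    case True
    have len: "(LINT u|lborel. (a m * indicator {0<..m} u)\<^sup>2) = (a m)\<^sup>2 * m"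
    proof -
      have "(indicator {0<..m} u)\<^sup>2 = (indicator {0<..m} u :: real)" for u by (simp add: indicator_def)
      then show ?thesis using m by (simp add: power_mult_distrib)
    qed
    have "(CLINT x|M. iexp (a m * X m x)) = complex_of_real (exp (- (a m)\<^sup>2 * m / 2))"
    proof (cases "m = 0")
      case True
      have "(CLINT x|M. iexp (a m * X m x)) = (CLINT x|M. 1)"
        using X0 m by (intro integral_cong_AE) (auto simp: True)
      then show ?thesis using True by (simp add: prob_space)
    next
      case False
      have "(CLINT x|M. iexp (a m * X m x)) = (CLINT x|M. iexp (a m * (X m x - X 0 x)))"
        using X0 m by (intro integral_cong_AE) auto
      then show ?thesis using False m incr[of 0 m "a m"] by simp
    qed
    moreover have "(\<Sum>q\<in>insert m Q. a q * f q) = a m * f m" for f :: "real \<Rightarrow> real" using True by simp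
    ultimately show ?thesis by (simp only: len) simp
  next
    case False
    define m' where "m' = Max Q"
    have m': "m' \<in> Q" "\<And>q. q \<in> Q \<Longrightarrow> q \<le> m'" "m' < m"
      using insert.hyps False by (auto simp: m'_def)
    have m'T: "0 \<le> m'" "m' \<le> T" using m' insert.prems by auto
    define a' where "a' = a(m' := a m' + a m)"
    have split: "(\<Sum>q\<in>insert m Q. a q * f q) = (\<Sum>q\<in>Q. a' q * f q) + a m * (f m - f m')" for f :: "real \<Rightarrow> real"
    proof -
      have "(\<Sum>q\<in>Q. a' q * f q) = (\<Sum>q\<in>Q. a q * f q + (if q = m' then a m * f m' else 0))"
        by (intro sum.cong) (auto simp: a'_def algebra_simps)
      also have "\<dots> = (\<Sum>q\<in>Q. a q * f q) + a m * f m'"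
        using m' insert.hyps by (simp add: sum.distrib)
      finally show ?thesis using notin insert.hyps by (simp add: algebra_simps)
    qed
    define U where "U x = (\<Sum>q\<in>Q. a' q * X q x)" for x
    have UG: "U \<in> borel_measurable (G m')" unfolding U_def
    proof (intro borel_measurable_sum borel_measurable_times borel_measurable_const)
      fix q assume q: "q \<in> Q"
      have "subalgebra (G m') (G q)"
        using bm m'(2)[OF q] unfolding brownian_motion_def filtration_on_def subalgebra_def filtration_def by simp
      moreover have "X q \<in> borel_measurable (G q)"
        using bm q insert.prems by (auto simp: brownian_motion_def adapted_on_def)
      ultimately show "X q \<in> borel_measurable (G m')" by (rule measurable_from_subalg)
    qed
    have UM: "U \<in> borel_measurable M" by (rule measurable_from_subalg[OF sub UG])
    have sp: "space (G m') = space M" using sub by (auto simp: subalgebra_def)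
    have "(CLINT x|M. iexp (\<Sum>q\<in>insert m Q. a q * X q x)) = (CLINT x|M. iexp (U x + a m * (X m x - X m' x)))"
      unfolding split U_def ..
    also have "\<dots> = (CLINT x|M. iexp (U x)) * (CLINT x|M. iexp (a m * (X m x - X m' x)))"
    proof (rule iexp_add_indep)
      show "indep_set (sets (G m')) {(\<lambda>\<omega>. X m \<omega> - X m' \<omega>) -` A \<inter> space M | A. A \<in> sets borel}"
        using bm m' m m'T by (auto simp: brownian_motion_def)
      show "U -` C \<inter> space M \<in> sets (G m')" if "C \<in> sets borel" for C
        using measurable_sets[OF UG that] sp by simp
      fix C :: "real set" assume C: "C \<in> sets borel"
      have "(\<lambda>x. a m * (X m x - X m' x)) -` C \<inter> space M = (\<lambda>\<omega>. X m \<omega> - X m' \<omega>) -` ((\<lambda>y. a m * y) -` C) \<inter> space M"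
        by auto
      moreover have "(\<lambda>y. a m * y) -` C \<in> sets borel"
        using measurable_sets[of "\<lambda>y. a m * y" borel borel C] C by simp
      ultimately show "(\<lambda>x. a m * (X m x - X m' x)) -` C \<inter> space M \<in> {(\<lambda>\<omega>. X m \<omega> - X m' \<omega>) -` A \<inter> space M | A. A \<in> sets borel}"
        by blast
    qed (use UM m m'T in \<open>auto intro!: borel_measurable_times borel_measurable_diff Xm\<close>)
    also have "\<dots> = complex_of_real (exp (- (LINT u|lborel. (\<Sum>q\<in>Q. a' q * indicator {0<..q} u)\<^sup>2) / 2)) *
        complex_of_real (exp (- (a m)\<^sup>2 * (m - m') / 2))"
      unfolding U_def using insert.IH[of a'] insert.prems incr[of m' m "a m"] m m' m'T by simp
    also have "\<dots> = complex_of_real (exp (- (LINT u|lborel. (\<Sum>q\<in>insert m Q. a q * indicator {0<..q} u)\<^sup>2) / 2))"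
    proof -
      have sq: "(\<Sum>q\<in>insert m Q. a q * indicator {0<..q} u)\<^sup>2 =
          (\<Sum>q\<in>Q. a' q * indicator {0<..q} u)\<^sup>2 + (a m)\<^sup>2 * indicator {m'<..m} u" for u :: real
      proof -
        have d: "indicator {0<..m} u - indicator {0<..m'} u = (indicator {m'<..m} u :: real)"
          using m' m'T by (auto simp: indicator_def)
        have "(\<Sum>q\<in>Q. a' q * indicator {0<..q} u) = 0" if "u > m'"
        proof (rule sum.neutral, rule ballI)
          fix q assume "q \<in> Q"
          then have "u \<notin> {0<..q}" using m'(2)[of q] that by auto
          then show "a' q * indicator {0<..q} u = 0" by simp
        qed
        then show ?thesis unfolding split d
          by (auto simp: indicator_def power_mult_distrib)
      qed
      note integrable_step_power2[of a' Q]
      then have "(LINT u|lborel. (\<Sum>q\<in>insert m Q. a q * indicator {0<..q} u)\<^sup>2) =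
         (LINT u|lborel. (\<Sum>q\<in>Q. a' q * indicator {0<..q} u)\<^sup>2) + (a m)\<^sup>2 * (m - m')"
        unfolding sq using m' by (subst Bochner_Integration.integral_add) auto
      then show ?thesis unfolding of_real_mult[symmetric] exp_add[symmetric] by (simp add: field_simps)
    qed
    finally show ?thesis .
  qed
qed

section \<open>Partitions and mean-square limits\<close>

lemma partition_of_mono:
  assumes p: "partition_of a b n p" and "i \<le> j" "j \<le> n"
  shows "p i \<le> p j"
  using assms(2,3)
proof (induction j)
  case (Suc j)
  then show ?case using p unfolding partition_of_def by (cases "i = Suc j") (auto intro: order_trans[of _ "p j"])
qed simp

lemma partition_of_mem:
  assumes p: "partition_of a b n p" and "i \<le> n"
  shows "p i \<in> {a..b}"
  using partition_of_mono[OF p, of 0 i] partition_of_mono[OF p, of i n] assms unfolding partition_of_def by auto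

text \<open>General codomain and extended integral: one notion covers random variables over
  \<open>M\<close> and pair-valued kernels over Lebesgue measure, and no term has to be integrable
  beforehand.\<close>

definition L2_lim :: "'a measure \<Rightarrow> (nat \<Rightarrow> 'a \<Rightarrow> 'b::real_normed_vector) \<Rightarrow> ('a \<Rightarrow> 'b) \<Rightarrow> bool" where
  "L2_lim M f g \<longleftrightarrow> (\<lambda>n. \<integral>\<^sup>+x. ennreal ((norm (f n x - g x))\<^sup>2) \<partial>M) \<longlonglongrightarrow> 0"

lemma norm_add_power2_le:
  fixes x y :: "'b::real_normed_vector"
  shows "(norm (x + y))\<^sup>2 \<le> 2 * (norm x)\<^sup>2 + 2 * (norm y)\<^sup>2"
proof -
  have "(norm (x + y))\<^sup>2 \<le> (norm x + norm y)\<^sup>2"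
    by (intro power_mono norm_triangle_ineq) auto
  also have "\<dots> \<le> 2 * (norm x)\<^sup>2 + 2 * (norm y)\<^sup>2"
    using zero_le_power2[of "norm x - norm y"] by (simp add: power2_eq_square algebra_simps)
  finally show ?thesis .
qed

lemma L2_lim_add:
  fixes f g :: "nat \<Rightarrow> 'a \<Rightarrow> 'b::euclidean_space"
  assumes [measurable]: "\<And>n. f n \<in> borel_measurable M" "f' \<in> borel_measurable M"
     "\<And>n. g n \<in> borel_measurable M" "g' \<in> borel_measurable M"
    and "L2_lim M f f'" "L2_lim M g g'"
  shows "L2_lim M (\<lambda>n x. f n x + g n x) (\<lambda>x. f' x + g' x)"
  unfolding L2_lim_def
proof (rule tendsto_sandwich[OF _ _ tendsto_const])
  have "(\<lambda>n. 2 * (\<integral>\<^sup>+x. ennreal ((norm (f n x - f' x))\<^sup>2) \<partial>M) + 2 * (\<integral>\<^sup>+x. ennreal ((norm (g n x - g' x))\<^sup>2) \<partial>M))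
     \<longlonglongrightarrow> 2 * 0 + 2 * 0"
    using assms(5,6) unfolding L2_lim_def by (intro tendsto_add ennreal_tendsto_cmult) auto
  then show "(\<lambda>n. 2 * (\<integral>\<^sup>+x. ennreal ((norm (f n x - f' x))\<^sup>2) \<partial>M) + 2 * (\<integral>\<^sup>+x. ennreal ((norm (g n x - g' x))\<^sup>2) \<partial>M))
     \<longlonglongrightarrow> 0" by simp
  show "\<forall>\<^sub>F n in sequentially. (\<integral>\<^sup>+x. ennreal ((norm (f n x + g n x - (f' x + g' x)))\<^sup>2) \<partial>M) \<le>
     2 * (\<integral>\<^sup>+x. ennreal ((norm (f n x - f' x))\<^sup>2) \<partial>M) + 2 * (\<integral>\<^sup>+x. ennreal ((norm (g n x - g' x))\<^sup>2) \<partial>M)"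
  proof (rule always_eventually, rule allI)
    fix n
    have "(\<integral>\<^sup>+x. ennreal ((norm (f n x + g n x - (f' x + g' x)))\<^sup>2) \<partial>M) \<le>
      (\<integral>\<^sup>+x. 2 * ennreal ((norm (f n x - f' x))\<^sup>2) + 2 * ennreal ((norm (g n x - g' x))\<^sup>2) \<partial>M)"
    proof (rule nn_integral_mono)
      fix x
      have "ennreal ((norm (f n x + g n x - (f' x + g' x)))\<^sup>2) \<le> ennreal (2 * (norm (f n x - f' x))\<^sup>2 + 2 * (norm (g n x - g' x))\<^sup>2)"
        using norm_add_power2_le[of "f n x - f' x" "g n x - g' x"] by (intro ennreal_leI) (simp add: algebra_simps)
      then show "ennreal ((norm (f n x + g n x - (f' x + g' x)))\<^sup>2) \<le>
         2 * ennreal ((norm (f n x - f' x))\<^sup>2) + 2 * ennreal ((norm (g n x - g' x))\<^sup>2)"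
        by (simp add: ennreal_plus ennreal_mult)
    qed
    then show "(\<integral>\<^sup>+x. ennreal ((norm (f n x + g n x - (f' x + g' x)))\<^sup>2) \<partial>M) \<le>
     2 * (\<integral>\<^sup>+x. ennreal ((norm (f n x - f' x))\<^sup>2) \<partial>M) + 2 * (\<integral>\<^sup>+x. ennreal ((norm (g n x - g' x))\<^sup>2) \<partial>M)"
      by (simp add: nn_integral_add nn_integral_cmult)
  qed
qed simp

lemma L2_lim_scaleR:
  fixes f :: "nat \<Rightarrow> 'a \<Rightarrow> 'b::euclidean_space"
  assumes [measurable]: "\<And>n. f n \<in> borel_measurable M" "f' \<in> borel_measurable M"
    and "L2_lim M f f'"
  shows "L2_lim M (\<lambda>n x. c *\<^sub>R f n x) (\<lambda>x. c *\<^sub>R f' x)"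
proof -
  have "(\<integral>\<^sup>+x. ennreal ((norm (c *\<^sub>R f n x - c *\<^sub>R f' x))\<^sup>2) \<partial>M) =
     ennreal (c\<^sup>2) * (\<integral>\<^sup>+x. ennreal ((norm (f n x - f' x))\<^sup>2) \<partial>M)" for n
    by (simp add: power_mult_distrib ennreal_mult nn_integral_cmult flip: scaleR_diff_right)
  moreover have "(\<lambda>n. ennreal (c\<^sup>2) * (\<integral>\<^sup>+x. ennreal ((norm (f n x - f' x))\<^sup>2) \<partial>M)) \<longlonglongrightarrow> ennreal (c\<^sup>2) * 0"
    using assms(3) unfolding L2_lim_def by (intro ennreal_tendsto_cmult) auto
  ultimately show ?thesis unfolding L2_lim_def by simp
qed

text \<open>The exponential is Lipschitz on the imaginary axis, and |x - y| \<le> e + |x - y|^2 / e.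
  Once the mean-square distance is below e^2, the transforms differ by at most 2 e, which is less
  than r for e = r / 3.\<close>

lemma (in prob_space) L2_lim_iexp:
  fixes f :: "nat \<Rightarrow> 'a \<Rightarrow> real"
  assumes [measurable]: "\<And>n. f n \<in> borel_measurable M" "g \<in> borel_measurable M" and lim: "L2_lim M f g"
  shows "(\<lambda>n. CLINT x|M. iexp (f n x)) \<longlonglongrightarrow> (CLINT x|M. iexp (g x))"
proof (rule LIMSEQ_I)
  fix r :: real assume r: "0 < r"
  define e where "e = r / 3"
  have e: "0 < e" using r by (simp add: e_def)
  have "\<forall>\<^sub>F n in sequentially. (\<integral>\<^sup>+x. ennreal ((norm (f n x - g x))\<^sup>2) \<partial>M) < ennreal (e\<^sup>2)"
    using lim e unfolding L2_lim_def by (intro order_tendstoD) auto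
  then obtain N where N: "\<And>n. n \<ge> N \<Longrightarrow> (\<integral>\<^sup>+x. ennreal ((norm (f n x - g x))\<^sup>2) \<partial>M) < ennreal (e\<^sup>2)"
    unfolding eventually_sequentially by auto
  show "\<exists>N. \<forall>n\<ge>N. norm ((CLINT x|M. iexp (f n x)) - (CLINT x|M. iexp (g x))) < r"
  proof (intro exI allI impI)
    fix n assume n: "n \<ge> N"
    have ii: "integrable M (\<lambda>x. iexp (U x))" if "U \<in> borel_measurable M" for U
      using that by (intro integrable_iexp) auto
    have pw: "norm (iexp x - iexp y) \<le> e + (norm (x - y))\<^sup>2 / e" for x y :: real
    proof -
      have "iexp x - iexp y = iexp y * (iexp (x - y) - 1)"
        by (simp add: algebra_simps flip: exp_add)
      then have "norm (iexp x - iexp y) = norm (iexp (x - y) - 1)"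
        by (simp add: norm_mult)
      also have "\<dots> \<le> \<bar>x - y\<bar>"
        using iexp_approx1[of "x - y" 0] by simp
      also have "\<dots> \<le> e + (norm (x - y))\<^sup>2 / e"
      proof -
        have "0 \<le> (\<bar>x - y\<bar> - e)\<^sup>2 + e * \<bar>x - y\<bar>" using e by simp
        then have "\<bar>x - y\<bar> * e \<le> e * e + \<bar>x - y\<bar>\<^sup>2" by (simp add: power2_eq_square algebra_simps)
        then show ?thesis using e by (simp add: field_simps power2_eq_square)
      qed
      finally show ?thesis .
    qed
    have "ennreal (norm ((CLINT x|M. iexp (f n x)) - (CLINT x|M. iexp (g x)))) =
      ennreal (norm (CLINT x|M. iexp (f n x) - iexp (g x)))"
      by (subst Bochner_Integration.integral_diff) (auto intro!: ii)
    also have "\<dots> \<le> (\<integral>\<^sup>+x. ennreal (norm (iexp (f n x) - iexp (g x))) \<partial>M)"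
      by (intro integral_norm_bound_ennreal Bochner_Integration.integrable_diff ii) auto
    also have "\<dots> \<le> (\<integral>\<^sup>+x. ennreal e + ennreal (1 / e) * ennreal ((norm (f n x - g x))\<^sup>2) \<partial>M)"
    proof (rule nn_integral_mono)
      fix x
      have "ennreal (norm (iexp (f n x) - iexp (g x))) \<le> ennreal (e + (norm (f n x - g x))\<^sup>2 / e)"
        by (intro ennreal_leI pw)
      then show "ennreal (norm (iexp (f n x) - iexp (g x))) \<le> ennreal e + ennreal (1 / e) * ennreal ((norm (f n x - g x))\<^sup>2)"
        using e by (simp add: ennreal_plus flip: ennreal_mult)
    qed
    also have "\<dots> = ennreal e + ennreal (1 / e) * (\<integral>\<^sup>+x. ennreal ((norm (f n x - g x))\<^sup>2) \<partial>M)"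
      by (simp add: nn_integral_add nn_integral_cmult emeasure_space_1)
    also have "\<dots> \<le> ennreal e + ennreal (1 / e) * ennreal (e\<^sup>2)"
      using N[OF n] by (intro add_left_mono mult_left_mono) auto
    also have "\<dots> = ennreal (2 * e)"
      using e by (simp add: power2_eq_square flip: ennreal_mult ennreal_plus)
    finally have "norm ((CLINT x|M. iexp (f n x)) - (CLINT x|M. iexp (g x))) \<le> 2 * e"
      using e by (simp add: ennreal_le_iff)
    then show "norm ((CLINT x|M. iexp (f n x)) - (CLINT x|M. iexp (g x))) < r"
      using r by (simp add: e_def)
  qed
qed

text \<open>In the difference of squares the cross term is split by Young's inequality with
  parameter e: the norm of g gets a small coefficient, while the large coefficient
  \<open>1 + 1 / e\<close> falls on the distance, which tends to 0.\<close>

lemma L2_lim_norm: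
  fixes f :: "nat \<Rightarrow> 'a \<Rightarrow> 'b::euclidean_space"
  assumes [measurable]: "\<And>n. f n \<in> borel_measurable M" "g \<in> borel_measurable M"
    and f: "\<And>n. integrable M (\<lambda>x. (norm (f n x))\<^sup>2)" and g: "integrable M (\<lambda>x. (norm (g x))\<^sup>2)"
    and lim: "L2_lim M f g"
  shows "(\<lambda>n. \<integral>x. (norm (f n x))\<^sup>2 \<partial>M) \<longlonglongrightarrow> (\<integral>x. (norm (g x))\<^sup>2 \<partial>M)"
proof (rule LIMSEQ_I)
  fix r :: real assume r: "0 < r"
  define N where "N = (\<integral>x. (norm (g x))\<^sup>2 \<partial>M)"
  have N0: "0 \<le> N" unfolding N_def by simp
  \<comment> \<open>Half of r is reserved for \<open>e * N\<close>; the summand 1 covers the case N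
    = 0.\<close>
  define e where "e = r / (2 * (N + 1))"
  have e: "0 < e" using r N0 by (simp add: e_def)
  have eN: "e * N \<le> r / 2" using r N0 by (simp add: e_def field_simps)
  define d where "d n = (\<integral>x. (norm (f n x - g x))\<^sup>2 \<partial>M)" for n
  have di: "integrable M (\<lambda>x. (norm (f n x - g x))\<^sup>2)" for n
  proof (rule Bochner_Integration.integrable_bound)
    show "integrable M (\<lambda>x. 2 * (norm (f n x))\<^sup>2 + 2 * (norm (g x))\<^sup>2)" using f g by simp
    show "AE x in M. norm ((norm (f n x - g x))\<^sup>2) \<le> norm (2 * (norm (f n x))\<^sup>2 + 2 * (norm (g x))\<^sup>2)"
      using norm_add_power2_le[of "f n x" "- g x" for x] by auto
  qed simp
  have "ennreal (d n) = (\<integral>\<^sup>+x. ennreal ((norm (f n x - g x))\<^sup>2) \<partial>M)" for n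
    unfolding d_def using di by (subst nn_integral_eq_integral) auto
  then have "(\<lambda>n. ennreal (d n)) \<longlonglongrightarrow> ennreal 0" using lim unfolding L2_lim_def by simp
  then have "d \<longlonglongrightarrow> 0" by (subst (asm) tendsto_ennreal_iff) (auto simp: d_def)
  then have "(\<lambda>n. (1 + 1 / e) * d n) \<longlonglongrightarrow> (1 + 1 / e) * 0" by (intro tendsto_intros)
  then have "\<forall>\<^sub>F n in sequentially. (1 + 1 / e) * d n < r / 2"
    using r by (intro order_tendstoD) auto
  then obtain K where K: "\<And>n. n \<ge> K \<Longrightarrow> (1 + 1 / e) * d n < r / 2"
    unfolding eventually_sequentially by auto
  have pw: "\<bar>(norm a)\<^sup>2 - (norm b)\<^sup>2\<bar> \<le> (1 + 1 / e) * (norm (a - b))\<^sup>2 + e * (norm b)\<^sup>2" for a b :: 'b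
  proof -
    define h where "h = a - b"
    have "(norm a)\<^sup>2 = (norm h)\<^sup>2 + 2 * inner h b + (norm b)\<^sup>2"
      unfolding h_def power2_norm_eq_inner by (simp add: inner_diff inner_commute algebra_simps)
    then have "\<bar>(norm a)\<^sup>2 - (norm b)\<^sup>2\<bar> \<le> (norm h)\<^sup>2 + 2 * \<bar>inner h b\<bar>"
      using zero_le_power2[of "norm h"] by linarith
    also have "\<dots> \<le> (norm h)\<^sup>2 + 2 * (norm h * norm b)"
      by (intro add_left_mono mult_left_mono Cauchy_Schwarz_ineq2) auto
    also have "2 * (norm h * norm b) \<le> (norm h)\<^sup>2 / e + e * (norm b)\<^sup>2"
    proof -
      have "0 \<le> (norm h - e * norm b)\<^sup>2 / e" using e by simp
      also have "\<dots> = (norm h)\<^sup>2 / e - 2 * (norm h * norm b) + e * (norm b)\<^sup>2"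
        using e by (simp add: power2_eq_square field_simps)
      finally show ?thesis by simp
    qed
    finally show ?thesis by (simp add: h_def algebra_simps)
  qed
  have "norm ((\<integral>x. (norm (f n x))\<^sup>2 \<partial>M) - (\<integral>x. (norm (g x))\<^sup>2 \<partial>M)) < r" if "n \<ge> K" for n
  proof -
    have "norm ((\<integral>x. (norm (f n x))\<^sup>2 \<partial>M) - (\<integral>x. (norm (g x))\<^sup>2 \<partial>M)) = \<bar>\<integral>x. (norm (f n x))\<^sup>2 - (norm (g x))\<^sup>2 \<partial>M\<bar>"
      using f g by simp
    also have "\<dots> \<le> (\<integral>x. \<bar>(norm (f n x))\<^sup>2 - (norm (g x))\<^sup>2\<bar> \<partial>M)" by (rule integral_abs_bound)
    also have "\<dots> \<le> (\<integral>x. (1 + 1 / e) * (norm (f n x - g x))\<^sup>2 + e * (norm (g x))\<^sup>2 \<partial>M)"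
      using f g di pw by (intro integral_mono) auto
    also have "\<dots> = (1 + 1 / e) * d n + e * N"
      using g di by (simp add: d_def N_def)
    also have "\<dots> < r" using K[OF that] eN by linarith
    finally show ?thesis .
  qed
  then show "\<exists>K. \<forall>n\<ge>K. norm ((\<integral>x. (norm (f n x))\<^sup>2 \<partial>M) - (\<integral>x. (norm (g x))\<^sup>2 \<partial>M)) < r" by auto
qed

section \<open>Gaussian calculus of kernels for two independent Brownian motions\<close>

locale independent_brownian_motions = prob_space M for M :: "'a measure" +
  fixes T :: real and B W :: "real \<Rightarrow> 'a \<Rightarrow> real"
  assumes T: "0 < T"
    and bmB: "brownian_motion M (natural_filtration M T B) T B"
    and bmW: "brownian_motion M (natural_filtration M T W) T W"
    and indep: "indep_set (sets (natural_filtration M T B T)) (sets (natural_filtration M T W T))"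
begin

lemma B_measurable: "t \<in> {0..T} \<Longrightarrow> B t \<in> borel_measurable M"
  and W_measurable: "t \<in> {0..T} \<Longrightarrow> W t \<in> borel_measurable M"
  using brownian_motion_measurable bmB bmW by blast+

text \<open>A kernel assigns to each time the coefficients of \<open>dB\<close> and \<open>dW\<close>; \<open>wiener_ker X \<kappa>\<close> says
  that \<open>X\<close> is the Wiener integral of \<open>\<kappa>\<close> against \<open>(B, W)\<close>.\<close>

definition lin_ker :: "('a \<Rightarrow> real) \<Rightarrow> (real \<Rightarrow> real \<times> real) \<Rightarrow> bool" where
  "lin_ker X \<kappa> \<longleftrightarrow> (\<exists>Q a b. finite Q \<and> Q \<subseteq> {0..T} \<and>
     X = (\<lambda>\<omega>. \<Sum>q\<in>Q. a q * B q \<omega> + b q * W q \<omega>) \<and>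
     \<kappa> = (\<lambda>u. \<Sum>q\<in>Q. (a q * indicator {0<..q} u, b q * indicator {0<..q} u)))"

definition wiener_ker :: "('a \<Rightarrow> real) \<Rightarrow> (real \<Rightarrow> real \<times> real) \<Rightarrow> bool" where
  "wiener_ker X \<kappa> \<longleftrightarrow> X \<in> borel_measurable M \<and> \<kappa> \<in> borel_measurable lborel \<and>
     integrable lborel (\<lambda>u. (norm (\<kappa> u))\<^sup>2) \<and>
     (\<exists>Xs \<kappa>s. (\<forall>n. lin_ker (Xs n) (\<kappa>s n)) \<and> L2_lim lborel \<kappa>s \<kappa> \<and> L2_lim M Xs X)"

lemma lin_ker_B: "t \<in> {0..T} \<Longrightarrow> lin_ker (B t) (\<lambda>u. (indicator {0<..t} u, 0))"
  unfolding lin_ker_def by (rule exI[of _ "{t}"], rule exI[of _ "\<lambda>_. 1"], rule exI[of _ "\<lambda>_. 0"]) auto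

lemma lin_ker_W: "t \<in> {0..T} \<Longrightarrow> lin_ker (W t) (\<lambda>u. (0, indicator {0<..t} u))"
  unfolding lin_ker_def by (rule exI[of _ "{t}"], rule exI[of _ "\<lambda>_. 0"], rule exI[of _ "\<lambda>_. 1"]) auto

lemma lin_ker_0: "lin_ker (\<lambda>_. 0) (\<lambda>_. 0)"
  unfolding lin_ker_def by (rule exI[of _ "{}"]) auto

lemma lin_ker_scale:
  assumes "lin_ker X \<kappa>"
  shows "lin_ker (\<lambda>\<omega>. c * X \<omega>) (\<lambda>u. c *\<^sub>R \<kappa> u)"
proof -
  obtain Q a b where "finite Q" "Q \<subseteq> {0..T}" and X: "X = (\<lambda>\<omega>. \<Sum>q\<in>Q. a q * B q \<omega> + b q * W q \<omega>)"
     "\<kappa> = (\<lambda>u. \<Sum>q\<in>Q. (a q * indicator {0<..q} u, b q * indicator {0<..q} u))"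
    using assms unfolding lin_ker_def by auto
  then show ?thesis unfolding lin_ker_def
    by (intro exI[of _ Q] exI[of _ "\<lambda>q. c * a q"] exI[of _ "\<lambda>q. c * b q"])
       (auto simp: sum_distrib_left scaleR_sum_right algebra_simps intro!: sum.cong)
qed

lemma lin_ker_add:
  assumes "lin_ker X \<kappa>" "lin_ker X' \<kappa>'"
  shows "lin_ker (\<lambda>\<omega>. X \<omega> + X' \<omega>) (\<lambda>u. \<kappa> u + \<kappa>' u)"
proof -
  obtain Q a b where Q: "finite Q" "Q \<subseteq> {0..T}" and X: "X = (\<lambda>\<omega>. \<Sum>q\<in>Q. a q * B q \<omega> + b q * W q \<omega>)"
     "\<kappa> = (\<lambda>u. \<Sum>q\<in>Q. (a q * indicator {0<..q} u, b q * indicator {0<..q} u))"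
    using assms unfolding lin_ker_def by auto
  obtain Q' a' b' where Q': "finite Q'" "Q' \<subseteq> {0..T}" and X': "X' = (\<lambda>\<omega>. \<Sum>q\<in>Q'. a' q * B q \<omega> + b' q * W q \<omega>)"
     "\<kappa>' = (\<lambda>u. \<Sum>q\<in>Q'. (a' q * indicator {0<..q} u, b' q * indicator {0<..q} u))"
    using assms unfolding lin_ker_def by auto
  define r where "r S f q = (if q \<in> S then f q else (0::real))" for S f and q :: real
  \<comment> \<open>Both sums are spread over the union of the time sets with coefficient 0 where a
    time was absent. The statement is made for any additive F so that it serves the random variable
    and the kernel alike.\<close>
  have eq: "(\<Sum>q\<in>Q. F q (a q) (b q)) + (\<Sum>q\<in>Q'. F q (a' q) (b' q)) =
      (\<Sum>q\<in>Q \<union> Q'. F q (r Q a q + r Q' a' q) (r Q b q + r Q' b' q))"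
    if F: "\<And>q x x' y y'. F q (x + x') (y + y') = F q x y + F q x' y'" for F :: "real \<Rightarrow> real \<Rightarrow> real \<Rightarrow> 'b::ab_group_add"
  proof -
    have F0: "F q 0 0 = 0" for q using F[of q 0 0 0 0] by simp
    have "(\<Sum>q\<in>Q. F q (a q) (b q)) = (\<Sum>q\<in>Q \<union> Q'. F q (r Q a q) (r Q b q))"
      "(\<Sum>q\<in>Q'. F q (a' q) (b' q)) = (\<Sum>q\<in>Q \<union> Q'. F q (r Q' a' q) (r Q' b' q))"
      using Q(1) Q'(1) F0 by (auto simp: r_def intro!: sum.mono_neutral_cong_left)
    then show ?thesis by (simp add: F sum.distrib)
  qed
  show ?thesis unfolding lin_ker_def X X'
    using Q Q'
    by (intro exI[of _ "Q \<union> Q'"] exI[of _ "\<lambda>q. r Q a q + r Q' a' q"] exI[of _ "\<lambda>q. r Q b q + r Q' b' q"] conjI ext eq)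
       (auto simp: algebra_simps)
qed

lemma lin_ker_measurable:
  assumes "lin_ker X \<kappa>"
  shows "X \<in> borel_measurable M" "\<kappa> \<in> borel_measurable lborel"
proof -
  obtain Q a b where Q: "finite Q" "Q \<subseteq> {0..T}" and X: "X = (\<lambda>\<omega>. \<Sum>q\<in>Q. a q * B q \<omega> + b q * W q \<omega>)"
     "\<kappa> = (\<lambda>u. \<Sum>q\<in>Q. (a q * indicator {0<..q} u, b q * indicator {0<..q} u))"
    using assms unfolding lin_ker_def by auto
  show "X \<in> borel_measurable M"
    unfolding X using Q by (intro borel_measurable_sum borel_measurable_add borel_measurable_times B_measurable W_measurable) auto
  show "\<kappa> \<in> borel_measurable lborel"
    unfolding X by (intro borel_measurable_sum borel_measurable_Pair) auto
qed

text \<open>Independence factors the transform into a B part and a W part, and the squared norm of a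
  pair is the sum of the squares, so the two exponents combine into one.\<close>

lemma lin_ker_iexp:
  assumes "lin_ker X \<kappa>"
  shows "integrable lborel (\<lambda>u. (norm (\<kappa> u))\<^sup>2)"
    "(CLINT x|M. iexp (X x)) = complex_of_real (exp (- (LINT u|lborel. (norm (\<kappa> u))\<^sup>2) / 2))"
proof -
  obtain Q a b where Q: "finite Q" "Q \<subseteq> {0..T}" and X: "X = (\<lambda>\<omega>. \<Sum>q\<in>Q. a q * B q \<omega> + b q * W q \<omega>)"
     "\<kappa> = (\<lambda>u. \<Sum>q\<in>Q. (a q * indicator {0<..q} u, b q * indicator {0<..q} u))"
    using assms unfolding lin_ker_def by auto
  have i: "integrable lborel (\<lambda>u. (\<Sum>q\<in>Q. c q * indicator {0<..q} u)\<^sup>2)" for c :: "real \<Rightarrow> real"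
    by (rule integrable_step_power2)
  have n: "(norm (\<kappa> u))\<^sup>2 = (\<Sum>q\<in>Q. a q * indicator {0<..q} u)\<^sup>2 + (\<Sum>q\<in>Q. b q * indicator {0<..q} u)\<^sup>2" for u
  proof -
    have "\<kappa> u = (\<Sum>q\<in>Q. a q * indicator {0<..q} u, \<Sum>q\<in>Q. b q * indicator {0<..q} u)"
    proof -
      have "(\<Sum>q\<in>Q. (f q, g q)) = (\<Sum>q\<in>Q. f q, \<Sum>q\<in>Q. g q)" for f g :: "real \<Rightarrow> real"
        using Q(1) by (induction Q rule: finite_induct) (auto simp: zero_prod_def)
      then show ?thesis unfolding X .
    qed
    then show ?thesis by (simp add: norm_Pair)
  qed
  show "integrable lborel (\<lambda>u. (norm (\<kappa> u))\<^sup>2)" unfolding n by (intro Bochner_Integration.integrable_add i)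
  have fB: "B q \<in> borel_measurable (natural_filtration M T B T)" "W q \<in> borel_measurable (natural_filtration M T W T)" if "q \<in> Q" for q
    using natural_filtration_props(4)[where T = T and X = B and M = M and s = q and t = T, OF B_measurable]
      natural_filtration_props(4)[where T = T and X = W and M = M and s = q and t = T, OF W_measurable] that Q T by auto
  have sp: "space (natural_filtration M T B T) = space M" "space (natural_filtration M T W T) = space M"
    using natural_filtration_props(1)[OF B_measurable] natural_filtration_props(1)[OF W_measurable] by auto
  have "(CLINT x|M. iexp (X x)) = (CLINT x|M. iexp ((\<Sum>q\<in>Q. a q * B q x) + (\<Sum>q\<in>Q. b q * W q x)))"
    unfolding X sum.distrib ..
  also have "\<dots> = (CLINT x|M. iexp (\<Sum>q\<in>Q. a q * B q x)) * (CLINT x|M. iexp (\<Sum>q\<in>Q. b q * W q x))"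
  proof (rule iexp_add_indep[OF indep])
    fix C :: "real set" assume C: "C \<in> sets borel"
    have "(\<lambda>x. \<Sum>q\<in>Q. a q * B q x) \<in> borel_measurable (natural_filtration M T B T)"
      using fB by (intro borel_measurable_sum borel_measurable_times) auto
    from measurable_sets[OF this C] sp
    show "(\<lambda>x. \<Sum>q\<in>Q. a q * B q x) -` C \<inter> space M \<in> sets (natural_filtration M T B T)" by simp
    have "(\<lambda>x. \<Sum>q\<in>Q. b q * W q x) \<in> borel_measurable (natural_filtration M T W T)"
      using fB by (intro borel_measurable_sum borel_measurable_times) auto
    from measurable_sets[OF this C] sp
    show "(\<lambda>x. \<Sum>q\<in>Q. b q * W q x) -` C \<inter> space M \<in> sets (natural_filtration M T W T)" by simp
  qed (use Q B_measurable W_measurable in \<open>auto intro!: borel_measurable_sum borel_measurable_times\<close>)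
  also have "\<dots> = complex_of_real (exp (- (LINT u|lborel. (norm (\<kappa> u))\<^sup>2) / 2))"
    unfolding brownian_motion_iexp_sum[OF bmB Q] brownian_motion_iexp_sum[OF bmW Q] n
      Bochner_Integration.integral_add[OF i i]
      of_real_mult[symmetric] exp_add[symmetric]
    by (simp add: field_simps)
  finally show "(CLINT x|M. iexp (X x)) = complex_of_real (exp (- (LINT u|lborel. (norm (\<kappa> u))\<^sup>2) / 2))" .
qed

lemma wiener_ker_lin:
  assumes "lin_ker X \<kappa>"
  shows "wiener_ker X \<kappa>"
  unfolding wiener_ker_def using lin_ker_measurable[OF assms] lin_ker_iexp(1)[OF assms] assms
  by (intro conjI exI[of _ "\<lambda>_. X"] exI[of _ "\<lambda>_. \<kappa>"]) (auto simp: L2_lim_def)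

lemma wiener_ker_scale:
  assumes "wiener_ker X \<kappa>"
  shows "wiener_ker (\<lambda>\<omega>. c * X \<omega>) (\<lambda>u. c *\<^sub>R \<kappa> u)"
proof -
  obtain Xs \<kappa>s where [measurable]: "X \<in> borel_measurable M" "\<kappa> \<in> borel_measurable borel" and
    i: "integrable lborel (\<lambda>u. (norm (\<kappa> u))\<^sup>2)" and l: "\<And>n. lin_ker (Xs n) (\<kappa>s n)"
    and lim: "L2_lim lborel \<kappa>s \<kappa>" "L2_lim M Xs X"
    using assms unfolding wiener_ker_def by auto
  have "L2_lim lborel (\<lambda>n u. c *\<^sub>R \<kappa>s n u) (\<lambda>u. c *\<^sub>R \<kappa> u)"
    using lin_ker_measurable[OF l] lim by (intro L2_lim_scaleR) auto
  moreover have "L2_lim M (\<lambda>n \<omega>. c *\<^sub>R Xs n \<omega>) (\<lambda>\<omega>. c *\<^sub>R X \<omega>)"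
    using lin_ker_measurable[OF l] lim by (intro L2_lim_scaleR) auto
  ultimately show ?thesis unfolding wiener_ker_def
    using i lin_ker_scale[OF l, of c]
    by (intro conjI exI[of _ "\<lambda>n \<omega>. c * Xs n \<omega>"] exI[of _ "\<lambda>n u. c *\<^sub>R \<kappa>s n u"]) (auto simp: power_mult_distrib)
qed

lemma wiener_ker_add:
  assumes "wiener_ker X \<kappa>" "wiener_ker X' \<kappa>'"
  shows "wiener_ker (\<lambda>\<omega>. X \<omega> + X' \<omega>) (\<lambda>u. \<kappa> u + \<kappa>' u)"
proof -
  obtain Xs \<kappa>s where [measurable]: "X \<in> borel_measurable M" "\<kappa> \<in> borel_measurable borel" and
    i: "integrable lborel (\<lambda>u. (norm (\<kappa> u))\<^sup>2)" and l: "\<And>n. lin_ker (Xs n) (\<kappa>s n)"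
    and lim: "L2_lim lborel \<kappa>s \<kappa>" "L2_lim M Xs X"
    using assms unfolding wiener_ker_def by auto
  obtain Xs' \<kappa>s' where [measurable]: "X' \<in> borel_measurable M" "\<kappa>' \<in> borel_measurable borel" and
    i': "integrable lborel (\<lambda>u. (norm (\<kappa>' u))\<^sup>2)" and l': "\<And>n. lin_ker (Xs' n) (\<kappa>s' n)"
    and lim': "L2_lim lborel \<kappa>s' \<kappa>'" "L2_lim M Xs' X'"
    using assms unfolding wiener_ker_def by auto
  have "integrable lborel (\<lambda>u. (norm (\<kappa> u + \<kappa>' u))\<^sup>2)"
  proof (rule Bochner_Integration.integrable_bound)
    show "integrable lborel (\<lambda>u. 2 * (norm (\<kappa> u))\<^sup>2 + 2 * (norm (\<kappa>' u))\<^sup>2)" using i i' by simp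
    show "AE u in lborel. norm ((norm (\<kappa> u + \<kappa>' u))\<^sup>2) \<le> norm (2 * (norm (\<kappa> u))\<^sup>2 + 2 * (norm (\<kappa>' u))\<^sup>2)"
      using norm_add_power2_le by auto
  qed simp
  moreover have "L2_lim lborel (\<lambda>n u. \<kappa>s n u + \<kappa>s' n u) (\<lambda>u. \<kappa> u + \<kappa>' u)"
    using lin_ker_measurable[OF l] lin_ker_measurable[OF l'] lim lim' by (intro L2_lim_add) auto
  moreover have "L2_lim M (\<lambda>n \<omega>. Xs n \<omega> + Xs' n \<omega>) (\<lambda>\<omega>. X \<omega> + X' \<omega>)"
    using lin_ker_measurable[OF l] lin_ker_measurable[OF l'] lim lim' by (intro L2_lim_add) auto
  ultimately show ?thesis unfolding wiener_ker_def
    using lin_ker_add[OF l l']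
    by (intro conjI exI[of _ "\<lambda>n \<omega>. Xs n \<omega> + Xs' n \<omega>"] exI[of _ "\<lambda>n u. \<kappa>s n u + \<kappa>s' n u"]) auto
qed

text \<open>Both sides pass to the limit along the approximating sequence: the transforms because
  the variables converge in mean square, the norms because the kernels do. From here on, laws are
  computed from kernels alone.\<close>

lemma wiener_ker_iexp:
  assumes "wiener_ker X \<kappa>"
  shows "(CLINT x|M. iexp (X x)) = complex_of_real (exp (- (LINT u|lborel. (norm (\<kappa> u))\<^sup>2) / 2))"
proof -
  obtain Xs \<kappa>s where [measurable]: "X \<in> borel_measurable M" "\<kappa> \<in> borel_measurable borel" and
    i: "integrable lborel (\<lambda>u. (norm (\<kappa> u))\<^sup>2)" and l: "\<And>n. lin_ker (Xs n) (\<kappa>s n)"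
    and lim: "L2_lim lborel \<kappa>s \<kappa>" "L2_lim M Xs X"
    using assms unfolding wiener_ker_def by auto
  have "(\<lambda>n. CLINT x|M. iexp (Xs n x)) \<longlonglongrightarrow> (CLINT x|M. iexp (X x))"
    using lin_ker_measurable[OF l] lim by (intro L2_lim_iexp) auto
  moreover have "(\<lambda>n. LINT u|lborel. (norm (\<kappa>s n u))\<^sup>2) \<longlonglongrightarrow> (LINT u|lborel. (norm (\<kappa> u))\<^sup>2)"
    using lin_ker_measurable[OF l] lin_ker_iexp(1)[OF l] lim i by (intro L2_lim_norm) auto
  then have "(\<lambda>n. complex_of_real (exp (- (LINT u|lborel. (norm (\<kappa>s n u))\<^sup>2) / 2))) \<longlonglongrightarrow>
     complex_of_real (exp (- (LINT u|lborel. (norm (\<kappa> u))\<^sup>2) / 2))"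
    by (intro tendsto_intros) auto
  then have "(\<lambda>n. CLINT x|M. iexp (Xs n x)) \<longlonglongrightarrow> complex_of_real (exp (- (LINT u|lborel. (norm (\<kappa> u))\<^sup>2) / 2))"
    unfolding lin_ker_iexp(2)[OF l] .
  ultimately show ?thesis by (rule LIMSEQ_unique)
qed

lemma lin_ker_step_integral:
  assumes p: "partition_of t T n p" and t: "0 \<le> t"
  shows "lin_ker (step_integral W n p c) (\<lambda>u. (0, step_fun n p c u))"
proof -
  note mono = partition_of_mono[OF p]
  have pT: "p i \<in> {0..T}" if "i \<le> n" for i
    using partition_of_mem[OF p that] t by auto
  have "lin_ker (\<lambda>\<omega>. \<Sum>i<m. c i * (W (p (Suc i)) \<omega> - W (p i) \<omega>)) (\<lambda>u. (0, \<Sum>i<m. c i * indicator {p i<..p (Suc i)} u))"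
    if "m \<le> n" for m
    using that
  proof (induction m)
    case 0
    then show ?case using lin_ker_0 by (simp add: zero_prod_def)
  next
    case (Suc m)
    have "indicator {p m<..p (Suc m)} u = indicator {0<..p (Suc m)} u - (indicator {0<..p m} u :: real)" for u
      using pT[of m] pT[of "Suc m"] mono[of m "Suc m"] Suc.prems by (auto simp: indicator_def)
    then show ?case
      using lin_ker_add[OF Suc.IH lin_ker_scale[OF lin_ker_add[OF lin_ker_W[OF pT[of "Suc m"]] lin_ker_scale[OF lin_ker_W[OF pT[of m]], of "-1"]], of "c m"]] Suc.prems
      by simp
  qed
  from this[of n] show ?thesis
    unfolding step_integral_def[abs_def] step_fun_def by simp
qed

text \<open>The approximation of \<sigma> is only controlled on [t, T], while a kernel lives on the
  whole line. Hence the cut-off to (t, T], the region where the step functions live.\<close>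

lemma wiener_ker_integral:
  assumes X: "has_wiener_integral M W t T \<sigma> X" and t: "t \<in> {0..T}"
    and [measurable]: "set_borel_measurable borel {0..T} \<sigma>"
    and \<sigma>2: "set_integrable lborel {t..T} (\<lambda>s. (\<sigma> s)\<^sup>2)"
  shows "wiener_ker X (\<lambda>u. (0, indicator {t<..T} u * \<sigma> u))"
proof -
  obtain n p c where Xm: "X \<in> borel_measurable M" and p: "\<And>k. partition_of t T (n k) (p k)" and
    l1: "(\<lambda>k. \<integral>\<^sup>+u\<in>{t..T}. ennreal ((step_fun (n k) (p k) (c k) u - \<sigma> u)\<^sup>2) \<partial>lborel) \<longlonglongrightarrow> 0" and
    l2: "(\<lambda>k. \<integral>\<^sup>+\<omega>. ennreal ((step_integral W (n k) (p k) (c k) \<omega> - X \<omega>)\<^sup>2) \<partial>M) \<longlonglongrightarrow> 0"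
    using X unfolding has_wiener_integral_def by auto
  have "(\<lambda>u. indicator {t<..T} u * (indicator {0..T} u *\<^sub>R \<sigma> u)) \<in> borel_measurable borel"
    using assms(3) unfolding set_borel_measurable_def by measurable
  moreover have ind: "indicator {t<..T} u * (indicator {0..T} u *\<^sub>R \<sigma> u) = indicator {t<..T} u * \<sigma> u" for u
    using t by (auto simp: indicator_def)
  ultimately have m: "(\<lambda>u. indicator {t<..T} u * \<sigma> u) \<in> borel_measurable borel" by (simp only:)
  have i: "integrable lborel (\<lambda>u. (norm (0::real, indicator {t<..T} u * \<sigma> u))\<^sup>2)"
  proof (rule Bochner_Integration.integrable_bound[OF \<sigma>2[unfolded set_integrable_def]])
    show "(\<lambda>u. (norm (0::real, indicator {t<..T} u * \<sigma> u))\<^sup>2) \<in> borel_measurable lborel"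
      using m by (simp add: norm_Pair)
  qed (auto simp: indicator_def norm_Pair)
  have "L2_lim lborel (\<lambda>k u. (0::real, step_fun (n k) (p k) (c k) u)) (\<lambda>u. (0, indicator {t<..T} u * \<sigma> u))"
    unfolding L2_lim_def
  proof (rule tendsto_sandwich[OF _ _ tendsto_const l1])
    \<comment> \<open>Outside (t, T] the step function vanishes together with the cut-off kernel,
      also at u = t because the cells are open on the left.\<close>
    have "(norm ((0::real, step_fun (n k) (p k) (c k) u) - (0, indicator {t<..T} u * \<sigma> u)))\<^sup>2 \<le>
       (step_fun (n k) (p k) (c k) u - \<sigma> u)\<^sup>2 * indicator {t..T} u" for k u
    proof (cases "u \<in> {t<..T}")
      case True
      then show ?thesis by (simp add: norm_Pair)
    next
      case False
      have le: "t \<le> p k i \<and> p k i \<le> T" if "i \<le> n k" for i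
        using partition_of_mem[OF p that] by simp
      have "step_fun (n k) (p k) (c k) u = 0"
        unfolding step_fun_def
      proof (rule sum.neutral, rule ballI)
        fix i assume "i \<in> {..<n k}"
        then have "u \<notin> {p k i<..p k (Suc i)}" using le[of i] le[of "Suc i"] False by auto
        then show "c k i * indicator {p k i<..p k (Suc i)} u = 0" by simp
      qed
      then show ?thesis using False by (simp add: norm_Pair)
    qed
    then show "\<forall>\<^sub>F k in sequentially. (\<integral>\<^sup>+u. ennreal ((norm ((0::real, step_fun (n k) (p k) (c k) u) - (0, indicator {t<..T} u * \<sigma> u)))\<^sup>2) \<partial>lborel)
       \<le> (\<integral>\<^sup>+u\<in>{t..T}. ennreal ((step_fun (n k) (p k) (c k) u - \<sigma> u)\<^sup>2) \<partial>lborel)"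
      by (intro always_eventually allI nn_integral_mono)
         (simp add: ennreal_leI ennreal_indicator[symmetric] flip: ennreal_mult)
  qed simp
  moreover have "L2_lim M (\<lambda>k. step_integral W (n k) (p k) (c k)) X"
    using l2 unfolding L2_lim_def by simp
  ultimately show ?thesis
    unfolding wiener_ker_def using Xm m i lin_ker_step_integral[OF p] t
    by (intro conjI exI[of _ "\<lambda>k. step_integral W (n k) (p k) (c k)"] exI[of _ "\<lambda>k u. (0::real, step_fun (n k) (p k) (c k) u)"])
       auto
qed

end

section \<open>Orthogonality of the Euler steps\<close>

lemma riemann_sum_error:
  fixes f :: "real \<Rightarrow> real"
  assumes f: "continuous_on {a..b} f" and p: "partition_of a b n p"
    and mesh: "\<And>i. i < n \<Longrightarrow> p (Suc i) - p i \<le> \<eta>"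
    and osc: "\<And>x y. x \<in> {a..b} \<Longrightarrow> y \<in> {a..b} \<Longrightarrow> \<bar>x - y\<bar> \<le> \<eta> \<Longrightarrow> \<bar>f x - f y\<bar> \<le> \<epsilon>"
  shows "\<bar>(\<Sum>i<n. f (p i) * (p (Suc i) - p i)) - integral {a..b} f\<bar> \<le> \<epsilon> * (b - a)"
proof -
  note mono = partition_of_mono[OF p]
  have pab: "p i \<in> {a..b}" if "i \<le> n" for i
    using partition_of_mem[OF p that] .
  have "\<bar>(\<Sum>i<m. f (p i) * (p (Suc i) - p i)) - integral {a..p m} f\<bar> \<le> \<epsilon> * (p m - a)" if "m \<le> n" for m
    using that
  proof (induction m)
    case 0
    then show ?case using p by (simp add: partition_of_def)
  next
    case (Suc m)
    have le: "a \<le> p m" "p m \<le> p (Suc m)" "p (Suc m) \<le> b"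
      using pab[of m] pab[of "Suc m"] mono[of m "Suc m"] Suc.prems by auto
    have c: "continuous_on {p m..p (Suc m)} f" "continuous_on {a..p (Suc m)} f"
      using le by (auto intro!: continuous_on_subset[OF f])
    have split: "integral {a..p (Suc m)} f = integral {a..p m} f + integral {p m..p (Suc m)} f"
      using le c(2) by (intro Henstock_Kurzweil_Integration.integral_combine[symmetric] integrable_continuous_interval) auto
    have "norm (integral {p m..p (Suc m)} (\<lambda>x. f x - f (p m))) \<le> \<epsilon> * (p (Suc m) - p m)"
    proof (rule integral_bound)
      show "norm (f t - f (p m)) \<le> \<epsilon>" if "t \<in> {p m..p (Suc m)}" for t
        unfolding real_norm_def using that le mesh[of m] Suc.prems by (intro osc) auto
    qed (use le c in \<open>auto intro!: continuous_intros\<close>)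
    also have "integral {p m..p (Suc m)} (\<lambda>x. f x - f (p m)) = integral {p m..p (Suc m)} f - f (p m) * (p (Suc m) - p m)"
      using le c by (subst Henstock_Kurzweil_Integration.integral_diff) (auto intro!: integrable_continuous_interval)
    finally have "\<bar>integral {p m..p (Suc m)} f - f (p m) * (p (Suc m) - p m)\<bar> \<le> \<epsilon> * (p (Suc m) - p m)" by simp
    moreover have "\<bar>(\<Sum>i<m. f (p i) * (p (Suc i) - p i)) - integral {a..p m} f\<bar> \<le> \<epsilon> * (p m - a)"
      using Suc by simp
    ultimately show ?case unfolding split by (simp add: algebra_simps abs_le_iff)
  qed
  from this[of n] show ?thesis using p by (simp add: partition_of_def)
qed

lemma riemann_sum_tendsto:
  fixes f :: "real \<Rightarrow> real"
  assumes f: "continuous_on {a..b} f" and ab: "a \<le> b" and p: "\<And>n. partition_of a b (N n) (p n)"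
    and mesh: "\<And>n i. i < N n \<Longrightarrow> p n (Suc i) - p n i \<le> \<eta> n" and \<eta>: "\<eta> \<longlonglongrightarrow> 0"
  shows "(\<lambda>n. \<Sum>i<N n. f (p n i) * (p n (Suc i) - p n i)) \<longlonglongrightarrow> integral {a..b} f"
proof (rule LIMSEQ_I)
  fix r :: real assume r: "0 < r"
  define \<epsilon> where "\<epsilon> = r / (2 * (b - a + 1))"
  have \<epsilon>: "0 < \<epsilon>" "\<epsilon> * (b - a) < r"
  proof -
    show "0 < \<epsilon>" using r ab by (simp add: \<epsilon>_def)
    have "\<epsilon> * (b - a) \<le> r / 2" using r ab by (simp add: \<epsilon>_def field_simps)
    then show "\<epsilon> * (b - a) < r" using r by simp
  qed
  obtain d where d: "0 < d" "\<And>x y. x \<in> {a..b} \<Longrightarrow> y \<in> {a..b} \<Longrightarrow> dist y x < d \<Longrightarrow> dist (f y) (f x) < \<epsilon>"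
    using compact_uniformly_continuous[OF f compact_Icc] \<epsilon> unfolding uniformly_continuous_on_def by metis
  have "\<forall>\<^sub>F n in sequentially. \<eta> n < d" using \<eta> d by (intro order_tendstoD) auto
  then obtain K where K: "\<And>n. n \<ge> K \<Longrightarrow> \<eta> n < d" unfolding eventually_sequentially by auto
  have "norm ((\<Sum>i<N n. f (p n i) * (p n (Suc i) - p n i)) - integral {a..b} f) < r" if "n \<ge> K" for n
  proof -
    have "\<bar>(\<Sum>i<N n. f (p n i) * (p n (Suc i) - p n i)) - integral {a..b} f\<bar> \<le> \<epsilon> * (b - a)"
    proof (rule riemann_sum_error[OF f p mesh])
      fix x y assume "x \<in> {a..b}" "y \<in> {a..b}" "\<bar>x - y\<bar> \<le> \<eta> n"
      then show "\<bar>f x - f y\<bar> \<le> \<epsilon>"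
        using d(2)[of x y] K[OF that] by (auto simp: dist_real_def abs_minus_commute)
    qed
    then show ?thesis using \<epsilon> by simp
  qed
  then show "\<exists>K. \<forall>n\<ge>K. norm ((\<Sum>i<N n. f (p n i) * (p n (Suc i) - p n i)) - integral {a..b} f) < r" by auto
qed

lemma uniform_riemann_sum_tendsto:
  fixes f :: "real \<Rightarrow> real"
  assumes f: "continuous_on {a..b} f" and ab: "a \<le> b"
  shows "(\<lambda>m. \<Sum>k<Suc m. f (a + real k * ((b - a) / Suc m)) * ((b - a) / Suc m)) \<longlonglongrightarrow> integral {a..b} f"
proof -
  define \<delta> where "\<delta> m = (b - a) / Suc m" for m
  define p where "p m k = a + real k * \<delta> m" for m k
  have \<delta>: "0 \<le> \<delta> m" "real (Suc m) * \<delta> m = b - a" for m using ab by (simp_all add: \<delta>_def)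
  have dp: "p m (Suc k) - p m k = \<delta> m" for m k by (simp add: p_def algebra_simps)
  have "(\<lambda>m. \<Sum>k<Suc m. f (p m k) * (p m (Suc k) - p m k)) \<longlonglongrightarrow> integral {a..b} f"
  proof (rule riemann_sum_tendsto[where \<eta> = \<delta>, OF f ab])
    show "partition_of a b (Suc m) (p m)" for m
      unfolding partition_of_def
    proof (intro conjI allI impI)
      show "p m (Suc m) = b" unfolding p_def \<delta> by simp
      show "p m i \<le> p m (Suc i)" for i using dp[of m i] \<delta>(1)[of m] by simp
    qed (simp add: p_def)
    show "p m (Suc i) - p m i \<le> \<delta> m" for m i by (simp add: dp)
    show "\<delta> \<longlonglongrightarrow> 0" unfolding \<delta>_def using LIMSEQ_Suc[OF lim_const_over_n[of "b - a"]] by simp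
  qed
  then show ?thesis unfolding dp by (simp only: p_def \<delta>_def)
qed

section \<open>Norms and inner products of kernels\<close>

definition L2_kernel :: "(real \<Rightarrow> real \<times> real) \<Rightarrow> bool" where
  "L2_kernel \<kappa> \<longleftrightarrow> \<kappa> \<in> borel_measurable lborel \<and> integrable lborel (\<lambda>u. (norm (\<kappa> u))\<^sup>2)"

definition ker_norm2 :: "(real \<Rightarrow> real \<times> real) \<Rightarrow> real" where
  "ker_norm2 \<kappa> = (LINT u|lborel. (norm (\<kappa> u))\<^sup>2)"

definition ker_inner :: "(real \<Rightarrow> real \<times> real) \<Rightarrow> (real \<Rightarrow> real \<times> real) \<Rightarrow> real" where
  "ker_inner \<kappa> \<kappa>' = (LINT u|lborel. inner (\<kappa> u) (\<kappa>' u))"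

lemma L2_kernel_inner:
  assumes "L2_kernel \<kappa>" "L2_kernel \<kappa>'"
  shows "integrable lborel (\<lambda>u. inner (\<kappa> u) (\<kappa>' u))"
proof -
  have [measurable]: "\<kappa> \<in> borel_measurable borel" "\<kappa>' \<in> borel_measurable borel" and
    i: "integrable lborel (\<lambda>u. (norm (\<kappa> u))\<^sup>2 + (norm (\<kappa>' u))\<^sup>2)"
    using assms by (auto simp: L2_kernel_def)
  show ?thesis
  proof (rule Bochner_Integration.integrable_bound[OF i])
    have "\<bar>inner x y\<bar> \<le> (norm x)\<^sup>2 + (norm y)\<^sup>2" for x y :: "real \<times> real"
    proof -
      have "\<bar>inner x y\<bar> \<le> norm x * norm y" by (rule Cauchy_Schwarz_ineq2)
      also have "\<dots> \<le> (norm x)\<^sup>2 + (norm y)\<^sup>2"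
        using zero_le_power2[of "norm x - norm y"] zero_le_power2[of "norm x"] zero_le_power2[of "norm y"]
        unfolding power2_diff by linarith
      finally show ?thesis .
    qed
    then show "AE u in lborel. norm (inner (\<kappa> u) (\<kappa>' u)) \<le> norm ((norm (\<kappa> u))\<^sup>2 + (norm (\<kappa>' u))\<^sup>2)"
      by simp
  qed measurable
qed

lemma L2_kernel_add_scale:
  assumes "L2_kernel \<kappa>" "L2_kernel \<kappa>'"
  shows "L2_kernel (\<lambda>u. \<kappa> u + c *\<^sub>R \<kappa>' u)"
    "ker_norm2 (\<lambda>u. \<kappa> u + c *\<^sub>R \<kappa>' u) = ker_norm2 \<kappa> + 2 * c * ker_inner \<kappa> \<kappa>' + c\<^sup>2 * ker_norm2 \<kappa>'"
proof -
  have [measurable]: "\<kappa> \<in> borel_measurable borel" "\<kappa>' \<in> borel_measurable borel" and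
    i: "integrable lborel (\<lambda>u. (norm (\<kappa> u))\<^sup>2)" "integrable lborel (\<lambda>u. (norm (\<kappa>' u))\<^sup>2)"
    using assms by (auto simp: L2_kernel_def)
  note j = L2_kernel_inner[OF assms]
  have eq: "(norm (\<kappa> u + c *\<^sub>R \<kappa>' u))\<^sup>2 = (norm (\<kappa> u))\<^sup>2 + 2 * c * inner (\<kappa> u) (\<kappa>' u) + c\<^sup>2 * (norm (\<kappa>' u))\<^sup>2" for u
    unfolding power2_norm_eq_inner by (simp add: inner_add inner_commute algebra_simps power2_eq_square)
  show "L2_kernel (\<lambda>u. \<kappa> u + c *\<^sub>R \<kappa>' u)" unfolding L2_kernel_def eq using i j by simp
  show "ker_norm2 (\<lambda>u. \<kappa> u + c *\<^sub>R \<kappa>' u) = ker_norm2 \<kappa> + 2 * c * ker_inner \<kappa> \<kappa>' + c\<^sup>2 * ker_norm2 \<kappa>'"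
    unfolding ker_norm2_def ker_inner_def eq using i j by simp
qed

lemma ker_inner_sum:
  assumes "L2_kernel \<kappa>" "\<And>k. k \<in> K \<Longrightarrow> L2_kernel (\<kappa>' k)"
  shows "ker_inner \<kappa> (\<lambda>u. \<Sum>k\<in>K. \<kappa>' k u) = (\<Sum>k\<in>K. ker_inner \<kappa> (\<kappa>' k))"
  unfolding ker_inner_def inner_sum_right using assms by (intro Bochner_Integration.integral_sum L2_kernel_inner) auto

context independent_brownian_motions
begin

lemma wiener_ker_L2: "wiener_ker X \<kappa> \<Longrightarrow> L2_kernel \<kappa>"
  unfolding wiener_ker_def L2_kernel_def by auto

lemma wiener_ker_measurable: "wiener_ker X \<kappa> \<Longrightarrow> X \<in> borel_measurable M"
  unfolding wiener_ker_def by auto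

lemma wiener_ker_0: "wiener_ker (\<lambda>_. 0) (\<lambda>_. 0)"
  by (rule wiener_ker_lin[OF lin_ker_0])

text \<open>\<open>V t\<close> is prescribed only on \<open>space M\<close>, so having a kernel must
  be insensitive to values outside it.\<close>

lemma wiener_ker_cong:
  assumes X: "wiener_ker X \<kappa>" and eq: "\<And>\<omega>. \<omega> \<in> space M \<Longrightarrow> X \<omega> = Y \<omega>"
  shows "wiener_ker Y \<kappa>"
proof -
  have "L2_lim M Xs Y = L2_lim M Xs X" for Xs
    unfolding L2_lim_def using eq by (auto intro!: arg_cong2[where f = "\<lambda>x y. filterlim x y sequentially"] nn_integral_cong)
  moreover have "Y \<in> borel_measurable M \<longleftrightarrow> X \<in> borel_measurable M"
    using eq by (intro measurable_cong) auto
  ultimately show ?thesis using X unfolding wiener_ker_def by simp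
qed

lemma wiener_ker_sum:
  assumes "\<And>k. k \<in> K \<Longrightarrow> wiener_ker (X k) (\<kappa> k)"
  shows "wiener_ker (\<lambda>\<omega>. \<Sum>k\<in>K. X k \<omega>) (\<lambda>u. \<Sum>k\<in>K. \<kappa> k u)"
  using assms
  by (induction K rule: infinite_finite_induct) (auto intro: wiener_ker_0 wiener_ker_add)

end

section \<open>Kernels and Euler steps of the enlargement\<close>

locale brownian_enlargement = independent_brownian_motions M T B W
  for M :: "'a measure" and T B W +
  fixes \<sigma> :: "real \<Rightarrow> real" and S V :: "real \<Rightarrow> 'a \<Rightarrow> real"
  assumes \<sigma>_measurable: "set_borel_measurable borel {0..T} \<sigma>"
    and \<sigma>_square: "set_integrable lborel {0..T} (\<lambda>s. (\<sigma> s)\<^sup>2)"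
    and S: "\<And>t. t \<in> {0..T} \<Longrightarrow> has_wiener_integral M W t T \<sigma> (S t)"
    and S_cont: "AE \<omega> in M. continuous_on {0..T} (\<lambda>t. S t \<omega>)"
    and V: "\<And>t \<omega>. t \<in> {0..T} \<Longrightarrow> \<omega> \<in> space M \<Longrightarrow> V t \<omega> = B T \<omega> + S t \<omega>"
begin

definition tail_var :: "real \<Rightarrow> real" where
  "tail_var t = (LINT u:{t..T}|lborel. (\<sigma> u)\<^sup>2)"

text \<open>The \<open>D\<close> of the overview; \<open>ker_norm2_gap\<close> identifies it as the
  squared norm of \<open>gap_ker\<close>. It is positive before T and equals 0 at T.\<close>

definition gap_var :: "real \<Rightarrow> real" where
  "gap_var t = T + tail_var t - t"

text \<open>At time T the denominator is 0, so \<open>drift T\<close> takes the value 0 by the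
  convention for division.\<close>

definition drift :: "real \<Rightarrow> 'a \<Rightarrow> real" where
  "drift t \<omega> = (V t \<omega> - B t \<omega>) / gap_var t"

definition gap_ker :: "real \<Rightarrow> real \<Rightarrow> real \<times> real" where
  "gap_ker t u = (indicator {t<..T} u, indicator {t<..T} u * \<sigma> u)"

definition V_ker :: "real \<Rightarrow> real \<Rightarrow> real \<times> real" where
  "V_ker t u = (indicator {0<..T} u, indicator {t<..T} u * \<sigma> u)"

text \<open>One Euler step of \<open>B\<close> minus its drift; exactly orthogonal to the information up to time \<open>u\<close>.\<close>

definition euler_step :: "real \<Rightarrow> real \<Rightarrow> 'a \<Rightarrow> real" where
  "euler_step u d \<omega> = B (u + d) \<omega> - B u \<omega> - d * drift u \<omega>"

definition euler_ker :: "real \<Rightarrow> real \<Rightarrow> real \<Rightarrow> real \<times> real" where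
  "euler_ker u d x = (indicator {u<..u + d} x, 0) - (d / gap_var u) *\<^sub>R gap_ker u x"

text \<open>The integrals with such a kernel are those known at time \<open>u\<close>: the future noise enters
  only through \<open>V\<close>, with the weight \<open>c\<close>.\<close>

definition past_ker :: "real \<Rightarrow> (real \<Rightarrow> real \<times> real) \<Rightarrow> bool" where
  "past_ker u \<kappa> \<longleftrightarrow> (\<exists>c. \<forall>x\<in>{u<..T}. \<kappa> x = (c, c * \<sigma> x))"

lemma \<sigma>_square_on: "t \<in> {0..T} \<Longrightarrow> set_integrable lborel {t..T} (\<lambda>s. (\<sigma> s)\<^sup>2)"
  by (rule set_integrable_subset[OF \<sigma>_square]) auto

text \<open>Kernels use half-open intervals, so that increments subtract exactly, while
  \<open>tail_var\<close> integrates over the closed interval; the two differ in the null point t.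
  Measurability on (t, T] is inherited by multiplying the integrable closed version with an
  indicator.\<close>

lemma tail_integral:
  assumes t: "t \<in> {0..T}"
  shows "integrable lborel (\<lambda>u. indicator {t<..T} u * (\<sigma> u)\<^sup>2)"
    "(LINT u|lborel. indicator {t<..T} u * (\<sigma> u)\<^sup>2) = tail_var t"
    "0 \<le> tail_var t"
proof -
  have i: "integrable lborel (\<lambda>u. indicator {t..T} u * (\<sigma> u)\<^sup>2)"
    using \<sigma>_square_on[OF t] by (simp add: set_integrable_def)
  have ae: "AE u in lborel. indicator {t..T} u * (\<sigma> u)\<^sup>2 = indicator {t<..T} u * (\<sigma> u)\<^sup>2"
    using AE_lborel_singleton[of t] by eventually_elim (auto simp: indicator_def)
  have m: "(\<lambda>u. indicator {t<..T} u * (\<sigma> u)\<^sup>2) \<in> borel_measurable lborel"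
  proof -
    have "(\<lambda>u. indicator {t<..T} u * (indicator {t..T} u * (\<sigma> u)\<^sup>2)) \<in> borel_measurable lborel"
      by (rule borel_measurable_times[OF _ borel_measurable_integrable[OF i]]) simp
    moreover have "indicator {t<..T} u * (indicator {t..T} u * (\<sigma> u)\<^sup>2) = indicator {t<..T} u * (\<sigma> u)\<^sup>2" for u
      by (auto simp: indicator_def)
    ultimately show ?thesis by (simp only:)
  qed
  show "integrable lborel (\<lambda>u. indicator {t<..T} u * (\<sigma> u)\<^sup>2)"
    using i ae m borel_measurable_integrable[OF i] by (subst integrable_cong_AE[symmetric]) auto
  show "(LINT u|lborel. indicator {t<..T} u * (\<sigma> u)\<^sup>2) = tail_var t"
    unfolding tail_var_def set_lebesgue_integral_def real_scaleR_def
    using ae m borel_measurable_integrable[OF i] by (intro integral_cong_AE[symmetric])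
  show "0 \<le> tail_var t"
    unfolding tail_var_def set_lebesgue_integral_def by (intro Bochner_Integration.integral_nonneg) simp
qed

lemma gap_var_pos: "t \<in> {0..<T} \<Longrightarrow> 0 < gap_var t"
  and gap_var_ge: "t \<in> {0..T} \<Longrightarrow> T - t \<le> gap_var t"
  using tail_integral(3)[of t] by (auto simp: gap_var_def)

lemma wiener_ker_V:
  assumes t: "t \<in> {0..T}"
  shows "wiener_ker (V t) (V_ker t)"
proof -
  have "wiener_ker (\<lambda>\<omega>. B T \<omega> + S t \<omega>) (\<lambda>u. (indicator {0<..T} u, 0) + (0, indicator {t<..T} u * \<sigma> u))"
    using T t by (intro wiener_ker_add wiener_ker_lin[OF lin_ker_B] wiener_ker_integral S \<sigma>_measurable \<sigma>_square_on) auto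
  then show ?thesis
    unfolding V_ker_def[abs_def] using V[OF t] by (auto elim!: wiener_ker_cong)
qed

lemma wiener_ker_B: "t \<in> {0..T} \<Longrightarrow> wiener_ker (B t) (\<lambda>u. (indicator {0<..t} u, 0))"
  by (rule wiener_ker_lin[OF lin_ker_B])

lemma V_measurable: "t \<in> {0..T} \<Longrightarrow> V t \<in> borel_measurable M"
  using wiener_ker_V wiener_ker_measurable by blast

lemma wiener_ker_gap:
  assumes t: "t \<in> {0..T}"
  shows "wiener_ker (\<lambda>\<omega>. V t \<omega> - B t \<omega>) (gap_ker t)"
proof -
  have "wiener_ker (\<lambda>\<omega>. V t \<omega> + (-1) * B t \<omega>) (\<lambda>u. V_ker t u + (-1) *\<^sub>R (indicator {0<..t} u, 0))"
    using t by (intro wiener_ker_add wiener_ker_scale wiener_ker_V wiener_ker_B)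
  moreover have "V_ker t u + (-1) *\<^sub>R (indicator {0<..t} u, 0) = gap_ker t u" for u
    using t by (auto simp: V_ker_def gap_ker_def indicator_def)
  ultimately show ?thesis by simp
qed

lemma wiener_ker_euler:
  assumes "0 \<le> u" "0 \<le> d" "u + d \<le> T"
  shows "wiener_ker (euler_step u d) (euler_ker u d)"
proof -
  have "wiener_ker (\<lambda>\<omega>. (B (u + d) \<omega> + (-1) * B u \<omega>) + (- (d / gap_var u)) * (V u \<omega> - B u \<omega>))
     (\<lambda>x. ((indicator {0<..u + d} x, 0) + (-1) *\<^sub>R (indicator {0<..u} x, 0)) + (- (d / gap_var u)) *\<^sub>R gap_ker u x)"
    using assms by (intro wiener_ker_add wiener_ker_scale wiener_ker_gap wiener_ker_B) auto
  moreover have "((indicator {0<..u + d} x, 0) + (-1) *\<^sub>R (indicator {0<..u} x, 0)) + (- (d / gap_var u)) *\<^sub>R gap_ker u x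
     = euler_ker u d x" for x
    using assms by (auto simp: euler_ker_def indicator_def)
  moreover have "(B (u + d) \<omega> + (-1) * B u \<omega>) + (- (d / gap_var u)) * (V u \<omega> - B u \<omega>) = euler_step u d \<omega>" for \<omega>
    by (simp add: euler_step_def drift_def)
  ultimately show ?thesis by simp
qed

lemma past_ker_mono: "past_ker u \<kappa> \<Longrightarrow> u \<le> v \<Longrightarrow> past_ker v \<kappa>"
  unfolding past_ker_def by (meson greaterThanAtMost_iff le_less_trans)

lemma past_ker_0: "past_ker u (\<lambda>_. 0)"
  unfolding past_ker_def by (intro exI[of _ 0]) (auto simp: zero_prod_def)

lemma past_ker_add: "past_ker u \<kappa> \<Longrightarrow> past_ker u \<kappa>' \<Longrightarrow> past_ker u (\<lambda>x. \<kappa> x + \<kappa>' x)"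
  unfolding past_ker_def
proof (elim exE)
  fix c c' assume "\<forall>x\<in>{u<..T}. \<kappa> x = (c, c * \<sigma> x)" "\<forall>x\<in>{u<..T}. \<kappa>' x = (c', c' * \<sigma> x)"
  then show "\<exists>c. \<forall>x\<in>{u<..T}. \<kappa> x + \<kappa>' x = (c, c * \<sigma> x)"
    by (intro exI[of _ "c + c'"]) (auto simp: algebra_simps)
qed

lemma past_ker_scale: "past_ker u \<kappa> \<Longrightarrow> past_ker u (\<lambda>x. a *\<^sub>R \<kappa> x)"
  unfolding past_ker_def
proof (elim exE)
  fix c assume "\<forall>x\<in>{u<..T}. \<kappa> x = (c, c * \<sigma> x)"
  then show "\<exists>c. \<forall>x\<in>{u<..T}. a *\<^sub>R \<kappa> x = (c, c * \<sigma> x)"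
    by (intro exI[of _ "a * c"]) auto
qed

lemma past_ker_sum: "(\<And>k. k \<in> K \<Longrightarrow> past_ker u (\<kappa> k)) \<Longrightarrow> past_ker u (\<lambda>x. \<Sum>k\<in>K. \<kappa> k x)"
  by (induction K rule: infinite_finite_induct) (auto intro: past_ker_0 past_ker_add)

lemma past_ker_B: "r \<le> u \<Longrightarrow> past_ker u (\<lambda>x. (indicator {0<..r} x, 0))"
  unfolding past_ker_def by (intro exI[of _ 0]) auto

lemma past_ker_V: "0 \<le> r \<Longrightarrow> r \<le> u \<Longrightarrow> past_ker u (V_ker r)"
  unfolding past_ker_def V_ker_def by (intro exI[of _ 1]) auto

text \<open>Beyond \<open>u + d\<close> only the multiple of \<open>gap_ker u\<close> remains, which
  has the required shape. A completed step thus counts as known information, and later steps are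
  orthogonal to it.\<close>

lemma past_ker_euler: "0 \<le> d \<Longrightarrow> past_ker (u + d) (euler_ker u d)"
  unfolding past_ker_def euler_ker_def gap_ker_def
  by (intro exI[of _ "- (d / gap_var u)"]) auto

text \<open>On (u, T] a past kernel is c times \<open>gap_ker u\<close>. Its products with the two
  parts of the Euler kernel are \<open>c * d\<close> and
  \<open>(d / gap_var u) * c * gap_var u\<close>, and they cancel. For t \<ge> u the kernel of
  \<open>V t\<close> lacks the \<sigma> part on (u, t], so the cancellation is incomplete by the
  stated amount. The squared norm is that of the residual: \<open>d\<close> minus the explained
  variance.\<close>

lemma euler_ker_integrals:
  assumes u: "0 \<le> u" "0 < d" "u + d \<le> T"
  shows "past_ker u \<kappa> \<Longrightarrow> ker_inner \<kappa> (euler_ker u d) = 0"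
    and "u \<le> t \<Longrightarrow> t \<le> T \<Longrightarrow> ker_inner (V_ker t) (euler_ker u d) = d * ((tail_var u - tail_var t) / gap_var u)"
    and "ker_norm2 (euler_ker u d) = d - d\<^sup>2 / gap_var u"
proof -
  have gp: "0 < gap_var u" using u by (intro gap_var_pos) auto
  have i1: "integrable lborel (indicator {u<..u + d} :: real \<Rightarrow> real)" "integrable lborel (indicator {u<..T} :: real \<Rightarrow> real)"
    using u by (auto intro!: integrable_real_indicator)
  have l1: "(LINT x|lborel. indicator {u<..u + d} x) = d" "(LINT x|lborel. indicator {u<..T} x) = T - u"
    using u by auto
  have i2: "integrable lborel (\<lambda>x. indicator {v<..T} x * (\<sigma> x)\<^sup>2)" "(LINT x|lborel. indicator {v<..T} x * (\<sigma> x)\<^sup>2) = tail_var v"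
    if "u \<le> v" "v \<le> T" for v
    using tail_integral[of v] that u by auto
  define \<gamma> where "\<gamma> = d / gap_var u"
  \<comment> \<open>Each of the three integrands below is a combination of these three functions,
    with v equal to u or t.\<close>
  have ii: "(LINT x|lborel. a * indicator {u<..u + d} x + b * indicator {u<..T} x + c * (indicator {v<..T} x * (\<sigma> x)\<^sup>2))
     = a * d + b * (T - u) + c * tail_var v" if "u \<le> v" "v \<le> T" for a b c v
    using i1 i2[OF that] l1 by simp
  show "ker_inner \<kappa> (euler_ker u d) = 0" if past: "past_ker u \<kappa>"
  proof -
    obtain c where c: "\<And>x. x \<in> {u<..T} \<Longrightarrow> \<kappa> x = (c, c * \<sigma> x)"
      using past unfolding past_ker_def by blast
    have "inner (\<kappa> x) (euler_ker u d x) = c * indicator {u<..u + d} x + (- c * \<gamma>) * indicator {u<..T} x + (- c * \<gamma>) * (indicator {u<..T} x * (\<sigma> x)\<^sup>2)" for x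
    proof (cases "x \<in> {u<..T}")
      case True
      then show ?thesis
        by (simp add: c[OF True] euler_ker_def gap_ker_def \<gamma>_def[symmetric] algebra_simps power2_eq_square)
    next
      case False
      then have "x \<notin> {u<..u + d}" using u by auto
      with False show ?thesis by (simp add: euler_ker_def gap_ker_def zero_prod_def[symmetric])
    qed
    then have "ker_inner \<kappa> (euler_ker u d) = c * d - c * \<gamma> * (T - u) - c * \<gamma> * tail_var u"
      unfolding ker_inner_def using ii[of u c "- c * \<gamma>" "- c * \<gamma>"] u by simp
    also have "\<dots> = c * (d - \<gamma> * gap_var u)" by (simp add: gap_var_def algebra_simps)
    also have "\<dots> = 0" using gp by (simp add: \<gamma>_def)
    finally show ?thesis .
  qed
  show "ker_inner (V_ker t) (euler_ker u d) = d * ((tail_var u - tail_var t) / gap_var u)" if t: "u \<le> t" "t \<le> T"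
  proof -
    have "inner (V_ker t x) (euler_ker u d x) = 1 * indicator {u<..u + d} x + (- \<gamma>) * indicator {u<..T} x + (- \<gamma>) * (indicator {t<..T} x * (\<sigma> x)\<^sup>2)" for x
    proof (cases "x \<in> {u<..T}")
      case True
      then show ?thesis using u
        by (simp add: V_ker_def euler_ker_def gap_ker_def \<gamma>_def[symmetric] algebra_simps power2_eq_square)
    next
      case False
      then have "x \<notin> {u<..u + d}" "x \<notin> {t<..T}" using u t by auto
      with False show ?thesis by (simp add: euler_ker_def gap_ker_def zero_prod_def[symmetric])
    qed
    then have "ker_inner (V_ker t) (euler_ker u d) = d - \<gamma> * (T - u) - \<gamma> * tail_var t"
      unfolding ker_inner_def using ii[OF t, of 1 "-\<gamma>" "-\<gamma>"] by simp
    also have "\<dots> = d * ((tail_var u - tail_var t) / gap_var u)"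
      using gp by (simp add: \<gamma>_def field_simps) (simp add: gap_var_def algebra_simps)
    finally show ?thesis .
  qed
  show "ker_norm2 (euler_ker u d) = d - d\<^sup>2 / gap_var u"
  proof -
    have np: "(norm (a, b))\<^sup>2 = a\<^sup>2 + b\<^sup>2" for a b :: real by (simp add: norm_Pair)
    have "(norm (euler_ker u d x))\<^sup>2 = (1 - 2 * \<gamma>) * indicator {u<..u + d} x + \<gamma>\<^sup>2 * indicator {u<..T} x + \<gamma>\<^sup>2 * (indicator {u<..T} x * (\<sigma> x)\<^sup>2)" for x
    proof (cases "x \<in> {u<..T}")
      case True
      then show ?thesis
        by (cases "x \<in> {u<..u + d}"; simp add: np euler_ker_def gap_ker_def \<gamma>_def[symmetric]; simp add: algebra_simps power2_eq_square)
    next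
      case False
      then have "x \<notin> {u<..u + d}" using u by auto
      with False show ?thesis by (simp add: euler_ker_def gap_ker_def zero_prod_def[symmetric])
    qed
    then have "ker_norm2 (euler_ker u d) = (1 - 2 * \<gamma>) * d + \<gamma>\<^sup>2 * (T - u) + \<gamma>\<^sup>2 * tail_var u"
      unfolding ker_norm2_def using ii[of u] u by simp
    also have "\<dots> = d - 2 * \<gamma> * d + \<gamma> * (\<gamma> * gap_var u)"
      by (simp add: gap_var_def algebra_simps power2_eq_square)
    also have "\<dots> = d - d\<^sup>2 / gap_var u"
      using gp by (simp add: \<gamma>_def field_simps power2_eq_square)
    finally show ?thesis .
  qed
qed

definition euler_sum :: "real \<Rightarrow> real \<Rightarrow> nat \<Rightarrow> 'a \<Rightarrow> real" where
  "euler_sum s d m \<omega> = (\<Sum>k<m. euler_step (s + real k * d) d \<omega>)"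

definition euler_sum_ker :: "real \<Rightarrow> real \<Rightarrow> nat \<Rightarrow> real \<Rightarrow> real \<times> real" where
  "euler_sum_ker s d m x = (\<Sum>k<m. euler_ker (s + real k * d) d x)"

lemma euler_sum_eq:
  "euler_sum s d m \<omega> = B (s + real m * d) \<omega> - B s \<omega> - (\<Sum>k<m. drift (s + real k * d) \<omega> * d)"
  by (induction m) (auto simp: euler_sum_def euler_step_def algebra_simps)

lemma grid_le:
  assumes "0 \<le> s" "0 < d" "s + real m * d \<le> T" "k < m"
  shows "0 \<le> s + real k * d" "s + real k * d + d \<le> T"
proof -
  have "real k + 1 \<le> real m" using assms(4) by simp
  then have "(real k + 1) * d \<le> m * d" using assms(2) by (intro mult_right_mono) auto
  then show "s + real k * d + d \<le> T" using assms by (simp add: algebra_simps)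
qed (use assms in auto)

lemma wiener_ker_euler_sum:
  assumes "0 \<le> s" "0 < d" "s + real m * d \<le> T"
  shows "wiener_ker (euler_sum s d m) (euler_sum_ker s d m)"
  unfolding euler_sum_def[abs_def] euler_sum_ker_def[abs_def]
  using assms grid_le[OF assms] by (intro wiener_ker_sum wiener_ker_euler) auto

text \<open>Pythagoras: the steps completed so far form a past kernel at the start of the next one,
  so products between different steps vanish and only those with \<kappa> remain.\<close>

lemma euler_sum_ker_norm2:
  assumes sd: "0 \<le> s" "0 < d" "s + real m * d \<le> T" and \<kappa>: "L2_kernel \<kappa>"
  shows "ker_norm2 (\<lambda>x. \<kappa> x + c *\<^sub>R euler_sum_ker s d m x) =
    ker_norm2 \<kappa> + 2 * c * (\<Sum>k<m. ker_inner \<kappa> (euler_ker (s + real k * d) d)) +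
    c\<^sup>2 * (\<Sum>k<m. d - d\<^sup>2 / gap_var (s + real k * d))"
proof -
  have L: "L2_kernel (euler_ker (s + real k * d) d)" if "k < m" for k
    using wiener_ker_L2[OF wiener_ker_euler] grid_le[OF sd that] sd by auto
  have "ker_norm2 (euler_sum_ker s d j) = (\<Sum>k<j. d - d\<^sup>2 / gap_var (s + real k * d))" if "j \<le> m" for j
    using that
  proof (induction j)
    case 0
    then show ?case by (simp add: euler_sum_ker_def[abs_def] ker_norm2_def)
  next
    case (Suc j)
    have j: "j < m" using Suc.prems by simp
    note g = grid_le[OF sd j]
    have past: "past_ker (s + j * d) (euler_sum_ker s d j)"
      unfolding euler_sum_ker_def[abs_def]
    proof (rule past_ker_sum)
      fix k assume "k \<in> {..<j}"
      then have "real k + 1 \<le> real j" by simp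
      then have "(real k + 1) * d \<le> j * d" using sd by (intro mult_right_mono) auto
      then show "past_ker (s + j * d) (euler_ker (s + real k * d) d)"
        using sd by (intro past_ker_mono[OF past_ker_euler]) (auto simp: algebra_simps)
    qed
    have "s + j * d \<le> T" using g sd by simp
    then have "L2_kernel (euler_sum_ker s d j)"
      using wiener_ker_L2[OF wiener_ker_euler_sum] sd by auto
    then have "ker_norm2 (\<lambda>x. euler_sum_ker s d j x + 1 *\<^sub>R euler_ker (s + j * d) d x) =
      ker_norm2 (euler_sum_ker s d j) + (d - d\<^sup>2 / gap_var (s + j * d))"
      using L2_kernel_add_scale(2)[OF _ L[OF j], of "euler_sum_ker s d j" 1]
        euler_ker_integrals(1,3)[of "s + j * d" d, OF g(1) sd(2) g(2)] past by simp
    then show ?case using Suc by (simp add: euler_sum_ker_def[abs_def])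
  qed
  moreover have "L2_kernel (euler_sum_ker s d m)"
    using wiener_ker_L2[OF wiener_ker_euler_sum[OF sd]] .
  moreover have "ker_inner \<kappa> (euler_sum_ker s d m) = (\<Sum>k<m. ker_inner \<kappa> (euler_ker (s + real k * d) d))"
    unfolding euler_sum_ker_def[abs_def] using \<kappa> L by (intro ker_inner_sum) auto
  ultimately show ?thesis using L2_kernel_add_scale(2)[OF \<kappa>] by simp
qed

lemma euler_sum_iexp:
  assumes sd: "0 \<le> s" "0 < d" "s + real m * d \<le> T" and Y: "wiener_ker Y \<kappa>"
  shows "(CLINT x|M. iexp (Y x + \<theta> * euler_sum s d m x)) = complex_of_real (exp (- (ker_norm2 \<kappa> +
    2 * \<theta> * (\<Sum>k<m. ker_inner \<kappa> (euler_ker (s + real k * d) d)) +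
    \<theta>\<^sup>2 * (\<Sum>k<m. d - d\<^sup>2 / gap_var (s + real k * d))) / 2))"
proof -
  have "wiener_ker (\<lambda>\<omega>. Y \<omega> + \<theta> * euler_sum s d m \<omega>) (\<lambda>x. \<kappa> x + \<theta> *\<^sub>R euler_sum_ker s d m x)"
    using sd Y by (intro wiener_ker_add wiener_ker_scale wiener_ker_euler_sum)
  from wiener_ker_iexp[OF this] show ?thesis
    unfolding ker_norm2_def[symmetric] euler_sum_ker_norm2[OF sd wiener_ker_L2[OF Y]] .
qed

end

section \<open>The cumulative drift\<close>

context independent_brownian_motions
begin

lemma wiener_ker_distributed:
  assumes X: "wiener_ker X \<kappa>" and pos: "0 < ker_norm2 \<kappa>"
  shows "distributed M lborel X (normal_density 0 (sqrt (ker_norm2 \<kappa>)))"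
proof (rule distributed_normal_of_iexp[OF pos wiener_ker_measurable[OF X]])
  fix \<theta>
  show "(CLINT x|M. iexp (\<theta> * X x)) = complex_of_real (exp (- \<theta>\<^sup>2 * ker_norm2 \<kappa> / 2))"
    using wiener_ker_iexp[OF wiener_ker_scale[OF X, of \<theta>]]
    by (simp add: ker_norm2_def power_mult_distrib)
qed

end

context brownian_enlargement
begin

lemma ker_norm2_gap:
  assumes u: "u \<in> {0..T}"
  shows "ker_norm2 (gap_ker u) = gap_var u"
proof -
  have "(norm (gap_ker u x))\<^sup>2 = indicator {u<..T} x + indicator {u<..T} x * (\<sigma> x)\<^sup>2" for x
    by (simp add: gap_ker_def norm_Pair indicator_def)
  then show ?thesis
    using tail_integral[OF u] u by (simp add: ker_norm2_def gap_var_def)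
qed

lemma drift_moment:
  assumes u: "u \<in> {0..<T}"
  shows "integrable M (drift u)" "(\<integral>\<omega>. \<bar>drift u \<omega>\<bar> \<partial>M) \<le> 1 / sqrt (T - u)"
proof -
  have g: "0 < gap_var u" "T - u \<le> gap_var u" using gap_var_pos gap_var_ge u by auto
  have "distributed M lborel (\<lambda>\<omega>. V u \<omega> - B u \<omega>) (normal_density 0 (sqrt (gap_var u)))"
    using wiener_ker_distributed[OF wiener_ker_gap[of u]] g u by (simp add: ker_norm2_gap)
  note m = centred_normal_moments[OF g(1) this]
  show "integrable M (drift u)" unfolding drift_def[abs_def] using m(1) by simp
  have "(\<integral>\<omega>. \<bar>drift u \<omega>\<bar> \<partial>M) = (\<integral>\<omega>. \<bar>V u \<omega> - B u \<omega>\<bar> \<partial>M) / gap_var u"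
    unfolding drift_def using g by simp
  also have "\<dots> \<le> sqrt (gap_var u) / gap_var u" using m(5) g by (intro divide_right_mono) auto
  also have "\<dots> = 1 / sqrt (gap_var u)" using g by (simp add: real_div_sqrt field_simps)
  also have "\<dots> \<le> 1 / sqrt (T - u)" using g u by (intro divide_left_mono) (auto intro!: mult_pos_pos)
  finally show "(\<integral>\<omega>. \<bar>drift u \<omega>\<bar> \<partial>M) \<le> 1 / sqrt (T - u)" .
qed

lemma tail_var_HK: "t \<in> {0..T} \<Longrightarrow> tail_var t = integral {t..T} (\<lambda>s. (\<sigma> s)\<^sup>2)"
  unfolding tail_var_def by (rule set_borel_integral_eq_integral(2)[OF \<sigma>_square_on])

lemma continuous_tail_var: "continuous_on {0..T} tail_var"
proof -
  have "continuous_on {0..T} (\<lambda>t. integral {t..T} (\<lambda>s. (\<sigma> s)\<^sup>2))"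
    by (rule indefinite_integral_continuous_1'[OF set_borel_integral_eq_integral(1)[OF \<sigma>_square]])
  then show ?thesis by (rule continuous_on_eq) (simp add: tail_var_HK)
qed

lemma continuous_drift:
  assumes "\<omega> \<in> space M" "continuous_on {0..T} (\<lambda>t. B t \<omega>)" "continuous_on {0..T} (\<lambda>t. S t \<omega>)"
  shows "continuous_on {0..<T} (\<lambda>t. drift t \<omega>)"
proof -
  have "continuous_on {0..<T} (\<lambda>t. (B T \<omega> + S t \<omega> - B t \<omega>) / (T + tail_var t - t))"
  proof (intro continuous_intros continuous_on_subset[OF assms(2)] continuous_on_subset[OF assms(3)]
      continuous_on_subset[OF continuous_tail_var])
    show "\<forall>t\<in>{0..<T}. T + tail_var t - t \<noteq> 0" using gap_var_pos unfolding gap_var_def by force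
  qed auto
  then show ?thesis
    by (rule continuous_on_eq) (use V assms(1) in \<open>simp add: drift_def gap_var_def\<close>)
qed

section \<open>Left-endpoint sums and integrability of the drift up to T\<close>

definition grid :: "nat \<Rightarrow> nat \<Rightarrow> real" where
  "grid n k = T * (real k / real (Suc n))"

lemma grid_props:
  "0 \<le> grid n k" "k \<le> n \<Longrightarrow> grid n k < T" "grid n 0 = 0" "grid n (Suc n) = T" "grid n k \<le> grid n (Suc k)"
  "grid n (Suc k) - grid n k = T / Suc n"
proof -
  show "grid n k < T" if "k \<le> n"
  proof -
    have "real k / real (Suc n) < 1" using that by simp
    then have "T * (real k / real (Suc n)) < T * 1" using T by (intro mult_strict_left_mono) auto
    then show ?thesis by (simp add: grid_def)
  qed
  show d: "grid n (Suc k) - grid n k = T / Suc n" by (simp add: grid_def add_divide_distrib distrib_left)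
  have "0 \<le> T / Suc n" using T by simp
  then show "grid n k \<le> grid n (Suc k)" using d by linarith
qed (use T in \<open>auto simp: grid_def\<close>)

text \<open>The grid divides [0, T] once and for all; only its cells are cut at t. Cells starting at
  or after t have length 0, so the sum at t depends on f at earlier grid times only. This is what
  makes it adapted at fixed t and predictable as a process in t.\<close>

definition grid_sum :: "(real \<Rightarrow> real) \<Rightarrow> nat \<Rightarrow> real \<Rightarrow> real" where
  "grid_sum f n t = (\<Sum>k<Suc n. f (grid n k) * (min t (grid n (Suc k)) - min t (grid n k)))"

text \<open>Brings the evaluation points into [0, t], as a Riemann sum over a partition of [0, t]
  requires. A point is moved only if its cell has length 0.\<close>

lemma grid_sum_alt:
  "grid_sum f n t = (\<Sum>k<Suc n. f (min t (grid n k)) * (min t (grid n (Suc k)) - min t (grid n k)))"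
  unfolding grid_sum_def
proof (rule sum.cong)
  fix k
  show "f (grid n k) * (min t (grid n (Suc k)) - min t (grid n k)) =
        f (min t (grid n k)) * (min t (grid n (Suc k)) - min t (grid n k))"
    using grid_props(5)[of n k] by (cases "grid n k \<le> t") (auto simp: min_def)
qed simp

lemma grid_sum_tendsto:
  assumes f: "continuous_on {0..t} f" and t: "t \<in> {0..T}"
  shows "(\<lambda>n. grid_sum f n t) \<longlonglongrightarrow> integral {0..t} f"
  unfolding grid_sum_alt
proof (rule riemann_sum_tendsto[where \<eta> = "\<lambda>n. T / Suc n"])
  show "partition_of 0 t (Suc n) (\<lambda>k. min t (grid n k))" for n
    unfolding partition_of_def using t grid_props(3-5) by (auto simp: min_def intro: order_trans)
  show "min t (grid n (Suc i)) - min t (grid n i) \<le> T / Suc n" for n i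
    using grid_props(5,6)[of n i] by (auto simp: min_def)
  show "(\<lambda>n. T / Suc n) \<longlonglongrightarrow> 0"
    using LIMSEQ_Suc[OF lim_const_over_n[of T]] by simp
qed (use f t in auto)

text \<open>The function 1 / sqrt (T - x) increases and has the antiderivative -2 sqrt (T - x), so
  its left-endpoint value times the cell length stays below the integral over the cell. The final
  point y = T is allowed.\<close>

lemma sqrt_telescope:
  assumes "0 \<le> x" "x \<le> y" "y \<le> T" "x < T"
  shows "1 / sqrt (T - x) * (y - x) \<le> 2 * sqrt (T - x) - 2 * sqrt (T - y)"
proof -
  have p: "0 < sqrt (T - x)" using assms by simp
  have "2 * sqrt (T - x) * sqrt (T - y) \<le> (T - x) + (T - y)"
    using sum_squares_bound[of "sqrt (T - x)" "sqrt (T - y)"] assms by simp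
  then have "y - x \<le> (2 * sqrt (T - x) - 2 * sqrt (T - y)) * sqrt (T - x)"
    using assms by (simp add: algebra_simps)
  then show ?thesis using p by (simp add: field_simps)
qed

text \<open>The first moments of the drift are compared cell by cell with (T - s)^(-1/2) and the
  bounds telescope. The result is the integral of that function over [0, T]; being uniform in n and
  t, it survives both limits taken later.\<close>

lemma expectation_grid_sum:
  assumes t: "t \<in> {0..<T}"
  shows "(\<integral>\<^sup>+\<omega>. ennreal (grid_sum (\<lambda>s. \<bar>drift s \<omega>\<bar>) n t) \<partial>M) \<le> ennreal (2 * sqrt T)"
proof -
  define \<Delta> where "\<Delta> k = min t (grid n (Suc k)) - min t (grid n k)" for k
  have \<Delta>0: "0 \<le> \<Delta> k" for k using grid_props(5)[of n k] by (auto simp: \<Delta>_def min_def)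
  have i: "integrable M (\<lambda>\<omega>. \<bar>drift (grid n k) \<omega>\<bar>)" if "k \<le> n" for k
    using drift_moment(1)[of "grid n k"] grid_props that by auto
  have "(\<integral>\<^sup>+\<omega>. ennreal (grid_sum (\<lambda>s. \<bar>drift s \<omega>\<bar>) n t) \<partial>M) = ennreal (\<integral>\<omega>. grid_sum (\<lambda>s. \<bar>drift s \<omega>\<bar>) n t \<partial>M)"
    unfolding grid_sum_def using i \<Delta>0 unfolding \<Delta>_def
    by (intro nn_integral_eq_integral Bochner_Integration.integrable_sum AE_I2 sum_nonneg) auto
  also have "(\<integral>\<omega>. grid_sum (\<lambda>s. \<bar>drift s \<omega>\<bar>) n t \<partial>M) = (\<Sum>k<Suc n. (\<integral>\<omega>. \<bar>drift (grid n k) \<omega>\<bar> \<partial>M) * \<Delta> k)"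
    unfolding grid_sum_def using i unfolding \<Delta>_def by (subst Bochner_Integration.integral_sum) auto
  also have "\<dots> \<le> (\<Sum>k<Suc n. 2 * sqrt (T - min t (grid n k)) - 2 * sqrt (T - min t (grid n (Suc k))))"
  proof (rule sum_mono)
    fix k assume "k \<in> {..<Suc n}"
    then have k: "grid n k < T" "0 \<le> grid n k" using grid_props by auto
    show "(\<integral>\<omega>. \<bar>drift (grid n k) \<omega>\<bar> \<partial>M) * \<Delta> k \<le> 2 * sqrt (T - min t (grid n k)) - 2 * sqrt (T - min t (grid n (Suc k)))"
    proof (cases "grid n k \<le> t")
      case True
      have "(\<integral>\<omega>. \<bar>drift (grid n k) \<omega>\<bar> \<partial>M) * \<Delta> k \<le> 1 / sqrt (T - grid n k) * \<Delta> k"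
        using k \<Delta>0 by (intro mult_right_mono drift_moment) auto
      also have "\<dots> \<le> 2 * sqrt (T - grid n k) - 2 * sqrt (T - min t (grid n (Suc k)))"
        unfolding \<Delta>_def using k t True grid_props(5)[of n k] sqrt_telescope[of "grid n k" "min t (grid n (Suc k))"]
        by (simp add: min_def split: if_splits)
      finally have "(\<integral>\<omega>. \<bar>drift (grid n k) \<omega>\<bar> \<partial>M) * \<Delta> k \<le> 2 * sqrt (T - grid n k) - 2 * sqrt (T - min t (grid n (Suc k)))" .
      moreover have "min t (grid n k) = grid n k" using True by simp
      ultimately show ?thesis by (simp only:)
    next
      case False
      then show ?thesis using grid_props(5)[of n k] by (simp add: \<Delta>_def min_def)
    qed
  qed
  also have "\<dots> = 2 * sqrt (T - min t (grid n 0)) - 2 * sqrt (T - min t (grid n (Suc n)))"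
    using sum_lessThan_telescope'[of "\<lambda>k. 2 * sqrt (T - min t (grid n k))" "Suc n"] by simp
  also have "\<dots> \<le> 2 * sqrt T" using t grid_props(3,4)[of n] by (simp add: min_def)
  finally show ?thesis by (simp add: ennreal_leI)
qed

text \<open>Times strictly before T that exhaust the horizon; the shift by 2 starts them at T / 2.
  They serve for integrability up to T and for the endpoint value of
  \<open>cum_drift\<close>.\<close>

definition approach :: "nat \<Rightarrow> real" where
  "approach m = T - T / real (m + 2)"

lemma approach_props:
  "approach m \<in> {0..<T}" "approach \<longlonglongrightarrow> T" "mono approach"
proof -
  have "T / real (m + 2) \<le> T" for m using T by (simp add: field_simps)
  then show "approach m \<in> {0..<T}" using T by (simp add: approach_def)
  have "(\<lambda>m. T - T / real (m + 2)) \<longlonglongrightarrow> T - 0"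
    by (intro tendsto_diff tendsto_const LIMSEQ_ignore_initial_segment[OF lim_const_over_n])
  then show "approach \<longlonglongrightarrow> T" by (simp add: approach_def[abs_def])
  show "mono approach"
    using T by (intro monoI) (auto simp: approach_def intro!: divide_left_mono)
qed

lemma drift_measurable: "t \<in> {0..T} \<Longrightarrow> drift t \<in> borel_measurable M"
  unfolding drift_def[abs_def] by (intro borel_measurable_divide borel_measurable_diff B_measurable V_measurable) auto

text \<open>Fatou takes the place of Fubini. On a continuous path the integral of the absolute drift
  up to \<open>approach m\<close> is the limit of grid sums with uniformly bounded expectations.
  Fatou over n and then over m makes the liminf almost surely finite; Fatou in the time variable,
  path by path, turns this into integrability.\<close>

lemma AE_drift_integrable: "AE \<omega> in M. set_integrable lborel {0..T} (\<lambda>s. drift s \<omega>)"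
proof -
  have gm: "(\<lambda>\<omega>. ennreal (grid_sum (\<lambda>s. \<bar>drift s \<omega>\<bar>) n t)) \<in> borel_measurable M" for n t
    unfolding grid_sum_def using grid_props(1,2)
    by (intro measurable_compose[OF _ measurable_ennreal] borel_measurable_sum borel_measurable_times
        borel_measurable_abs drift_measurable) (auto simp: less_Suc_eq_le intro: less_imp_le)
  define J where "J m \<omega> = liminf (\<lambda>n. ennreal (grid_sum (\<lambda>s. \<bar>drift s \<omega>\<bar>) n (approach m)))" for m \<omega>
  have Jm: "J m \<in> borel_measurable M" for m
    unfolding J_def using gm by (intro borel_measurable_liminf)
  have "(\<integral>\<^sup>+\<omega>. J m \<omega> \<partial>M) \<le> liminf (\<lambda>n. \<integral>\<^sup>+\<omega>. ennreal (grid_sum (\<lambda>s. \<bar>drift s \<omega>\<bar>) n (approach m)) \<partial>M)" for m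
    unfolding J_def using gm by (intro nn_integral_liminf)
  also have "\<dots> m \<le> liminf (\<lambda>n::nat. ennreal (2 * sqrt T))" for m
    using approach_props by (intro Liminf_mono always_eventually allI expectation_grid_sum)
  finally have J1: "(\<integral>\<^sup>+\<omega>. J m \<omega> \<partial>M) \<le> ennreal (2 * sqrt T)" for m by (simp add: Liminf_const)
  have "(\<integral>\<^sup>+\<omega>. liminf (\<lambda>m. J m \<omega>) \<partial>M) \<le> liminf (\<lambda>m. \<integral>\<^sup>+\<omega>. J m \<omega> \<partial>M)"
    using Jm by (intro nn_integral_liminf)
  also have "\<dots> \<le> liminf (\<lambda>m::nat. ennreal (2 * sqrt T))"
    using J1 by (intro Liminf_mono always_eventually allI)
  also have "\<dots> < \<infinity>" by (simp add: Liminf_const)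
  finally have "AE \<omega> in M. liminf (\<lambda>m. J m \<omega>) \<noteq> \<infinity>"
    using Jm by (intro nn_integral_PInf_AE borel_measurable_liminf) auto
  moreover have "AE \<omega> in M. continuous_on {0..T} (\<lambda>t. B t \<omega>)"
    using bmB by (simp add: brownian_motion_def)
  ultimately show ?thesis
    using S_cont AE_space
  proof eventually_elim
    case (elim \<omega>)
    define f where "f s = drift s \<omega>" for s
    have c: "continuous_on {0..<T} f" unfolding f_def using elim by (intro continuous_drift)
    have cm: "continuous_on {0..approach m} f" for m
      using approach_props(1)[of m] by (auto intro: continuous_on_subset[OF c])
    have Jeq: "J m \<omega> = ennreal (integral {0..approach m} (\<lambda>s. \<bar>f s\<bar>))" for m
    proof -
      have "(\<lambda>n. grid_sum (\<lambda>s. \<bar>f s\<bar>) n (approach m)) \<longlonglongrightarrow> integral {0..approach m} (\<lambda>s. \<bar>f s\<bar>)"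
        using approach_props(1)[of m] cm by (intro grid_sum_tendsto continuous_intros) auto
      then have "(\<lambda>n. ennreal (grid_sum (\<lambda>s. \<bar>f s\<bar>) n (approach m))) \<longlonglongrightarrow> ennreal (integral {0..approach m} (\<lambda>s. \<bar>f s\<bar>))"
        by (intro tendsto_ennrealI)
      then show ?thesis unfolding J_def f_def by (intro lim_imp_Liminf) auto
    qed
    have Jnn: "J m \<omega> = (\<integral>\<^sup>+s. ennreal (indicator {0..approach m} s * \<bar>f s\<bar>) \<partial>lborel)" for m
    proof -
      have i: "set_integrable lborel {0..approach m} (\<lambda>s. \<bar>f s\<bar>)"
        using cm by (intro borel_integrable_atLeastAtMost' continuous_intros)
      show ?thesis
        unfolding Jeq set_borel_integral_eq_integral(2)[OF i, symmetric] set_lebesgue_integral_def real_scaleR_def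
        using i unfolding set_integrable_def by (intro nn_integral_eq_integral[symmetric]) auto
    qed
    have fm: "(\<lambda>s. indicator {0..<T} s * f s) \<in> borel_measurable borel"
      using borel_measurable_continuous_on_indicator[OF _ c] by simp
    have am: "(\<lambda>s. ennreal (indicator {0..approach m} s * \<bar>f s\<bar>)) \<in> borel_measurable lborel" for m
    proof -
      have "(\<lambda>s. ennreal (indicator {0..approach m} s * \<bar>indicator {0..<T} s * f s\<bar>)) \<in> borel_measurable lborel"
        using fm by simp
      moreover have "indicator {0..approach m} s * \<bar>indicator {0..<T} s * f s\<bar> = indicator {0..approach m} s * \<bar>f s\<bar>" for s
        using approach_props(1)[of m] by (auto simp: indicator_def)
      ultimately show ?thesis by simp
    qed
    have conv: "(\<lambda>m. ennreal (indicator {0..approach m} s * \<bar>f s\<bar>)) \<longlonglongrightarrow> ennreal (indicator {0..<T} s * \<bar>f s\<bar>)" for s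
    proof (cases "s \<in> {0..<T}")
      case True
      then have "\<forall>\<^sub>F m in sequentially. s < approach m" using approach_props(2) by (intro order_tendstoD) auto
      then have "\<forall>\<^sub>F m in sequentially. ennreal (indicator {0..approach m} s * \<bar>f s\<bar>) = ennreal (indicator {0..<T} s * \<bar>f s\<bar>)"
        by eventually_elim (use True in auto)
      then show ?thesis by (rule tendsto_eventually)
    next
      case False
      then have "s \<notin> {0..approach m}" for m using approach_props(1)[of m] by auto
      then show ?thesis using False by simp
    qed
    have "(\<integral>\<^sup>+s. ennreal (indicator {0..<T} s * \<bar>f s\<bar>) \<partial>lborel) =
       (\<integral>\<^sup>+s. liminf (\<lambda>m. ennreal (indicator {0..approach m} s * \<bar>f s\<bar>)) \<partial>lborel)"
      using conv by (intro nn_integral_cong lim_imp_Liminf[symmetric]) auto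
    also have "\<dots> \<le> liminf (\<lambda>m. J m \<omega>)"
      unfolding Jnn using am by (intro nn_integral_liminf)
    finally have "(\<integral>\<^sup>+s. ennreal (indicator {0..<T} s * \<bar>f s\<bar>) \<partial>lborel) < \<infinity>"
      using elim(1) by (auto simp: top.not_eq_extremum intro: le_less_trans)
    then have "integrable lborel (\<lambda>s. indicator {0..<T} s * f s)"
      using fm by (intro integrableI_bounded) (auto simp: abs_mult)
    \<comment> \<open>Passing from [0, T) to [0, T] adds a single null point.\<close>
    moreover have "AE s in lborel. indicator {0..<T} s * f s = indicator {0..T} s * f s"
      using AE_lborel_singleton[of T] by eventually_elim (auto simp: indicator_def)
    moreover have "(\<lambda>s. indicator {0..T} s * f s) \<in> borel_measurable lborel"
    proof -
      have "(\<lambda>s. indicator {0..<T} s * f s + indicator {T} s * f T) \<in> borel_measurable lborel"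
        using fm by simp
      moreover have "indicator {0..<T} s * f s + indicator {T} s * f T = indicator {0..T} s * f s" for s
        using T by (auto simp: indicator_def)
      ultimately show ?thesis by simp
    qed
    ultimately have "integrable lborel (\<lambda>s. indicator {0..T} s * f s)"
      by (subst integrable_cong_AE[symmetric]) auto
    then show ?case by (simp add: set_integrable_def f_def)
  qed
qed

definition good_path :: "'a \<Rightarrow> bool" where
  "good_path \<omega> \<longleftrightarrow> \<omega> \<in> space M \<and> continuous_on {0..T} (\<lambda>t. B t \<omega>) \<and> continuous_on {0..T} (\<lambda>t. S t \<omega>) \<and>
     B 0 \<omega> = 0 \<and> set_integrable lborel {0..T} (\<lambda>s. drift s \<omega>)"

lemma AE_good_path: "AE \<omega> in M. good_path \<omega>"
proof -
  have "AE \<omega> in M. continuous_on {0..T} (\<lambda>t. B t \<omega>)" "AE \<omega> in M. B 0 \<omega> = 0"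
    using bmB by (auto simp: brownian_motion_def)
  with AE_drift_integrable S_cont AE_space show ?thesis
    by eventually_elim (simp add: good_path_def)
qed

text \<open>A limit of sums rather than the path integral, so that it is measurable for the
  uncompleted filtration at every \<omega>, including paths where \<open>lim\<close> is only a
  default value; on good paths it is the integral. Near T the drift may be unbounded, so the sums
  are not taken directly at T: the endpoint value is the limit of the values at
  \<open>approach m\<close>.\<close>

definition cum_drift :: "real \<Rightarrow> 'a \<Rightarrow> real" where
  "cum_drift t \<omega> = (if t < T then lim (\<lambda>n. grid_sum (\<lambda>s. drift s \<omega>) n t)
     else lim (\<lambda>m. lim (\<lambda>n. grid_sum (\<lambda>s. drift s \<omega>) n (approach m))))"

lemma good_path_drift:
  assumes "good_path \<omega>"
  shows "continuous_on {0..<T} (\<lambda>s. drift s \<omega>)" "(\<lambda>s. drift s \<omega>) integrable_on {0..T}"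
    "continuous_on {0..T} (\<lambda>t. integral {0..t} (\<lambda>s. drift s \<omega>))"
    "t \<in> {0..T} \<Longrightarrow> set_integrable lborel {0..t} (\<lambda>s. drift s \<omega>)"
proof -
  show "continuous_on {0..<T} (\<lambda>s. drift s \<omega>)"
    using assms unfolding good_path_def by (intro continuous_drift) auto
  show i: "(\<lambda>s. drift s \<omega>) integrable_on {0..T}"
    using assms unfolding good_path_def by (intro set_borel_integral_eq_integral(1)) auto
  show "continuous_on {0..T} (\<lambda>t. integral {0..t} (\<lambda>s. drift s \<omega>))"
    by (rule indefinite_integral_continuous_1[OF i])
  show "set_integrable lborel {0..t} (\<lambda>s. drift s \<omega>)" if "t \<in> {0..T}"
    using assms that unfolding good_path_def by (auto intro: set_integrable_subset)
qed

lemma cum_drift_eq: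
  assumes g: "good_path \<omega>" and t: "t \<in> {0..T}"
  shows "cum_drift t \<omega> = integral {0..t} (\<lambda>s. drift s \<omega>)"
proof -
  note d = good_path_drift[OF g]
  have l: "lim (\<lambda>n. grid_sum (\<lambda>s. drift s \<omega>) n r) = integral {0..r} (\<lambda>s. drift s \<omega>)" if "r \<in> {0..<T}" for r
  proof (rule limI, rule grid_sum_tendsto)
    show "continuous_on {0..r} (\<lambda>s. drift s \<omega>)" using that by (intro continuous_on_subset[OF d(1)]) auto
  qed (use that in auto)
  show ?thesis
  proof (cases "t < T")
    case True
    then show ?thesis using t by (simp add: cum_drift_def l)
  next
    case False
    then have tT: "t = T" using t by simp
    have "(\<lambda>m. integral {0..approach m} (\<lambda>s. drift s \<omega>)) \<longlonglongrightarrow> integral {0..T} (\<lambda>s. drift s \<omega>)"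
    proof (rule continuous_on_tendsto_compose[OF d(3) approach_props(2)])
      show "\<forall>\<^sub>F m in sequentially. approach m \<in> {0..T}"
        using approach_props(1) by (intro always_eventually allI) (auto intro: less_imp_le)
    qed (use T in simp)
    then show ?thesis using approach_props(1) by (simp add: tT cum_drift_def l limI)
  qed
qed

definition innovation :: "real \<Rightarrow> 'a \<Rightarrow> real" where
  "innovation t \<omega> = B t \<omega> - cum_drift t \<omega>"

lemma innovation_continuous: "good_path \<omega> \<Longrightarrow> continuous_on {0..T} (\<lambda>t. innovation t \<omega>)"
proof -
  assume g: "good_path \<omega>"
  then have "continuous_on {0..T} (\<lambda>t. B t \<omega> - integral {0..t} (\<lambda>s. drift s \<omega>))"
    using good_path_drift(3)[OF g] by (intro continuous_intros) (auto simp: good_path_def)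
  then show ?thesis by (rule continuous_on_eq) (simp add: innovation_def cum_drift_eq[OF g])
qed

lemma innovation_0: "good_path \<omega> \<Longrightarrow> innovation 0 \<omega> = 0"
  using T by (simp add: innovation_def cum_drift_eq) (simp add: good_path_def)

text \<open>The increments of B telescope, and the rest is a Riemann sum of the drift over [s, t].
  Since t < T, the drift is continuous on that compact interval.\<close>

lemma euler_sum_tendsto:
  assumes g: "good_path \<omega>" and st: "0 \<le> s" "s < t" "t < T"
  shows "(\<lambda>m. euler_sum s ((t - s) / Suc m) (Suc m) \<omega>) \<longlonglongrightarrow> innovation t \<omega> - innovation s \<omega>"
proof -
  note d = good_path_drift[OF g]
  define \<delta> where "\<delta> m = (t - s) / Suc m" for m
  have \<delta>: "real (Suc m) * \<delta> m = t - s" for m by (simp add: \<delta>_def)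
  have "continuous_on {s..t} (\<lambda>s. drift s \<omega>)" using st by (intro continuous_on_subset[OF d(1)]) auto
  then have "(\<lambda>m. B t \<omega> - B s \<omega> - (\<Sum>k<Suc m. drift (s + real k * \<delta> m) \<omega> * \<delta> m)) \<longlonglongrightarrow>
      B t \<omega> - B s \<omega> - integral {s..t} (\<lambda>s. drift s \<omega>)"
    unfolding \<delta>_def using st by (intro tendsto_intros uniform_riemann_sum_tendsto) auto
  moreover have "euler_sum s (\<delta> m) (Suc m) \<omega> = B t \<omega> - B s \<omega> - (\<Sum>k<Suc m. drift (s + real k * \<delta> m) \<omega> * \<delta> m)" for m
    unfolding euler_sum_eq \<delta> by simp
  moreover have "integral {0..t} (\<lambda>s. drift s \<omega>) = integral {0..s} (\<lambda>s. drift s \<omega>) + integral {s..t} (\<lambda>s. drift s \<omega>)"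
    using st by (intro Henstock_Kurzweil_Integration.integral_combine[symmetric] integrable_on_subinterval[OF d(2)]) auto
  then have "innovation t \<omega> - innovation s \<omega> = B t \<omega> - B s \<omega> - integral {s..t} (\<lambda>s. drift s \<omega>)"
    using st by (simp add: innovation_def cum_drift_eq[OF g])
  ultimately show ?thesis by (simp only: \<delta>_def[symmetric])
qed

end

section \<open>The innovation process in the enlarged filtration\<close>

lemma right_cont_filtration_props:
  assumes F: "filtration_on M F"
  shows "space (right_cont_filtration F t) = space M"
    "t < u \<Longrightarrow> sets (right_cont_filtration F t) \<subseteq> sets (F u)"
    "sets (F t) \<subseteq> sets (right_cont_filtration F t)"
    "filtration_on M (right_cont_filtration F)"
proof -
  have sp: "space (F t) = space M" for t
    using F by (simp add: filtration_on_def subalgebra_def)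
  have FM: "sets (F t) \<subseteq> sets M" for t using F by (simp add: filtration_on_def subalgebra_def)
  have mono: "sets (F s) \<subseteq> sets (F t)" if "s \<le> t" for s t
    using F that by (simp add: filtration_on_def filtration_def)
  have Pow: "(\<Inter>u\<in>{t<..}. sets (F u)) \<subseteq> Pow (space (F t))" for t
  proof -
    have "t + 1 \<in> {t<..}" by simp
    then have "(\<Inter>u\<in>{t<..}. sets (F u)) \<subseteq> sets (F (t + 1))" by blast
    then show ?thesis using sets.space_closed[of "F (t + 1)"] sp by auto
  qed
  show spR: "space (right_cont_filtration F t) = space M" for t
    unfolding right_cont_filtration_def space_measure_of[OF Pow] by (rule sp)
  have se: "sets (right_cont_filtration F t) = sigma_sets (space M) (\<Inter>u\<in>{t<..}. sets (F u))" for t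
  proof -
    have "sets (sigma (space (F t)) (\<Inter>u\<in>{t<..}. sets (F u))) = sigma_sets (space (F t)) (\<Inter>u\<in>{t<..}. sets (F u))"
      by (rule sets_measure_of[OF Pow])
    then show ?thesis by (simp only: right_cont_filtration_def sp)
  qed
  have sub: "sets (right_cont_filtration F t) \<subseteq> sets (F u)" if "t < u" for t u
  proof -
    have "sigma_sets (space (F u)) (\<Inter>u\<in>{t<..}. sets (F u)) \<subseteq> sets (F u)"
      using that by (intro sets.sigma_sets_subset) auto
    then show ?thesis unfolding se sp .
  qed
  then show "t < u \<Longrightarrow> sets (right_cont_filtration F t) \<subseteq> sets (F u)" .
  show "sets (F t) \<subseteq> sets (right_cont_filtration F t)" for t
  proof
    fix A assume "A \<in> sets (F t)"
    moreover have "t \<le> u" if "u \<in> {t<..}" for u using that by simp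
    ultimately have "A \<in> (\<Inter>u\<in>{t<..}. sets (F u))" using mono by blast
    then show "A \<in> sets (right_cont_filtration F t)" unfolding se by (rule sigma_sets.Basic)
  qed
  have "sets (right_cont_filtration F s) \<subseteq> sets (right_cont_filtration F t)" if "s \<le> t" for s t
    unfolding se using that by (intro sigma_sets_mono' INF_superset_mono) auto
  moreover have "sets (right_cont_filtration F t) \<subseteq> sets M" for t
    using sub[of t "t + 1"] FM by auto
  ultimately show "filtration_on M (right_cont_filtration F)"
    unfolding filtration_on_def filtration_def subalgebra_def using spR by auto
qed

lemma
  assumes T: "0 < T" and sp: "\<And>t. space (F t) = \<Omega>"
  shows space_predictable_sigma: "space (predictable_sigma F T) = {0..<T} \<times> \<Omega>"
    and predictable_zero: "A \<in> sets (F 0) \<Longrightarrow> {0} \<times> A \<in> sets (predictable_sigma F T)"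
    and predictable_Ioc: "0 \<le> s \<Longrightarrow> s < t \<Longrightarrow> t < T \<Longrightarrow> A \<in> sets (F s) \<Longrightarrow> {s<..t} \<times> A \<in> sets (predictable_sigma F T)"
proof -
  let ?G = "{{0} \<times> A | A. A \<in> sets (F 0)} \<union>
      {{s<..t} \<times> A | s t A. 0 \<le> s \<and> s < t \<and> t < T \<and> A \<in> sets (F s)}"
  have A: "A \<subseteq> \<Omega>" if "A \<in> sets (F t)" for A t using sets.sets_into_space[OF that] sp by simp
  have Pow: "?G \<subseteq> Pow ({0..<T} \<times> space (F 0))"
  proof
    fix X assume "X \<in> ?G"
    then consider A where "X = {0} \<times> A" "A \<in> sets (F 0)"
      | s t A where "X = {s<..t} \<times> A" "0 \<le> s" "t < T" "A \<in> sets (F s)" by blast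
    then have "X \<subseteq> {0..<T} \<times> \<Omega>"
    proof cases
      case 1
      then show ?thesis using A T by auto
    next
      case 2
      then show ?thesis using A[OF 2(4)] by auto
    qed
    then show "X \<in> Pow ({0..<T} \<times> space (F 0))" using sp by simp
  qed
  show "space (predictable_sigma F T) = {0..<T} \<times> \<Omega>"
    using space_measure_of[OF Pow] by (simp add: predictable_sigma_def sp)
  have se: "sets (predictable_sigma F T) = sigma_sets ({0..<T} \<times> space (F 0)) ?G"
    unfolding predictable_sigma_def by (rule sets_measure_of[OF Pow])
  show "{0} \<times> A \<in> sets (predictable_sigma F T)" if "A \<in> sets (F 0)"
    unfolding se using that by (intro sigma_sets.Basic) blast
  show "{s<..t} \<times> A \<in> sets (predictable_sigma F T)" if "0 \<le> s" "s < t" "t < T" "A \<in> sets (F s)"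
    unfolding se using that by (intro sigma_sets.Basic) blast
qed

lemma measurable_predictable_fst:
  assumes T: "0 < T" and sp: "\<And>t. space (F t) = \<Omega>"
  shows "fst \<in> borel_measurable (predictable_sigma F T)"
  unfolding borel_measurable_iff_le
proof
  fix a :: real
  let ?P = "predictable_sigma F T"
  have top: "\<Omega> \<in> sets (F t)" for t using sets.top[of "F t"] sp by simp
  consider "a < 0" | "a = 0" | "0 < a" "a < T" | "T \<le> a" by linarith
  then show "{w \<in> space ?P. fst w \<le> a} \<in> sets ?P"
  proof cases
    case 1
    then have "{w \<in> space ?P. fst w \<le> a} = {}" by (auto simp: space_predictable_sigma[where F = F, OF T sp])
    then show ?thesis by (simp only: sets.empty_sets)
  next
    case 2
    then have "{w \<in> space ?P. fst w \<le> a} = {0} \<times> \<Omega>" using T by (auto simp: space_predictable_sigma[where F = F, OF T sp])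
    then show ?thesis by (simp only: predictable_zero[where F = F, OF T sp top])
  next
    case 3
    then have "{w \<in> space ?P. fst w \<le> a} = {0} \<times> \<Omega> \<union> {0<..a} \<times> \<Omega>" by (auto simp: space_predictable_sigma[where F = F, OF T sp])
    moreover have "{0<..a} \<times> \<Omega> \<in> sets ?P" using 3 by (intro predictable_Ioc[where F = F, OF T sp _ _ _ top]) auto
    ultimately show ?thesis by (simp only: sets.Un predictable_zero[where F = F, OF T sp top])
  next
    case 4
    then have "{w \<in> space ?P. fst w \<le> a} = space ?P" by (auto simp: space_predictable_sigma[where F = F, OF T sp])
    then show ?thesis by (simp only: sets.top)
  qed
qed

lemma measurable_predictable_left:
  assumes u: "0 \<le> u" "u < T" and sp: "\<And>t. space (F t) = \<Omega>" and f: "f \<in> borel_measurable (F u)"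
  shows "(\<lambda>(t, \<omega>). if u < t then f \<omega> else (0::real)) \<in> borel_measurable (predictable_sigma F T)"
proof -
  let ?P = "predictable_sigma F T"
  have T: "0 < T" using u by simp
  have Ioo: "{u<..<T} \<times> A \<in> sets ?P" if A: "A \<in> sets (F u)" for A
  proof -
    \<comment> \<open>Generating rectangles must end before T, so (u, T) is exhausted by the
      intervals (u, r n]. The shift by 2 gives u < r n already for n = 0.\<close>
    define r where "r n = T - (T - u) / real (n + 2)" for n
    have r: "u < r n" "r n < T" for n
    proof -
      have "(T - u) * 1 < (T - u) * real (n + 2)" using u by (intro mult_strict_left_mono) auto
      then have "(T - u) / real (n + 2) < T - u" by (simp add: divide_less_eq)
      then show "u < r n" by (simp add: r_def)
      show "r n < T" using u by (simp add: r_def)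
    qed
    have "(\<lambda>n. T - (T - u) / real (n + 2)) \<longlonglongrightarrow> T - 0"
      by (intro tendsto_diff tendsto_const LIMSEQ_ignore_initial_segment[OF lim_const_over_n])
    then have lim: "r \<longlonglongrightarrow> T" by (simp add: r_def[abs_def])
    have "{u<..<T} = (\<Union>n. {u<..r n})"
    proof (intro equalityI subsetI)
      fix x assume x: "x \<in> {u<..<T}"
      then have "\<forall>\<^sub>F n in sequentially. x < r n" using lim by (intro order_tendstoD) auto
      then obtain n where "x < r n" unfolding eventually_sequentially by auto
      then have "x \<in> {u<..r n}" using x by simp
      then show "x \<in> (\<Union>n. {u<..r n})" by blast
    next
      fix x assume "x \<in> (\<Union>n. {u<..r n})"
      then obtain n where "u < x" "x \<le> r n" by auto
      then show "x \<in> {u<..<T}" using r(2)[of n] by simp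
    qed
    then have "{u<..<T} \<times> A = (\<Union>n. {u<..r n} \<times> A)" by blast
    also have "\<dots> \<in> sets ?P"
    proof (rule sets.countable_UN, safe)
      show "{u<..r n} \<times> A \<in> sets ?P" for n
        by (rule predictable_Ioc[where F = F, OF T sp u(1) r A])
    qed
    finally show ?thesis .
  qed
  show ?thesis
  proof (rule measurableI)
    fix C :: "real set" assume C: "C \<in> sets borel"
    let ?g = "\<lambda>(t, \<omega>). if u < t then f \<omega> else (0::real)"
    have pre: "{u<..<T} \<times> (f -` D \<inter> \<Omega>) \<in> sets ?P" if "D \<in> sets borel" for D
      using Ioo[OF measurable_sets[OF f that]] sp by simp
    show "?g -` C \<inter> space ?P \<in> sets ?P"
    \<comment> \<open>The process is 0 up to time u, so that whole region lies in the preimage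
      exactly when C contains 0; then the complement is used.\<close>
    proof (cases "0 \<in> C")
      case True
      then have "?g -` C \<inter> space ?P = space ?P - {u<..<T} \<times> (f -` (- C) \<inter> \<Omega>)"
        using u by (auto simp: space_predictable_sigma[where F = F, OF T sp] split: if_splits)
      then show ?thesis using pre[of "- C"] C by auto
    next
      case False
      then have "?g -` C \<inter> space ?P = {u<..<T} \<times> (f -` C \<inter> \<Omega>)"
        using u by (auto simp: space_predictable_sigma[where F = F, OF T sp] split: if_splits)
      then show ?thesis using pre[OF C] by simp
    qed
  qed simp
qed

section \<open>Measurability of the drift and the innovation with respect to the
  observations\<close>

context brownian_enlargement
begin

definition obs :: "real \<Rightarrow> 'a measure" where
  "obs = natural_filtration M T (\<lambda>t \<omega>. (B t \<omega>, V t \<omega>))"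

lemma obs_pair_measurable: "t \<in> {0..T} \<Longrightarrow> (\<lambda>\<omega>. (B t \<omega>, V t \<omega>)) \<in> borel_measurable M"
  by (intro borel_measurable_Pair B_measurable V_measurable)

lemmas obs_props = natural_filtration_props[where T = T and X = "\<lambda>t \<omega>. (B t \<omega>, V t \<omega>)" and M = M,
  OF obs_pair_measurable, folded obs_def]

lemma obs_filtration: "filtration_on M obs" "space (obs t) = space M"
  "subalgebra M (obs t)" "s \<le> t \<Longrightarrow> subalgebra (obs t) (obs s)"
  using obs_props(1,3) by (auto simp: filtration_on_def subalgebra_def filtration_def)

abbreviation "enl \<equiv> right_cont_filtration obs"

lemmas enl_props = right_cont_filtration_props[OF obs_filtration(1)]

lemma obs_measurable:
  assumes "s \<in> {0..min t T}"
  shows "B s \<in> borel_measurable (obs t)" "V s \<in> borel_measurable (obs t)" "drift s \<in> borel_measurable (obs t)"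
proof -
  have p: "(\<lambda>\<omega>. (B s \<omega>, V s \<omega>)) \<in> borel_measurable (obs t)"
    using obs_props(4)[of s t] assms by simp
  have "(\<lambda>x::real \<times> real. fst x) \<in> borel_measurable borel" "(\<lambda>x::real \<times> real. snd x) \<in> borel_measurable borel"
    by (auto intro!: borel_measurable_continuous_onI continuous_intros)
  from measurable_compose[OF p this(1)] measurable_compose[OF p this(2)]
  show "B s \<in> borel_measurable (obs t)" "V s \<in> borel_measurable (obs t)" by simp_all
  then show "drift s \<in> borel_measurable (obs t)"
    unfolding drift_def[abs_def] by (intro borel_measurable_divide borel_measurable_diff) auto
qed

lemma grid_sum_obs_measurable:
  assumes t: "t \<in> {0..T}"
  shows "(\<lambda>\<omega>. grid_sum (\<lambda>s. drift s \<omega>) n t) \<in> borel_measurable (obs t)"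
  unfolding grid_sum_def
proof (rule borel_measurable_sum)
  fix k assume "k \<in> {..<Suc n}"
  then have k: "grid n k < T" "0 \<le> grid n k" using grid_props by auto
  show "(\<lambda>\<omega>. drift (grid n k) \<omega> * (min t (grid n (Suc k)) - min t (grid n k))) \<in> borel_measurable (obs t)"
  proof (cases "grid n k \<le> t")
    case True
    then show ?thesis using k by (intro borel_measurable_times obs_measurable(3)) auto
  next
    \<comment> \<open>The cell starts after t and has length 0, so the later drift value is
      multiplied by 0.\<close>
    case False
    then have "min t (grid n (Suc k)) - min t (grid n k) = 0" using grid_props(5)[of n k] by (simp add: min_def)
    then show ?thesis by (simp only: mult_zero_right) simp
  qed
qed

lemma cum_drift_measurable:
  assumes t: "t \<in> {0..T}"
  shows "cum_drift t \<in> borel_measurable (obs t)"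
proof (cases "t < T")
  case True
  then have "cum_drift t = (\<lambda>\<omega>. lim (\<lambda>n. grid_sum (\<lambda>s. drift s \<omega>) n t))"
    by (auto simp: cum_drift_def)
  then show ?thesis using grid_sum_obs_measurable[OF t] by (simp add: borel_measurable_lim_metric)
next
  case False
  then have tT: "t = T" using t by simp
  have "(\<lambda>\<omega>. grid_sum (\<lambda>s. drift s \<omega>) n (approach m)) \<in> borel_measurable (obs T)" for n m
    using approach_props(1)[of m]
    by (intro measurable_from_subalg[OF obs_filtration(4) grid_sum_obs_measurable]) auto
  then have "(\<lambda>\<omega>. lim (\<lambda>m. lim (\<lambda>n. grid_sum (\<lambda>s. drift s \<omega>) n (approach m)))) \<in> borel_measurable (obs T)"
    by (intro borel_measurable_lim_metric)
  moreover have "cum_drift T = (\<lambda>\<omega>. lim (\<lambda>m. lim (\<lambda>n. grid_sum (\<lambda>s. drift s \<omega>) n (approach m))))"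
    by (auto simp: cum_drift_def)
  ultimately show ?thesis unfolding tT by simp
qed

lemma innovation_obs_measurable: "t \<in> {0..T} \<Longrightarrow> innovation t \<in> borel_measurable (obs t)"
  unfolding innovation_def[abs_def] by (intro borel_measurable_diff cum_drift_measurable obs_measurable(1)) auto

lemma innovation_measurable: "t \<in> {0..T} \<Longrightarrow> innovation t \<in> borel_measurable M"
  by (rule measurable_from_subalg[OF obs_filtration(3) innovation_obs_measurable])

text \<open>Inserting \<open>if grid n k < t\<close> changes no summand, because the cell factor is
  0 otherwise, and it exhibits each summand as a predictable step process times a function of time.
  On the predictable space t < T holds, so only the first branch of \<open>cum_drift\<close>
  occurs.\<close>

lemma cum_drift_predictable:
  "(\<lambda>(t, \<omega>). cum_drift t \<omega>) \<in> borel_measurable (predictable_sigma enl T)"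
proof -
  let ?P = "predictable_sigma enl T"
  have drift_enl: "drift s \<in> borel_measurable (enl s)" if "s \<in> {0..T}" for s
  proof (rule measurable_from_subalg)
    show "subalgebra (enl s) (obs s)"
      unfolding subalgebra_def using enl_props(1,3) obs_filtration(2) by simp
    show "drift s \<in> borel_measurable (obs s)" using that by (intro obs_measurable) auto
  qed
  have "(\<lambda>w. (\<Sum>k<Suc n. (case w of (t, \<omega>) \<Rightarrow> if grid n k < t then drift (grid n k) \<omega> else 0) *
      (min (fst w) (grid n (Suc k)) - min (fst w) (grid n k)))) \<in> borel_measurable ?P" for n
    using grid_props(1,2)
    by (intro borel_measurable_sum borel_measurable_times borel_measurable_diff borel_measurable_min measurable_predictable_fst[where F = enl, OF T enl_props(1)] borel_measurable_const
        measurable_predictable_left[where F = enl, OF _ _ enl_props(1) drift_enl]) (auto simp: less_Suc_eq_le intro: less_imp_le)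
  moreover have "(\<Sum>k<Suc n. (case w of (t, \<omega>) \<Rightarrow> if grid n k < t then drift (grid n k) \<omega> else 0) *
      (min (fst w) (grid n (Suc k)) - min (fst w) (grid n k))) = (case w of (t, \<omega>) \<Rightarrow> grid_sum (\<lambda>s. drift s \<omega>) n t)" for n w
  proof -
    have "(if grid n k < t then d else 0) * (min t (grid n (Suc k)) - min t (grid n k)) =
       d * (min t (grid n (Suc k)) - min t (grid n k))" for t d k
      using grid_props(5)[of n k] by (cases "grid n k < t") (auto simp: min_def)
    then show ?thesis by (cases w) (simp only: grid_sum_def prod.case fst_conv)
  qed
  ultimately have "(\<lambda>(t, \<omega>). grid_sum (\<lambda>s. drift s \<omega>) n t) \<in> borel_measurable ?P" for n
    by simp
  then have "(\<lambda>w. lim (\<lambda>n. case w of (t, \<omega>) \<Rightarrow> grid_sum (\<lambda>s. drift s \<omega>) n t)) \<in> borel_measurable ?P"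
    by (intro borel_measurable_lim_metric)
  moreover have "(\<lambda>(t, \<omega>). cum_drift t \<omega>) \<in> borel_measurable ?P \<longleftrightarrow>
    (\<lambda>w. lim (\<lambda>n. case w of (t, \<omega>) \<Rightarrow> grid_sum (\<lambda>s. drift s \<omega>) n t)) \<in> borel_measurable ?P"
    by (intro measurable_cong) (auto simp: space_predictable_sigma[where F = enl, OF T enl_props(1)] cum_drift_def)
  ultimately show ?thesis by simp
qed

section \<open>Law of the innovation increments\<close>

text \<open>One limit is computed twice: by the explicit Gaussian exponents of the Euler sums and by
  their almost sure convergence under dominated convergence. The limit c of the cross terms is a
  parameter, because it is 0 for past observations but a nontrivial integral for V at a later
  time.\<close>

lemma innovation_iexp:
  assumes st: "0 \<le> s" "s < t" "t < T" and Y: "wiener_ker Y \<kappa>"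
    and c: "(\<lambda>m. \<Sum>k<Suc m. ker_inner \<kappa> (euler_ker (s + real k * ((t - s) / Suc m)) ((t - s) / Suc m))) \<longlonglongrightarrow> c"
  shows "(CLINT x|M. iexp (Y x + \<theta> * (innovation t x - innovation s x))) =
    complex_of_real (exp (- (ker_norm2 \<kappa> + 2 * \<theta> * c + \<theta>\<^sup>2 * (t - s)) / 2))"
proof -
  define \<delta> where "\<delta> m = (t - s) / Suc m" for m
  have \<delta>: "0 < \<delta> m" "s + real (Suc m) * \<delta> m = t" for m using st by (simp_all add: \<delta>_def)
  define q where "q m = (\<Sum>k<Suc m. \<delta> m - (\<delta> m)\<^sup>2 / gap_var (s + real k * \<delta> m))" for m
  have \<delta>0: "\<delta> \<longlonglongrightarrow> 0" unfolding \<delta>_def using LIMSEQ_Suc[OF lim_const_over_n[of "t - s"]] by simp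
  have Ym: "Y \<in> borel_measurable M" by (rule wiener_ker_measurable[OF Y])
  have im: "innovation t \<in> borel_measurable M" "innovation s \<in> borel_measurable M"
    using st by (auto intro!: innovation_measurable)
  have em: "euler_sum s (\<delta> m) (Suc m) \<in> borel_measurable M" for m
    using wiener_ker_measurable[OF wiener_ker_euler_sum[of s "\<delta> m" "Suc m"]] \<delta> st by simp
  have q: "q \<longlonglongrightarrow> t - s"
  proof -
    \<comment> \<open>All grid points are at most t, so \<open>gap_var\<close> is at least T - t
      there, and the corrections \<delta>^2 / D sum to at most \<delta> (t - s) / (T - t).\<close>
    have bound: "t - s - \<delta> m * ((t - s) / (T - t)) \<le> q m \<and> q m \<le> t - s" for m
    proof -
      have gp: "T - t \<le> gap_var (s + real k * \<delta> m)" if "k < Suc m" for k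
      proof -
        have "real k * \<delta> m \<le> real (Suc m) * \<delta> m" using that \<delta>(1)[of m] by (intro mult_right_mono) auto
        then have "s + real k * \<delta> m \<le> t" using \<delta>(2)[of m] by linarith
        then show ?thesis using gap_var_ge[of "s + real k * \<delta> m"] st \<delta>(1)[of m] by (auto simp: less_imp_le)
      qed
      have "(\<delta> m)\<^sup>2 / gap_var (s + real k * \<delta> m) \<le> (\<delta> m)\<^sup>2 / (T - t)"
        "0 \<le> (\<delta> m)\<^sup>2 / gap_var (s + real k * \<delta> m)" if "k < Suc m" for k
        using gp[OF that] st by (auto intro!: divide_left_mono divide_nonneg_nonneg mult_pos_pos)
      then have "(\<Sum>k<Suc m. \<delta> m - (\<delta> m)\<^sup>2 / (T - t)) \<le> q m" "q m \<le> (\<Sum>k<Suc m. \<delta> m)"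
        unfolding q_def by (intro sum_mono, force)+
      moreover have "(\<Sum>k<Suc m. \<delta> m) = t - s" using \<delta>(2)[of m] by simp
      moreover have "(\<Sum>k<Suc m. \<delta> m - (\<delta> m)\<^sup>2 / (T - t)) = t - s - \<delta> m * ((t - s) / (T - t))"
      proof -
        have "(\<Sum>k<Suc m. \<delta> m - (\<delta> m)\<^sup>2 / (T - t)) = real (Suc m) * \<delta> m - \<delta> m * ((real (Suc m) * \<delta> m) / (T - t))"
          by (simp add: power2_eq_square algebra_simps add_divide_distrib)
        also have "real (Suc m) * \<delta> m = t - s" using \<delta>(2)[of m] by simp
        finally show ?thesis .
      qed
      ultimately show ?thesis by simp
    qed
    have "(\<lambda>m. t - s - \<delta> m * ((t - s) / (T - t))) \<longlonglongrightarrow> t - s - 0 * ((t - s) / (T - t))"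
      using \<delta>0 by (intro tendsto_intros)
    then show ?thesis
      using bound by (intro tendsto_sandwich[of "\<lambda>m. t - s - \<delta> m * ((t - s) / (T - t))" q sequentially "\<lambda>_. t - s"]) (auto intro!: always_eventually)
  qed
  have cf: "(CLINT x|M. iexp (Y x + \<theta> * euler_sum s (\<delta> m) (Suc m) x)) = complex_of_real (exp (- (ker_norm2 \<kappa> +
    2 * \<theta> * (\<Sum>k<Suc m. ker_inner \<kappa> (euler_ker (s + real k * \<delta> m) (\<delta> m))) + \<theta>\<^sup>2 * q m) / 2))" for m
    unfolding q_def using \<delta> st by (intro euler_sum_iexp Y) auto
  have "(\<lambda>m. CLINT x|M. iexp (Y x + \<theta> * euler_sum s (\<delta> m) (Suc m) x)) \<longlonglongrightarrow>
     (CLINT x|M. iexp (Y x + \<theta> * (innovation t x - innovation s x)))"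
  proof (rule iexp_tendsto(2))
    show "AE x in M. (\<lambda>m. Y x + \<theta> * euler_sum s (\<delta> m) (Suc m) x) \<longlonglongrightarrow> Y x + \<theta> * (innovation t x - innovation s x)"
      using AE_good_path
    proof eventually_elim
      case (elim x)
      show ?case
        using euler_sum_tendsto[OF elim st, folded \<delta>_def] by (intro tendsto_intros)
    qed
  qed (use Ym im em in simp_all)
  moreover have "(\<lambda>m. complex_of_real (exp (- (ker_norm2 \<kappa> +
    2 * \<theta> * (\<Sum>k<Suc m. ker_inner \<kappa> (euler_ker (s + real k * \<delta> m) (\<delta> m))) + \<theta>\<^sup>2 * q m) / 2))) \<longlonglongrightarrow>
    complex_of_real (exp (- (ker_norm2 \<kappa> + 2 * \<theta> * c + \<theta>\<^sup>2 * (t - s)) / 2))"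
    using q c[folded \<delta>_def] by (intro tendsto_intros) auto
  ultimately show ?thesis unfolding cf by (rule LIMSEQ_unique)
qed

text \<open>A kernel that is past at s is past at every later grid point, so each cross term is
  exactly 0.\<close>

lemma innovation_iexp_past:
  assumes st: "0 \<le> s" "s < t" "t < T" and Y: "wiener_ker Y \<kappa>" and past: "past_ker s \<kappa>"
  shows "(CLINT x|M. iexp (\<theta> * (innovation t x - innovation s x) + Y x)) =
    complex_of_real (exp (- \<theta>\<^sup>2 * (t - s) / 2)) * (CLINT x|M. iexp (Y x))"
proof -
  have "ker_inner \<kappa> (euler_ker (s + real k * ((t - s) / Suc m)) ((t - s) / Suc m)) = 0" if "k < Suc m" for k m
  proof (rule euler_ker_integrals(1))
    have p: "0 < (t - s) / Suc m" using st by simp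
    have e: "s + real (Suc m) * ((t - s) / Suc m) = t" using st by simp
    note g = grid_le[OF st(1) p _ that]
    show "0 \<le> s + real k * ((t - s) / Suc m)" "s + real k * ((t - s) / Suc m) + (t - s) / Suc m \<le> T"
      using g e st by auto
    show "past_ker (s + real k * ((t - s) / Suc m)) \<kappa>"
      using mult_nonneg_nonneg[of "real k" "(t - s) / Suc m"] p by (intro past_ker_mono[OF past]) simp
  qed (use st in simp)
  then have "(\<lambda>m. \<Sum>k<Suc m. ker_inner \<kappa> (euler_ker (s + real k * ((t - s) / Suc m)) ((t - s) / Suc m))) \<longlonglongrightarrow> 0"
    by (simp del: sum.lessThan_Suc of_nat_Suc)
  from innovation_iexp[OF st Y this, of \<theta>]
  have "(CLINT x|M. iexp (Y x + \<theta> * (innovation t x - innovation s x))) =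
    complex_of_real (exp (- \<theta>\<^sup>2 * (t - s) / 2)) * complex_of_real (exp (- ker_norm2 \<kappa> / 2))"
    unfolding of_real_mult[symmetric] exp_add[symmetric] by (simp add: field_simps)
  then show ?thesis using wiener_ker_iexp[OF Y] by (simp add: ker_norm2_def add.commute)
qed

lemma innovation_iexp_obs:
  assumes st: "0 \<le> s" "s < t" "t < T" and A: "A \<in> sets (obs s)"
  shows "(CLINT x|M. indicator A x * iexp (\<theta> * (innovation t x - innovation s x))) =
    complex_of_real (exp (- \<theta>\<^sup>2 * (t - s) / 2) * prob A)"
proof -
  \<comment> \<open>The tag distinguishes B from V, which turns both processes into one family
    indexed by J.\<close>
  define Y where "Y j = (if fst j then B (snd j) else V (snd j))" for j :: "bool \<times> real"
  define \<kappa> where "\<kappa> j = (if fst j then (\<lambda>u. (indicator {0<..snd j} u, 0)) else V_ker (snd j))" for j :: "bool \<times> real"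
  define J where "J = (UNIV :: bool set) \<times> {0..s}"
  have K: "wiener_ker (Y j) (\<kappa> j)" "past_ker s (\<kappa> j)" if "j \<in> J" for j
    using that st unfolding Y_def \<kappa>_def J_def
    by (auto intro!: wiener_ker_B wiener_ker_V past_ker_B past_ker_V)
  have Ym: "Y j \<in> borel_measurable M" if "j \<in> J" for j using K(1)[OF that] by (rule wiener_ker_measurable)
  let ?G = "{Y j -` C \<inter> space M | j C. j \<in> J \<and> C \<in> sets borel}"
  show ?thesis
  proof (rule iexp_indicator_factor[OF _ Ym])
    show "(\<lambda>x. innovation t x - innovation s x) \<in> borel_measurable M"
      using st by (intro borel_measurable_diff innovation_measurable) auto
    show "0 \<le> t - s" using st by simp
    show "(CLINT x|M. iexp (\<theta> * (innovation t x - innovation s x) + (\<Sum>j\<in>Q. l j * Y j x))) =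
       complex_of_real (exp (- \<theta>\<^sup>2 * (t - s) / 2)) * (CLINT x|M. iexp (\<Sum>j\<in>Q. l j * Y j x))"
      if "finite Q" "Q \<subseteq> J" for \<theta> Q l
    proof (rule innovation_iexp_past[OF st])
      show "wiener_ker (\<lambda>x. \<Sum>j\<in>Q. l j * Y j x) (\<lambda>u. \<Sum>j\<in>Q. l j *\<^sub>R \<kappa> j u)"
        using that(2) K(1) by (intro wiener_ker_sum wiener_ker_scale) auto
      show "past_ker s (\<lambda>u. \<Sum>j\<in>Q. l j *\<^sub>R \<kappa> j u)"
        using that(2) K(2) by (intro past_ker_sum past_ker_scale) auto
    qed
    have GP: "?G \<subseteq> Pow (space M)" by auto
    have gen: "Y j \<in> borel_measurable (sigma (space M) ?G)" if "j \<in> J" for j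
    proof (rule measurableI)
      fix C :: "real set" assume "C \<in> sets borel"
      then have "Y j -` C \<inter> space M \<in> ?G" using that by blast
      then show "Y j -` C \<inter> space (sigma (space M) ?G) \<in> sets (sigma (space M) ?G)"
        unfolding space_measure_of[OF GP] sets_measure_of[OF GP] ..
    qed simp
    \<comment> \<open>\<open>obs\<close> is generated by preimages of planar Borel sets under the
      pair. Joint measurability follows from that of the two coordinates, so the coordinate family
      generates at least as much.\<close>
    have "(\<lambda>\<omega>. (B r \<omega>, V r \<omega>)) \<in> borel_measurable (sigma (space M) ?G)" if "r \<in> {0..s}" for r
      using gen[of "(True, r)"] gen[of "(False, r)"] that by (intro borel_measurable_Pair) (auto simp: Y_def J_def)
    from measurable_sets[OF this]
    have "(\<lambda>\<omega>. (B r \<omega>, V r \<omega>)) -` C \<inter> space M \<in> sigma_sets (space M) ?G" if "r \<in> {0..s}" "C \<in> sets borel" for r C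
      using that unfolding space_measure_of[OF GP] sets_measure_of[OF GP] by auto
    then have "{(\<lambda>\<omega>. (B r \<omega>, V r \<omega>)) -` C \<inter> space M | r C. r \<in> {0..min s T} \<and> C \<in> sets borel}
        \<subseteq> sigma_sets (space M) ?G"
      using st by auto
    from sigma_sets_mono[OF this] have "sets (obs s) \<subseteq> sigma_sets (space M) ?G"
      using obs_props(2)[of s] by simp
    then show "A \<in> sigma_sets (space M) ?G" using A by auto
  qed
qed

text \<open>The interval is shrunk at both ends. On the left, \<open>enl s\<close> is contained in
  \<open>obs (s + e n)\<close>; on the right, \<open>t - e n\<close> stays below T, which admits t =
  T. Path continuity restores the endpoints.\<close>

lemma innovation_iexp_enl:
  assumes st: "0 \<le> s" "s < t" "t \<le> T" and A: "A \<in> sets (enl s)"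
  shows "(CLINT x|M. indicator A x * iexp (\<theta> * (innovation t x - innovation s x))) =
    complex_of_real (exp (- \<theta>\<^sup>2 * (t - s) / 2) * prob A)"
proof -
  \<comment> \<open>The shift by 3 gives 3 e \<le> t - s, so the shrunk interval is nondegenerate
    for every n.\<close>
  define e where "e n = (t - s) / real (n + 3)" for n
  have e0: "e \<longlonglongrightarrow> 0"
    unfolding e_def by (rule LIMSEQ_ignore_initial_segment[OF lim_const_over_n])
  have e: "0 < e n" "s + e n < t - e n" for n
  proof -
    show "0 < e n" using st by (simp add: e_def)
    have "3 * e n \<le> t - s" using st mult_right_mono[of s t "real n"] by (simp add: e_def field_simps)
    then show "s + e n < t - e n" using \<open>0 < e n\<close> by linarith
  qed
  have [measurable]: "A \<in> sets M"
    using A enl_props(4) by (auto simp: filtration_on_def subalgebra_def)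
  have im: "innovation r \<in> borel_measurable M" if "0 \<le> r" "r \<le> T" for r
    using that by (intro innovation_measurable) auto
  have eq: "(CLINT x|M. indicator A x * iexp (\<theta> * (innovation (t - e n) x - innovation (s + e n) x))) =
    complex_of_real (exp (- \<theta>\<^sup>2 * ((t - e n) - (s + e n)) / 2) * prob A)" for n
  proof (rule innovation_iexp_obs)
    show "A \<in> sets (obs (s + e n))" using A enl_props(2)[of s "s + e n"] e(1)[of n] by auto
  qed (use st e(1)[of n] e(2)[of n] in auto)
  have lim: "(\<lambda>n. t - e n) \<longlonglongrightarrow> t" "(\<lambda>n. s + e n) \<longlonglongrightarrow> s"
    using tendsto_diff[OF tendsto_const[of t] e0] tendsto_add[OF tendsto_const[of s] e0] by auto
  have "(\<lambda>n. CLINT x|M. indicator A x * iexp (\<theta> * (innovation (t - e n) x - innovation (s + e n) x))) \<longlonglongrightarrow>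
    (CLINT x|M. indicator A x * iexp (\<theta> * (innovation t x - innovation s x)))"
  proof (rule iexp_tendsto(1))
    show "AE x in M. (\<lambda>n. \<theta> * (innovation (t - e n) x - innovation (s + e n) x)) \<longlonglongrightarrow> \<theta> * (innovation t x - innovation s x)"
      using AE_good_path
    proof eventually_elim
      case (elim x)
      have mem: "t - e n \<in> {0..T}" "s + e n \<in> {0..T}" for n
        using st e(1)[of n] e(2)[of n] by auto
      have "(\<lambda>n. innovation (t - e n) x) \<longlonglongrightarrow> innovation t x" "(\<lambda>n. innovation (s + e n) x) \<longlonglongrightarrow> innovation s x"
        using st mem by (auto intro!: continuous_on_tendsto_compose[OF innovation_continuous[OF elim]] lim always_eventually)
      then show ?case by (intro tendsto_intros)
    qed
    show "(\<lambda>x. \<theta> * (innovation (t - e n) x - innovation (s + e n) x)) \<in> borel_measurable M" for n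
      using st e(1)[of n] e(2)[of n] im[of "t - e n"] im[of "s + e n"] by simp
  qed (use st im[of t] im[of s] in simp_all)
  moreover have "(\<lambda>n. complex_of_real (exp (- \<theta>\<^sup>2 * ((t - e n) - (s + e n)) / 2) * prob A)) \<longlonglongrightarrow>
    complex_of_real (exp (- \<theta>\<^sup>2 * (t - s) / 2) * prob A)"
    using lim by (intro tendsto_intros) auto
  ultimately show ?thesis unfolding eq by (rule LIMSEQ_unique)
qed

text \<open>The normal law is the case of the sure event. For independence, the indicator of A and
  the constant \<open>prob A\<close> are two weights under which the increment has the same
  transform, so they give the same integral to every event of the increment.\<close>

lemma innovation_increment:
  assumes st: "0 \<le> s" "s < t" "t \<le> T"
  shows "distributed M lborel (\<lambda>\<omega>. innovation t \<omega> - innovation s \<omega>) (normal_density 0 (sqrt (t - s)))"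
    "indep_set (sets (enl s))
       {(\<lambda>\<omega>. innovation t \<omega> - innovation s \<omega>) -` C \<inter> space M | C. C \<in> sets borel}"
proof -
  let ?Z = "\<lambda>\<omega>. innovation t \<omega> - innovation s \<omega>"
  have Zm: "?Z \<in> borel_measurable M" using st by (intro borel_measurable_diff innovation_measurable) auto
  have cf: "(CLINT x|M. iexp (\<theta> * ?Z x)) = complex_of_real (exp (- \<theta>\<^sup>2 * (t - s) / 2))" for \<theta>
  proof -
    have "space M \<in> sets (enl s)" using sets.top[of "enl s"] enl_props(1) by simp
    from innovation_iexp_enl[OF st this, of \<theta>]
    have "(CLINT x|M. indicator (space M) x * iexp (\<theta> * ?Z x)) = complex_of_real (exp (- \<theta>\<^sup>2 * (t - s) / 2))"
      by (simp add: prob_space)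
    moreover have "(CLINT x|M. indicator (space M) x * iexp (\<theta> * ?Z x)) = (CLINT x|M. iexp (\<theta> * ?Z x))"
      by (intro Bochner_Integration.integral_cong) auto
    ultimately show ?thesis by simp
  qed
  then show "distributed M lborel ?Z (normal_density 0 (sqrt (t - s)))"
    using st Zm by (intro distributed_normal_of_iexp) auto
  show "indep_set (sets (enl s)) {?Z -` C \<inter> space M | C. C \<in> sets borel}"
    unfolding indep_sets2_eq
  proof (intro conjI ballI)
    show sub: "sets (enl s) \<subseteq> events"
      using enl_props(4) by (auto simp: filtration_on_def subalgebra_def)
    show "{?Z -` C \<inter> space M | C. C \<in> sets borel} \<subseteq> events" using measurable_sets[OF Zm] by auto
    fix A b assume A: "A \<in> sets (enl s)" and "b \<in> {?Z -` C \<inter> space M | C. C \<in> sets borel}"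
    then obtain C where C: "C \<in> sets borel" "b = ?Z -` C \<inter> space M" by auto
    have AM: "A \<in> sets M" and bM: "b \<in> sets M" using A sub C measurable_sets[OF Zm C(1)] by auto
    have iA: "integrable M (indicator A :: _ \<Rightarrow> real)" using AM by (simp add: emeasure_eq_measure)
    have "(\<integral>x. indicator A x * indicator C (?Z x) \<partial>M) = (\<integral>x. prob A * indicator C (?Z x) \<partial>M)"
    proof (rule Levy_uniqueness_weighted[OF iA _ _ _ Zm C(1)])
      fix \<theta>
      have "(CLINT x|M. complex_of_real (indicator A x) * iexp (\<theta> * ?Z x)) = (CLINT x|M. indicator A x * iexp (\<theta> * ?Z x))"
        by (intro Bochner_Integration.integral_cong) (auto simp: indicator_def)
      also have "\<dots> = complex_of_real (exp (- \<theta>\<^sup>2 * (t - s) / 2) * prob A)"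
        by (rule innovation_iexp_enl[OF st A])
      also have "\<dots> = (CLINT x|M. complex_of_real (prob A) * iexp (\<theta> * ?Z x))"
        unfolding integral_mult_right_zero cf by simp
      finally show "(CLINT x|M. complex_of_real (indicator A x) * iexp (\<theta> * ?Z x)) = (CLINT x|M. complex_of_real (prob A) * iexp (\<theta> * ?Z x))" .
    qed auto
    moreover have "(\<integral>x. indicator A x * indicator C (?Z x) \<partial>M) = (\<integral>x. indicator (A \<inter> b) x \<partial>M :: real)"
      by (intro Bochner_Integration.integral_cong) (auto simp: C(2) indicator_def)
    moreover have "(\<integral>x. indicator C (?Z x) \<partial>M) = (\<integral>x. indicator b x \<partial>M :: real)"
      by (intro Bochner_Integration.integral_cong) (auto simp: C(2) indicator_def)
    ultimately show "prob (A \<inter> b) = prob A * prob b"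
      using AM bM by simp
  qed
qed

end

section \<open>Correlation of the innovation with V\<close>

context brownian_enlargement
begin

lemma tail_var_split:
  assumes "0 \<le> s" "s \<le> t" "t \<le> T"
  shows "tail_var s = (LINT u:{s..t}|lborel. (\<sigma> u)\<^sup>2) + tail_var t" "tail_var t \<le> tail_var s"
proof -
  have "integral {s..T} (\<lambda>u. (\<sigma> u)\<^sup>2) = integral {s..t} (\<lambda>u. (\<sigma> u)\<^sup>2) + integral {t..T} (\<lambda>u. (\<sigma> u)\<^sup>2)"
    using assms by (intro Henstock_Kurzweil_Integration.integral_combine[symmetric]
        set_borel_integral_eq_integral(1)[OF \<sigma>_square_on]) auto
  moreover have "set_integrable lborel {s..t} (\<lambda>u. (\<sigma> u)\<^sup>2)"
    using assms by (intro set_integrable_subset[OF \<sigma>_square]) auto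
  ultimately show eq: "tail_var s = (LINT u:{s..t}|lborel. (\<sigma> u)\<^sup>2) + tail_var t"
    using assms by (simp add: tail_var_HK set_borel_integral_eq_integral(2))
  have "0 \<le> (LINT u:{s..t}|lborel. (\<sigma> u)\<^sup>2)"
    unfolding set_lebesgue_integral_def by (intro Bochner_Integration.integral_nonneg) simp
  then show "tail_var t \<le> tail_var s" using eq by simp
qed

lemma tail_var_less:
  assumes t: "t \<in> {0..T}" and nz: "\<not> (AE s in lborel. s \<in> {0..t} \<longrightarrow> \<sigma> s = 0)"
  shows "tail_var t < tail_var 0"
proof (rule ccontr)
  assume "\<not> tail_var t < tail_var 0"
  then have "(LINT u:{0..t}|lborel. (\<sigma> u)\<^sup>2) = 0" using tail_var_split[of 0 t] t by auto
  moreover have "set_integrable lborel {0..t} (\<lambda>u. (\<sigma> u)\<^sup>2)"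
    using t by (intro set_integrable_subset[OF \<sigma>_square]) auto
  ultimately have "AE u in lborel. indicator {0..t} u * (\<sigma> u)\<^sup>2 = 0"
    unfolding set_lebesgue_integral_def set_integrable_def real_scaleR_def
    by (subst (asm) integral_nonneg_eq_0_iff_AE) auto
  then have "AE u in lborel. u \<in> {0..t} \<longrightarrow> \<sigma> u = 0" by eventually_elim (auto simp: indicator_def)
  with nz show False by simp
qed

lemma ker_norm2_V:
  assumes t: "t \<in> {0..T}"
  shows "ker_norm2 (V_ker t) = T + tail_var t"
proof -
  have "(norm (V_ker t x))\<^sup>2 = indicator {0<..T} x + indicator {t<..T} x * (\<sigma> x)\<^sup>2" for x
    by (simp add: V_ker_def norm_Pair indicator_def)
  then show ?thesis using tail_integral[OF t] T by (simp add: ker_norm2_def)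
qed

text \<open>For r \<le> t all grid points are at most t, so the cross terms with \<open>V t\<close>
  form a Riemann sum of the integrand; r < T keeps its denominator away from 0.\<close>

lemma innovation_V_iexp:
  assumes r: "0 < r" "r < T" "r \<le> t" "t \<le> T"
  shows "(CLINT x|M. iexp (l * V t x + \<theta> * (innovation r x - innovation 0 x))) =
    complex_of_real (exp (- (l\<^sup>2 * (T + tail_var t) +
      2 * \<theta> * l * integral {0..r} (\<lambda>u. (tail_var u - tail_var t) / gap_var u) + \<theta>\<^sup>2 * r) / 2))"
proof -
  define f where "f u = (tail_var u - tail_var t) / gap_var u" for u
  define \<delta> where "\<delta> m = (r - 0) / Suc m" for m
  have \<delta>: "0 < \<delta> m" "real (Suc m) * \<delta> m = r" for m using r by (simp_all add: \<delta>_def)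
  have fc: "continuous_on {0..r} f"
    unfolding f_def gap_var_def
  proof (intro continuous_intros continuous_on_subset[OF continuous_tail_var])
    show "\<forall>u\<in>{0..r}. T + tail_var u - u \<noteq> 0" using gap_var_pos r unfolding gap_var_def by force
  qed (use r in auto)
  have "(\<lambda>m. l * (\<Sum>k<Suc m. f (0 + real k * \<delta> m) * \<delta> m)) \<longlonglongrightarrow> l * integral {0..r} f"
    unfolding \<delta>_def using r by (intro tendsto_intros uniform_riemann_sum_tendsto fc) auto
  then have lim: "(\<lambda>m. l * (\<Sum>k<Suc m. f (real k * \<delta> m) * \<delta> m)) \<longlonglongrightarrow> l * integral {0..r} f"
    by (simp only: add_0)
  have ki: "ker_inner (\<lambda>u. l *\<^sub>R V_ker t u) \<kappa> = l * ker_inner (V_ker t) \<kappa>" for \<kappa>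
    unfolding ker_inner_def by simp
  have "ker_inner (\<lambda>u. l *\<^sub>R V_ker t u) (euler_ker (0 + real k * \<delta> m) (\<delta> m)) = l * (f (real k * \<delta> m) * \<delta> m)" if "k < Suc m" for k m
  proof -
    note g = grid_le[of 0 "\<delta> m" "Suc m" k]
    have le: "0 \<le> real k * \<delta> m" "real k * \<delta> m + \<delta> m \<le> T" using g that \<delta>[of m] r by auto
    have "real k * \<delta> m \<le> real (Suc m) * \<delta> m" using that \<delta>(1)[of m] by (intro mult_right_mono) auto
    then have "real k * \<delta> m \<le> t" using \<delta>(2)[of m] r by linarith
    then show ?thesis unfolding ki
      using euler_ker_integrals(2)[OF le(1) \<delta>(1) le(2)] r by (simp add: f_def)
  qed
  then have "(\<Sum>k<Suc m. ker_inner (\<lambda>u. l *\<^sub>R V_ker t u) (euler_ker (0 + real k * \<delta> m) (\<delta> m))) =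
     l * (\<Sum>k<Suc m. f (real k * \<delta> m) * \<delta> m)" for m
    unfolding sum_distrib_left by (intro sum.cong) auto
  with lim have "(\<lambda>m. \<Sum>k<Suc m. ker_inner (\<lambda>u. l *\<^sub>R V_ker t u) (euler_ker (0 + real k * \<delta> m) (\<delta> m))) \<longlonglongrightarrow> l * integral {0..r} f"
    by (simp only:)
  moreover have "wiener_ker (\<lambda>\<omega>. l * V t \<omega>) (\<lambda>u. l *\<^sub>R V_ker t u)"
    using r by (intro wiener_ker_scale wiener_ker_V) auto
  moreover have "ker_norm2 (\<lambda>u. l *\<^sub>R V_ker t u) = l\<^sup>2 * (T + tail_var t)"
    using ker_norm2_V[of t] r by (simp add: ker_norm2_def power_mult_distrib)
  ultimately show ?thesis
    using innovation_iexp[of 0 r "\<lambda>\<omega>. l * V t \<omega>" "\<lambda>u. l *\<^sub>R V_ker t u" "l * integral {0..r} f" \<theta>] r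
    unfolding \<delta>_def f_def by (simp add: mult.assoc)
qed

text \<open>For t = T the denominator vanishes at the end of the interval, so the covariance is
  obtained along times r n below t. The integrals increase and are bounded because the integrand
  lies in [0, 1]; their limit is positive because the integrand is positive at 0.\<close>

lemma innovation_V_joint_iexp:
  assumes t: "0 < t" "t \<le> T" and less: "tail_var t < tail_var 0"
  obtains c where "0 < c" "\<And>l \<theta>. (CLINT x|M. iexp (l * V t x + \<theta> * (innovation t x - innovation 0 x))) =
    complex_of_real (exp (- (l\<^sup>2 * (T + tail_var t) + 2 * \<theta> * l * c + \<theta>\<^sup>2 * t) / 2))"
proof -
  define f where "f u = (tail_var u - tail_var t) / gap_var u" for u
  define r where "r n = t - t / real (n + 2)" for n
  have r: "0 < r n" "r n < t" for n
  proof -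
    have "t / real (n + 2) < t" using t mult_strict_left_mono[of 1 "real (n + 2)" t] by (simp add: divide_less_eq)
    then show "0 < r n" by (simp add: r_def)
    show "r n < t" using t by (simp add: r_def)
  qed
  have rmono: "r m \<le> r n" if "m \<le> n" for m n
    using t that by (auto simp: r_def intro!: divide_left_mono)
  have "(\<lambda>n. t - t / real (n + 2)) \<longlonglongrightarrow> t - 0"
    by (intro tendsto_diff tendsto_const LIMSEQ_ignore_initial_segment[OF lim_const_over_n])
  then have rlim: "r \<longlonglongrightarrow> t" by (simp add: r_def[abs_def])
  have fc: "continuous_on {0..r n} f" for n
    unfolding f_def gap_var_def
  proof (intro continuous_intros continuous_on_subset[OF continuous_tail_var])
    show "\<forall>u\<in>{0..r n}. T + tail_var u - u \<noteq> 0" using gap_var_pos r[of n] t unfolding gap_var_def by force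
  qed (use r[of n] t in auto)
  have fb: "0 \<le> f u" "f u \<le> 1" if "u \<in> {0..r n}" for u n
  proof -
    have u: "0 \<le> u" "u < t" "u < T" using that r[of n] t by auto
    have g: "0 < gap_var u" using u by (intro gap_var_pos) auto
    show "0 \<le> f u" unfolding f_def using g u t tail_var_split(2)[of u t] by (intro divide_nonneg_nonneg) auto
    \<comment> \<open>After cancelling \<open>tail_var u\<close> this reads u \<le> T +
      \<open>tail_var t\<close>.\<close>
    have "tail_var u - tail_var t \<le> gap_var u" using tail_integral(3)[of t] u t by (simp add: gap_var_def)
    then show "f u \<le> 1" unfolding f_def using g by simp
  qed
  define c where "c n = integral {0..r n} f" for n
  have fi: "f integrable_on {0..r n}" for n by (rule integrable_continuous_interval[OF fc])
  have "incseq c"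
    unfolding c_def using fi fb rmono by (intro incseq_def[THEN iffD2] allI impI integral_subset_le) auto
  moreover have "c n \<le> T" for n
  proof -
    have "c n \<le> integral {0..r n} (\<lambda>_. 1)" unfolding c_def using fi fb by (intro integral_le) auto
    then show ?thesis using r[of n] t by simp
  qed
  ultimately obtain c' where c': "c \<longlonglongrightarrow> c'" "\<And>n. c n \<le> c'" using incseq_convergent by blast
  \<comment> \<open>The first interval ends at t / 2 > 0. A nonnegative continuous integrand with
    zero integral there would vanish at 0, contrary to the strict decrease of
    \<open>tail_var\<close>.\<close>
  have "c 0 \<noteq> 0"
  proof
    assume "c 0 = 0"
    then have "f 0 = 0"
      using integral_eq_0_iff[OF fc r(1), of 0] fb(1)[of _ 0] r(1)[of 0] unfolding c_def by auto
    then show False using less gap_var_pos[of 0] T by (simp add: f_def)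
  qed
  moreover have "0 \<le> c 0" unfolding c_def using fi fb by (intro Henstock_Kurzweil_Integration.integral_nonneg) auto
  ultimately have "0 < c'" using c'(2)[of 0] by simp
  moreover have "(CLINT x|M. iexp (l * V t x + \<theta> * (innovation t x - innovation 0 x))) =
    complex_of_real (exp (- (l\<^sup>2 * (T + tail_var t) + 2 * \<theta> * l * c' + \<theta>\<^sup>2 * t) / 2))" for l \<theta>
  proof -
    have m: "V t \<in> borel_measurable M" "innovation t \<in> borel_measurable M" "innovation 0 \<in> borel_measurable M"
      "\<And>n. innovation (r n) \<in> borel_measurable M"
    proof -
      show "innovation (r n) \<in> borel_measurable M" for n using r[of n] t by (intro innovation_measurable) auto
    qed (use t in \<open>auto intro!: V_measurable innovation_measurable\<close>)
    have "(\<lambda>n. CLINT x|M. iexp (l * V t x + \<theta> * (innovation (r n) x - innovation 0 x))) \<longlonglongrightarrow>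
       (CLINT x|M. iexp (l * V t x + \<theta> * (innovation t x - innovation 0 x)))"
    proof (rule iexp_tendsto(2))
      show "AE x in M. (\<lambda>n. l * V t x + \<theta> * (innovation (r n) x - innovation 0 x)) \<longlonglongrightarrow>
        l * V t x + \<theta> * (innovation t x - innovation 0 x)"
        using AE_good_path
      proof eventually_elim
        case (elim x)
        have "r n \<in> {0..T}" for n using r[of n] t by auto
        then have "(\<lambda>n. innovation (r n) x) \<longlonglongrightarrow> innovation t x"
          using t by (intro continuous_on_tendsto_compose[OF innovation_continuous[OF elim] rlim] always_eventually) auto
        then show ?case by (intro tendsto_intros)
      qed
    qed (use m in simp_all)
    moreover have "(CLINT x|M. iexp (l * V t x + \<theta> * (innovation (r n) x - innovation 0 x))) =
       complex_of_real (exp (- (l\<^sup>2 * (T + tail_var t) + 2 * \<theta> * l * c n + \<theta>\<^sup>2 * r n) / 2))" for n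
      unfolding c_def f_def using r[of n] t by (intro innovation_V_iexp) auto
    moreover have "(\<lambda>n. complex_of_real (exp (- (l\<^sup>2 * (T + tail_var t) + 2 * \<theta> * l * c n + \<theta>\<^sup>2 * r n) / 2))) \<longlonglongrightarrow>
       complex_of_real (exp (- (l\<^sup>2 * (T + tail_var t) + 2 * \<theta> * l * c' + \<theta>\<^sup>2 * t) / 2))"
      using c'(1) rlim by (intro tendsto_intros) auto
    ultimately show ?thesis using LIMSEQ_unique by simp
  qed
  ultimately show ?thesis by (rule that)
qed

text \<open>Polarization: the joint transform gives normal laws for the innovation increment, for
  \<open>V t\<close> and for their sum, and the three variances determine the mixed moment as c > 0.
  The increment from time 0 replaces the innovation because \<open>innovation 0\<close> vanishes
  only almost surely.\<close>

lemma covariance_innovation_V: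
  assumes t: "t \<in> {0..T}" and nz: "\<not> (AE s in lborel. s \<in> {0..t} \<longrightarrow> \<sigma> s = 0)"
  shows "covariance M (innovation t) (V t) \<noteq> 0"
proof -
  have less: "tail_var t < tail_var 0" by (rule tail_var_less[OF t nz])
  then have "t \<noteq> 0" by auto
  then have t0: "0 < t" "t \<le> T" using t by auto
  obtain c where c: "0 < c" and cf: "\<And>l \<theta>. (CLINT x|M. iexp (l * V t x + \<theta> * (innovation t x - innovation 0 x))) =
    complex_of_real (exp (- (l\<^sup>2 * (T + tail_var t) + 2 * \<theta> * l * c + \<theta>\<^sup>2 * t) / 2))"
    by (rule innovation_V_joint_iexp[OF t0 less], rule that)
  define X where "X x = innovation t x - innovation 0 x" for x
  have Xm: "X \<in> borel_measurable M" unfolding X_def[abs_def]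
    using t0 by (intro borel_measurable_diff innovation_measurable) auto
  have Vm: "V t \<in> borel_measurable M" using t by (rule V_measurable)
  have tv: "0 \<le> tail_var t" using tail_integral(3)[OF t] .
  have dX: "distributed M lborel X (normal_density 0 (sqrt t))"
  proof (rule distributed_normal_of_iexp[OF t0(1) Xm])
    show "(CLINT x|M. iexp (\<theta> * X x)) = complex_of_real (exp (- \<theta>\<^sup>2 * t / 2))" for \<theta>
      using cf[of 0 \<theta>] by (simp add: X_def)
  qed
  have dV: "distributed M lborel (V t) (normal_density 0 (sqrt (T + tail_var t)))"
  proof (rule distributed_normal_of_iexp[OF _ Vm])
    show "(CLINT x|M. iexp (\<theta> * V t x)) = complex_of_real (exp (- \<theta>\<^sup>2 * (T + tail_var t) / 2))" for \<theta>
      using cf[of \<theta> 0] by simp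
  qed (use T tv in simp)
  have dS: "distributed M lborel (\<lambda>x. V t x + X x) (normal_density 0 (sqrt (T + tail_var t + 2 * c + t)))"
  proof (rule distributed_normal_of_iexp)
    fix \<theta>
    have "(CLINT x|M. iexp (\<theta> * (V t x + X x))) = (CLINT x|M. iexp (\<theta> * V t x + \<theta> * (innovation t x - innovation 0 x)))"
      by (simp add: X_def distrib_left)
    also have "\<dots> = complex_of_real (exp (- \<theta>\<^sup>2 * (T + tail_var t + 2 * c + t) / 2))"
      unfolding cf by (simp add: algebra_simps power2_eq_square)
    finally show "(CLINT x|M. iexp (\<theta> * (V t x + X x))) = complex_of_real (exp (- \<theta>\<^sup>2 * (T + tail_var t + 2 * c + t) / 2))" .
  qed (use T tv c t0 Xm Vm in auto)
  have pos: "0 < t" "0 < T + tail_var t" "0 < T + tail_var t + 2 * c + t" using T tv c t0 by auto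
  note mX = centred_normal_moments[OF pos(1) dX] and mV = centred_normal_moments[OF pos(2) dV]
    and mS = centred_normal_moments[OF pos(3) dS]
  have prod: "X x * V t x = ((V t x + X x)\<^sup>2 - (X x)\<^sup>2 - (V t x)\<^sup>2) / 2" for x
    by (simp add: power2_eq_square algebra_simps)
  have cXV: "(\<integral>x. X x * V t x \<partial>M) = c"
    unfolding prod using mX(3,4) mV(3,4) mS(3,4) by simp
  have AE0: "AE x in M. innovation t x = X x"
    using AE_good_path by eventually_elim (simp add: X_def innovation_0)
  have im: "innovation t \<in> borel_measurable M" using t by (rule innovation_measurable)
  have "(\<integral>x. innovation t x \<partial>M) = 0"
    using integral_cong_AE[OF im Xm AE0] mX(2) by simp
  then have "covariance M (innovation t) (V t) = (\<integral>x. innovation t x * V t x \<partial>M)"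
    using mV(2) by (simp add: covariance_def)
  also have "\<dots> = (\<integral>x. X x * V t x \<partial>M)"
    using AE0 im Xm Vm by (intro integral_cong_AE) auto
  finally show ?thesis using cXV c by simp
qed

section \<open>Brownian motion, martingale and Doob-Meyer properties\<close>

lemma innovation_enl_measurable:
  assumes "t \<in> {0..T}"
  shows "innovation t \<in> borel_measurable (enl t)"
proof (rule measurable_from_subalg[OF _ innovation_obs_measurable[OF assms]])
  show "subalgebra (enl t) (obs t)"
    unfolding subalgebra_def using enl_props(1,3) obs_filtration(2) by simp
qed

lemma brownian_motion_innovation: "brownian_motion M enl T innovation"
  unfolding brownian_motion_def adapted_on_def
proof (intro conjI ballI allI impI)
  show "filtration_on M enl" by (rule enl_props(4))
  show "innovation t \<in> borel_measurable (enl t)" if "t \<in> {0..T}" for t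
    using that by (rule innovation_enl_measurable)
  show "AE \<omega> in M. innovation 0 \<omega> = 0"
    using AE_good_path by eventually_elim (rule innovation_0)
  show "AE \<omega> in M. continuous_on {0..T} (\<lambda>t. innovation t \<omega>)"
    using AE_good_path by eventually_elim (rule innovation_continuous)
qed (auto intro!: innovation_increment)

lemma innovation_integrable:
  assumes t: "t \<in> {0..T}"
  shows "integrable M (innovation t)"
proof -
  have im: "innovation t \<in> borel_measurable M" using t by (rule innovation_measurable)
  show ?thesis
  proof (cases "t = 0")
    \<comment> \<open>At time 0 there is no increment of positive length with a normal density; the
      variable is almost surely 0 instead.\<close>
    case True
    have "AE x in M. innovation t x = 0" unfolding True using AE_good_path by eventually_elim (rule innovation_0)
    then show ?thesis using im by (subst integrable_cong_AE[of _ _ "\<lambda>_. 0"]) auto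
  next
    case False
    then have t0: "0 < t" "t \<le> T" using t by auto
    have "integrable M (\<lambda>\<omega>. innovation t \<omega> - innovation 0 \<omega>)"
      using centred_normal_moments(1)[of t] innovation_increment(1)[of 0 t] t0 by simp
    moreover have "AE x in M. innovation t x - innovation 0 x = innovation t x"
      using AE_good_path by eventually_elim (simp add: innovation_0)
    ultimately show ?thesis
      using im T by (subst integrable_cong_AE[symmetric]) (auto intro: borel_measurable_integrable)
  qed
qed

lemma martingale_innovation: "martingale_on M enl {0..<T} innovation"
  unfolding martingale_on_def adapted_on_def
proof (intro conjI ballI impI)
  show "filtration_on M enl" by (rule enl_props(4))
  show "innovation t \<in> borel_measurable (enl t)" if "t \<in> {0..<T}" for t
    using that by (intro innovation_enl_measurable) auto
  show "integrable M (innovation t)" if "t \<in> {0..<T}" for t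
    using that by (intro innovation_integrable) auto
  fix s t assume s: "s \<in> {0..<T}" and t: "t \<in> {0..<T}" and st: "s \<le> t"
  let ?F = "enl s"
  have subF: "subalgebra M ?F" using enl_props(4) by (simp add: filtration_on_def)
  interpret finite_measure_subalgebra M ?F
    by unfold_locales (rule subF)
  have i: "integrable M (innovation s)" "integrable M (innovation t)"
    using s t by (auto intro!: innovation_integrable)
  have ms: "innovation s \<in> borel_measurable ?F" using s by (intro innovation_enl_measurable) auto
  show "AE \<omega> in M. real_cond_exp M ?F (innovation t) \<omega> = innovation s \<omega>"
  proof (rule real_cond_exp_charact[OF _ i(2,1) ms])
    fix A assume A: "A \<in> sets ?F"
    have AM: "A \<in> sets M" using A subF by (auto simp: subalgebra_def)
    show "(\<integral>x\<in>A. innovation t x \<partial>M) = (\<integral>x\<in>A. innovation s x \<partial>M)"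
    proof (cases "s = t")
      case False
      then have st': "0 \<le> s" "s < t" "t \<le> T" using s t st by auto
      let ?Z = "\<lambda>\<omega>. innovation t \<omega> - innovation s \<omega>"
      have Zm: "?Z \<in> borel_measurable M" using i by (intro borel_measurable_diff) auto
      have iA: "integrable M (indicator A :: _ \<Rightarrow> real)" using AM by (simp add: emeasure_eq_measure)
      have iZ: "integrable M ?Z" "(\<integral>x. ?Z x \<partial>M) = 0"
        using centred_normal_moments(1,2)[OF _ innovation_increment(1)[OF st']] st' by auto
      \<comment> \<open>Independence from A turns the integral of the increment over A into a
        product with its mean, which is 0.\<close>
      have "indep_var borel (indicator A :: _ \<Rightarrow> real) borel ?Z"
      proof (rule indep_var_of_indep_set[OF innovation_increment(2)[OF st']])
        have "indicator A \<in> borel_measurable ?F" using A by simp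
        from measurable_sets[OF this]
        show "(indicator A :: _ \<Rightarrow> real) -` C \<inter> space M \<in> sets ?F" if "C \<in> sets borel" for C
          using that enl_props(1)[of s] by simp
      qed (use AM Zm in auto)
      from indep_var_lebesgue_integral[OF this iA iZ(1)]
      have "(\<integral>x. indicator A x * ?Z x \<partial>M) = 0" using iZ(2) by simp
      moreover have "integrable M (\<lambda>x. indicator A x * innovation r x)" if "integrable M (innovation r)" for r
        using integrable_mult_indicator[OF AM that] by simp
      ultimately show ?thesis
        using i unfolding set_lebesgue_integral_def by (simp add: right_diff_distrib)
    qed simp
  qed
qed

text \<open>For t < T the drift is continuous on the compact interval [0, t], hence bounded by some
  K, and the cumulative drift is Lipschitz there. Its variation is at most
  \<open>K * t\<close>.\<close>

lemma cum_drift_finite_variation: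
  assumes g: "good_path \<omega>" and t: "t \<in> {0..<T}"
  shows "finite_variation_on 0 t (\<lambda>s. cum_drift s \<omega>)"
proof -
  note d = good_path_drift[OF g]
  have c: "continuous_on {0..t} (\<lambda>s. drift s \<omega>)" using t by (intro continuous_on_subset[OF d(1)]) auto
  then have "compact ((\<lambda>s. drift s \<omega>) ` {0..t})" by (intro compact_continuous_image) auto
  then have "bounded ((\<lambda>s. drift s \<omega>) ` {0..t})" by (rule compact_imp_bounded)
  then obtain K where "\<forall>x\<in>(\<lambda>s. drift s \<omega>) ` {0..t}. norm x \<le> K" unfolding bounded_iff by blast
  then have K: "norm (drift s \<omega>) \<le> K" if "s \<in> {0..t}" for s using that by blast
  show ?thesis
    unfolding finite_variation_on_def
  proof (intro exI[of _ "K * t"] allI impI)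
    fix n p assume p: "partition_of 0 t n p"
    note mono = partition_of_mono[OF p]
    have pt: "p i \<in> {0..t}" if "i \<le> n" for i
      using partition_of_mem[OF p that] .
    have "\<bar>cum_drift (p (Suc i)) \<omega> - cum_drift (p i) \<omega>\<bar> \<le> K * (p (Suc i) - p i)" if "i < n" for i
    proof -
      have le: "0 \<le> p i" "p i \<le> p (Suc i)" "p (Suc i) \<le> t" using pt[of i] pt[of "Suc i"] mono[of i "Suc i"] that by auto
      have "integral {0..p (Suc i)} (\<lambda>s. drift s \<omega>) = integral {0..p i} (\<lambda>s. drift s \<omega>) + integral {p i..p (Suc i)} (\<lambda>s. drift s \<omega>)"
        using le t by (intro Henstock_Kurzweil_Integration.integral_combine[symmetric] integrable_on_subinterval[OF d(2)]) auto
      then have "cum_drift (p (Suc i)) \<omega> - cum_drift (p i) \<omega> = integral {p i..p (Suc i)} (\<lambda>s. drift s \<omega>)"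
        using le t by (simp add: cum_drift_eq[OF g])
      moreover have "norm (integral {p i..p (Suc i)} (\<lambda>s. drift s \<omega>)) \<le> K * (p (Suc i) - p i)"
        using le K by (intro integral_bound continuous_on_subset[OF c]) auto
      ultimately show ?thesis by simp
    qed
    then have "(\<Sum>i<n. \<bar>cum_drift (p (Suc i)) \<omega> - cum_drift (p i) \<omega>\<bar>) \<le> (\<Sum>i<n. K * (p (Suc i) - p i))"
      by (intro sum_mono) auto
    also have "\<dots> = K * t"
      using p sum_lessThan_telescope[of p n] by (simp add: partition_of_def flip: sum_distrib_left)
    finally show "(\<Sum>i<n. \<bar>cum_drift (p (Suc i)) \<omega> - cum_drift (p i) \<omega>\<bar>) \<le> K * t" .
  qed
qed

lemma doob_meyer_innovation:
  "doob_meyer_decomposition M enl T B innovation cum_drift"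
  unfolding doob_meyer_decomposition_def
proof (intro conjI)
  show "martingale_on M enl {0..<T} innovation" by (rule martingale_innovation)
  show "AE \<omega> in M. continuous_on {0..<T} (\<lambda>t. innovation t \<omega>)"
    using AE_good_path by eventually_elim (auto intro: continuous_on_subset[OF innovation_continuous])
  show "(\<lambda>(t, \<omega>). cum_drift t \<omega>) \<in> borel_measurable (predictable_sigma enl T)"
    by (rule cum_drift_predictable)
  show "AE \<omega> in M. cum_drift 0 \<omega> = 0"
    using AE_good_path by eventually_elim (use T in \<open>simp add: cum_drift_eq\<close>)
  show "AE \<omega> in M. continuous_on {0..<T} (\<lambda>t. cum_drift t \<omega>)"
    using AE_good_path
  proof eventually_elim
    case (elim \<omega>)
    have "continuous_on {0..<T} (\<lambda>t. integral {0..t} (\<lambda>s. drift s \<omega>))"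
      by (rule continuous_on_subset[OF good_path_drift(3)[OF elim]]) auto
    then show ?case by (rule continuous_on_eq) (simp add: cum_drift_eq[OF elim])
  qed
  show "AE \<omega> in M. \<forall>t\<in>{0..<T}. finite_variation_on 0 t (\<lambda>s. cum_drift s \<omega>)"
    using AE_good_path by eventually_elim (auto intro: cum_drift_finite_variation)
  show "AE \<omega> in M. \<forall>t\<in>{0..<T}. B t \<omega> = innovation t \<omega> + cum_drift t \<omega>"
    by (simp add: innovation_def)
qed

lemma cum_drift_integral:
  "AE \<omega> in M. \<forall>t\<in>{0..<T}. set_integrable lborel {0..t} (\<lambda>s. drift s \<omega>) \<and>
     cum_drift t \<omega> = (LINT s:{0..t}|lborel. drift s \<omega>)"
  using AE_good_path
proof eventually_elim
  case (elim \<omega>)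
  show ?case
  proof
    fix t assume "t \<in> {0..<T}"
    then have i: "set_integrable lborel {0..t} (\<lambda>s. drift s \<omega>)" using good_path_drift(4)[OF elim] by simp
    with \<open>t \<in> {0..<T}\<close> show "set_integrable lborel {0..t} (\<lambda>s. drift s \<omega>) \<and>
     cum_drift t \<omega> = (LINT s:{0..t}|lborel. drift s \<omega>)"
      by (simp add: cum_drift_eq[OF elim] set_borel_integral_eq_integral(2))
  qed
qed

end

theorem proposition16:
  fixes M :: "'a measure" and T :: real and \<sigma> :: "real \<Rightarrow> real"
    and B W S V :: "real \<Rightarrow> 'a \<Rightarrow> real" and F :: "real \<Rightarrow> 'a measure"
  assumes "prob_space M"
    and "T > 0"
    and "brownian_motion M (natural_filtration M T B) T B"
    and "brownian_motion M (natural_filtration M T W) T W"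
    and "prob_space.indep_set M
           (sets (natural_filtration M T B T)) (sets (natural_filtration M T W T))"
    and "set_borel_measurable borel {0..T} \<sigma>"
    and "\<And>t. t \<in> {0..T} \<Longrightarrow> set_integrable lborel {t..T} (\<lambda>s. (\<sigma> s)\<^sup>2)"
    and "\<And>t. t \<in> {0..T} \<Longrightarrow> has_wiener_integral M W t T \<sigma> (S t)"
    and "AE \<omega> in M. continuous_on {0..T} (\<lambda>t. S t \<omega>)"
    and "\<And>t \<omega>. t \<in> {0..T} \<Longrightarrow> \<omega> \<in> space M \<Longrightarrow> V t \<omega> = B T \<omega> + S t \<omega>"
    and "\<And>t. t \<in> {0..<T} \<Longrightarrow>
           set_integrable lborel {0..t} (\<lambda>s. T / (T + (LINT u:{s..T}|lborel. (\<sigma> u)\<^sup>2) - s))"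
    and F_def: "F = right_cont_filtration (natural_filtration M T (\<lambda>t \<omega>. (B t \<omega>, V t \<omega>)))"
  shows "\<exists>Wt A.
      doob_meyer_decomposition M F T B Wt A \<and>
      (AE \<omega> in M. \<forall>t\<in>{0..<T}.
         set_integrable lborel {0..t}
           (\<lambda>s. (V s \<omega> - B s \<omega>) / (T + (LINT u:{s..T}|lborel. (\<sigma> u)\<^sup>2) - s)) \<and>
         A t \<omega> = (LINT s:{0..t}|lborel.
           (V s \<omega> - B s \<omega>) / (T + (LINT u:{s..T}|lborel. (\<sigma> u)\<^sup>2) - s))) \<and>
      brownian_motion M F T Wt \<and>
      (\<forall>t\<in>{0..T}. \<not> (AE s in lborel. s \<in> {0..t} \<longrightarrow> \<sigma> s = 0) \<longrightarrow>
         covariance M (Wt t) (V t) \<noteq> 0)"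
proof -
  interpret prob_space M by fact
  \<comment> \<open>Square integrability of \<sigma> on the whole horizon is the corresponding
    hypothesis at t = 0.\<close>
  interpret brownian_enlargement M T B W \<sigma> S V
    by unfold_locales (use assms in auto)
  have F: "F = enl" unfolding F_def obs_def ..
  show ?thesis
    unfolding F
    using doob_meyer_innovation cum_drift_integral brownian_motion_innovation covariance_innovation_V
    unfolding drift_def gap_var_def tail_var_def by blast
qed

end
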